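(* Let $(G_n)_{n\ge1}$ be a random sequence in $\Pi(\mathcal K)$ with $|V(G_n)|\to\infty$ in probability. Then the following are equivalent: (1) $\tau^+(G_n)\to\Gamma$ in distribution for some random $\Gamma\in\overline{\Pi(\mathcal K)^+}\setminus\Pi(\mathcal K)^+$; (2) $\hat G_n\to H$ in distribution in $\mathcal L_\infty$, for some random element $H$ of $\mathcal L_\infty$. If either holds, then $\mathbb E\,t(F,\Gamma)=\mathbb E\,t_{\mathrm{inj}}(F,H|_{[k]})$ for every $F\in\Pi(\mathcal C)$ with $V(F)=[k]$, and $H$ is exchangeable.
   Context: Fix an integer $r\ge1$ and a compact Polish space $\mathcal K$. Let $\mathcal C$ be the space of continuous real functions on $\mathcal K$ and $\mathcal F\subset\mathcal C$ a countable set with $\|f\|_\infty\le1$ for $f\in\mathcal F$ whose linear span is sup-norm dense in $\mathcal C$. For a set $S$, an $S$-decorated directed $r$-uniform hypergraph $G$ is a finite vertex set $V(G)$ with an $r$-array $G:V(G)^r\to S$; $\Pi(S)$ is the set of isomorphism classes. For $F\in\Pi(\mathcal C)$ with $V(F)=[m]$ and $G\in\Pi(\mathcal K)$: $t(F,G)=|V(G)|^{-m}\sum_{\phi:[m]\to V(G)}\prod_{(i_1,\dots,i_r)\in[m]^r}F_{i_1,\dots,i_r}(G_{\phi(i_1),\dots,\phi(i_r)})$, and $t_{\mathrm{inj}}(F,G)$ is the average over injective $\phi$ only; for labeled $G$ these are computed on the underlying unlabeled object. $\tau^+(G)=((t(F,G))_{F\in\Pi(\mathcal F)},1/|V(G)|)\in[-1,1]^{\Pi(\mathcal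 F)}\times[0,1]$ (product topology); $\Pi(\mathcal K)^+=\tau^+(\Pi(\mathcal K))$, $\overline{\Pi(\mathcal K)^+}$ its closure, and for $\Gamma$ in the closure, $t(F,\Gamma)$ is the continuous extension of $t(F,\cdot)$ (for $F\in\Pi(\mathcal F)$ this is the $F$-coordinate of $\Gamma$). $\mathcal L_n$ denotes the set of $\mathcal K$-decorated directed $r$-uniform hypergraphs with vertex set labeled by $[n]$, and $\mathcal L_\infty$ those with vertex set $\mathbb N$; $\mathcal L_n$ is regarded as a subset of $\mathcal L_\infty$ by adding isolated vertices labeled $\mathbb N\setminus[n]$. $\mathcal L_\infty$ carries the product topology, so convergence in distribution in $\mathcal L_\infty$ means convergence in distribution of all finite restrictions. For $H\in\mathcal L_\infty$, $H|_{[k]}\in\mathcal L_k$ is the restriction to the vertices $[k]$. For a (random) hypergraph $G$ with $n$ vertices, $\hat G$ is the random element of $\mathcal L_n$ obtained by forgetting any labels and applying a uniformly random labeling by $[n]$. A random element of $\mathcal L_\infty$ is exchangeable if its distribution is invariant under every permutation of $\mathbb N$ moving only finitely many elements. *)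

theory Defs
  imports "HOL-Probability.Probability"
begin

section \<open>Decorated directed uniform hypergraphs\<close>

text \<open>
  The uniformity \<open>r \<ge> 1\<close> is the cardinality of the finite type \<open>'r\<close> of positions, so an
  \<open>r\<close>-tuple of vertices is a function \<open>'r \<Rightarrow> nat\<close>. The vertex set \<open>[n]\<close> is \<open>{..<n}\<close>, and \<open>n > 0\<close>
  throughout. A pair \<open>(n, A)\<close> stands for the hypergraph with vertex set \<open>[n]\<close> and array \<open>A\<close>;
  the values of \<open>A\<close> outside \<open>tuples n\<close> are irrelevant.
\<close>

abbreviation tuples :: "nat \<Rightarrow> ('r \<Rightarrow> nat) set" where
  "tuples n \<equiv> UNIV \<rightarrow> {..<n}"

fun hiso :: "nat \<times> (('r \<Rightarrow> nat) \<Rightarrow> 's) \<Rightarrow> nat \<times> (('r \<Rightarrow> nat) \<Rightarrow> 's) \<Rightarrow> bool" where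
  "hiso (n, A) (m, B) \<longleftrightarrow>
     n > 0 \<and> m > 0 \<and>
     (\<exists>\<sigma>. bij_betw \<sigma> {..<n} {..<m} \<and> (\<forall>v \<in> tuples n. B (\<sigma> \<circ> v) = A v))"

lemma hisoE:
  assumes "hiso (n, A) (m, B)"
  obtains \<sigma> where "m = n" "n > 0" "bij_betw \<sigma> {..<n} {..<n}" "\<And>v. v \<in> tuples n \<Longrightarrow> B (\<sigma> \<circ> v) = A v"
proof -
  obtain \<sigma> where s: "n > 0" "bij_betw \<sigma> {..<n} {..<m}" "\<forall>v \<in> tuples n. B (\<sigma> \<circ> v) = A v"
    using assms unfolding hiso.simps by blast
  have "m = n"
    using bij_betw_same_card[OF s(2)] by simp
  with s show thesis
    by (intro that[of \<sigma>]) auto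
qed

lemma hisoI:
  assumes "n > 0" "bij_betw \<sigma> {..<n} {..<n}" "\<And>v. v \<in> tuples n \<Longrightarrow> B (\<sigma> \<circ> v) = A v"
  shows "hiso (n, A) (n, B)"
  unfolding hiso.simps using assms by blast

declare hiso.simps [simp del]

lemma tuples_comp:
  assumes "bij_betw \<sigma> {..<n} {..<n}" "v \<in> tuples n"
  shows "\<sigma> \<circ> v \<in> tuples n"
  using assms by (auto simp: bij_betw_def Pi_iff)

lemma hiso_refl: "n > 0 \<Longrightarrow> hiso (n, A) (n, A)"
  by (rule hisoI[of _ id]) auto

lemma hiso_sym:
  assumes "hiso x y"
  shows "hiso y x"
proof -
  obtain n A m B where xy: "x = (n, A)" "y = (m, B)"
    using surj_pair[of x] surj_pair[of y] by blast
  obtain \<sigma> where s: "m = n" "n > 0" "bij_betw \<sigma> {..<n} {..<n}"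
    "\<And>v. v \<in> tuples n \<Longrightarrow> B (\<sigma> \<circ> v) = A v"
    using assms unfolding xy by (rule hisoE) blast
  define \<tau> where "\<tau> = the_inv_into {..<n} \<sigma>"
  have t: "bij_betw \<tau> {..<n} {..<n}"
    unfolding \<tau>_def by (rule bij_betw_the_inv_into[OF s(3)])
  have "A (\<tau> \<circ> v) = B v" if "v \<in> tuples n" for v
  proof -
    have "\<tau> \<circ> v \<in> tuples n"
      by (rule tuples_comp[OF t that])
    moreover have "\<sigma> \<circ> (\<tau> \<circ> v) = v"
    proof
      fix i
      have "v i \<in> \<sigma> ` {..<n}"
        using that s(3) by (auto simp: bij_betw_def)
      then show "(\<sigma> \<circ> (\<tau> \<circ> v)) i = v i"
        using s(3) by (simp add: \<tau>_def bij_betw_def f_the_inv_into_f)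
    qed
    ultimately show ?thesis
      using s(4)[of "\<tau> \<circ> v"] by simp
  qed
  then show ?thesis
    unfolding xy s(1) by (intro hisoI[OF s(2) t])
qed

lemma hiso_trans:
  assumes "hiso x y" "hiso y z"
  shows "hiso x z"
proof -
  obtain n A m B l C where xyz: "x = (n, A)" "y = (m, B)" "z = (l, C)"
    using surj_pair[of x] surj_pair[of y] surj_pair[of z] by blast
  obtain \<sigma> where s: "m = n" "n > 0" "bij_betw \<sigma> {..<n} {..<n}"
    "\<And>v. v \<in> tuples n \<Longrightarrow> B (\<sigma> \<circ> v) = A v"
    using assms(1) unfolding xyz by (rule hisoE) blast
  obtain \<tau> where t: "l = m" "m > 0" "bij_betw \<tau> {..<m} {..<m}"
    "\<And>v. v \<in> tuples m \<Longrightarrow> C (\<tau> \<circ> v) = B v"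
    using assms(2) unfolding xyz by (rule hisoE) blast
  have comp: "C (\<tau> \<circ> \<sigma> \<circ> v) = A v" if "v \<in> tuples n" for v
  proof -
    have "\<sigma> \<circ> v \<in> tuples m"
      unfolding s(1) by (rule tuples_comp[OF s(3) that])
    then show ?thesis
      using s(4)[OF that] t(4)[of "\<sigma> \<circ> v"] by (simp add: comp_assoc)
  qed
  have bij: "bij_betw (\<tau> \<circ> \<sigma>) {..<n} {..<n}"
    by (rule bij_betw_trans[OF s(3) t(3)[unfolded s(1)]])
  show ?thesis
    unfolding xyz t(1) s(1) by (rule hisoI[OF s(2) bij]) (rule comp)
qed

text \<open>\<open>('r, 's) hypergraph\<close> is the set \<open>\<Pi>(S)\<close> of isomorphism classes for \<open>S = UNIV :: 's set\<close>.\<close>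

quotient_type ('r, 's) hypergraph = "nat \<times> (('r \<Rightarrow> nat) \<Rightarrow> 's)" / partial: hiso
proof (rule part_equivpI)
  show "\<exists>x. hiso x x"
    using hiso_refl[OF zero_less_one] by (rule exI)
  show "symp hiso"
    by (rule sympI) (rule hiso_sym)
  show "transp hiso"
    by (rule transpI) (rule hiso_trans)
qed

definition unlabel :: "nat \<Rightarrow> (('r \<Rightarrow> nat) \<Rightarrow> 's) \<Rightarrow> ('r, 's) hypergraph" where
  "unlabel n A = abs_hypergraph (n, A)"

lift_definition nverts :: "('r, 's) hypergraph \<Rightarrow> nat" is fst
proof -
  fix x y :: "nat \<times> (('r \<Rightarrow> nat) \<Rightarrow> 's)"
  assume xy: "hiso x y"
  obtain n A m B where eqs: "x = (n, A)" "y = (m, B)"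
    using surj_pair[of x] surj_pair[of y] by blast
  have "m = n"
    using xy unfolding eqs by (rule hisoE) assumption
  then show "fst x = fst y"
    by (simp add: eqs)
qed

lift_definition decorations :: "('r, 's) hypergraph \<Rightarrow> 's set" is "\<lambda>(n, A). A ` tuples n"
proof -
  have sub: "A ` tuples n \<subseteq> B ` tuples m"
    if iso: "hiso (n, A) (m, B)" for n m and A B :: "('r \<Rightarrow> nat) \<Rightarrow> 's"
  proof -
    obtain \<sigma> where s: "m = n" "n > 0" "bij_betw \<sigma> {..<n} {..<n}"
      "\<And>v. v \<in> tuples n \<Longrightarrow> B (\<sigma> \<circ> v) = A v"
      using iso by (rule hisoE) blast
    show ?thesis
    proof (rule image_subsetI)
      fix v :: "'r \<Rightarrow> nat" assume v: "v \<in> tuples n"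
      then have "\<sigma> \<circ> v \<in> tuples m"
        unfolding s(1) by (intro tuples_comp[OF s(3)])
      then show "A v \<in> B ` tuples m"
        using s(4)[OF v] by (metis image_eqI)
    qed
  qed
  fix x y :: "nat \<times> (('r \<Rightarrow> nat) \<Rightarrow> 's)"
  assume xy: "hiso x y"
  obtain n A m B where eqs: "x = (n, A)" "y = (m, B)"
    using surj_pair[of x] surj_pair[of y] by blast
  have "A ` tuples n = B ` tuples m"
    using sub[OF xy[unfolded eqs]] sub[OF hiso_sym[OF xy, unfolded eqs]] by (rule subset_antisym)
  then show "(case x of (n, A) \<Rightarrow> A ` tuples n) = (case y of (n, A) \<Rightarrow> A ` tuples n)"
    by (simp add: eqs)
qed

definition hypergraphs :: "'s set \<Rightarrow> ('r, 's) hypergraph set" where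
  "hypergraphs S = {G. decorations G \<subseteq> S}"

text \<open>
  The topology of \<open>\<Pi>(S)\<close>: the disjoint union over \<open>n\<close> of the quotients of the array spaces by
  relabeling.
\<close>

instantiation hypergraph :: (type, topological_space) topological_space
begin

definition open_hypergraph :: "('a, 'b) hypergraph set \<Rightarrow> bool" where
  "open_hypergraph U \<longleftrightarrow> (\<forall>n>0. open {A. unlabel n A \<in> U})"

instance
proof
  show "open (UNIV :: ('a, 'b) hypergraph set)"
    by (simp add: open_hypergraph_def)
next
  fix S T :: "('a, 'b) hypergraph set"
  assume "open S" "open T"
  then show "open (S \<inter> T)"
    by (auto simp: open_hypergraph_def Collect_conj_eq)
next
  fix K :: "('a, 'b) hypergraph set set"
  assume "\<forall>S\<in>K. open S"
  moreover have "{A. unlabel n A \<in> \<Union>K} = (\<Union>S\<in>K. {A. unlabel n A \<in> S})"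
    for n and K :: "('a, 'b) hypergraph set set"
    by auto
  ultimately show "open (\<Union>K)"
    unfolding open_hypergraph_def by auto
qed

end


section \<open>Homomorphism densities\<close>

text \<open>
  On a compact space every continuous function is bounded, so \<open>'k \<Rightarrow>\<^sub>C real\<close> is the space of
  continuous functions with the sup norm.
\<close>

definition hom_weight ::
  "nat \<Rightarrow> (('r::finite \<Rightarrow> nat) \<Rightarrow> ('k::topological_space \<Rightarrow>\<^sub>C real)) \<Rightarrow>
   (('r \<Rightarrow> nat) \<Rightarrow> 'k) \<Rightarrow> (nat \<Rightarrow> nat) \<Rightarrow> real" where
  "hom_weight m F G \<phi> = (\<Prod>v \<in> tuples m. apply_bcontfun (F v) (G (\<phi> \<circ> v)))"

definition inj_maps :: "nat \<Rightarrow> nat \<Rightarrow> (nat \<Rightarrow> nat) set" where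
  "inj_maps m n = {\<phi> \<in> {..<m} \<rightarrow>\<^sub>E {..<n}. inj_on \<phi> {..<m}}"

lemma hom_weight_transport:
  fixes F F' :: "('r::finite \<Rightarrow> nat) \<Rightarrow> ('k::topological_space \<Rightarrow>\<^sub>C real)"
  assumes F: "bij_betw \<rho> {..<m} {..<m}" "\<And>v. v \<in> tuples m \<Longrightarrow> F' (\<rho> \<circ> v) = F v"
    and G: "bij_betw \<sigma> {..<n} {..<n}" "\<And>v. v \<in> tuples n \<Longrightarrow> G' (\<sigma> \<circ> v) = G v"
    and \<phi>: "\<phi> \<in> {..<m} \<rightarrow>\<^sub>E {..<n}"
  shows "hom_weight m F' G' (restrict (\<sigma> \<circ> \<phi> \<circ> the_inv_into {..<m} \<rho>) {..<m}) = hom_weight m F G \<phi>"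
proof -
  define \<psi> where "\<psi> = restrict (\<sigma> \<circ> \<phi> \<circ> the_inv_into {..<m} \<rho>) {..<m}"
  have inj: "inj_on \<rho> {..<m}" and img: "\<rho> ` {..<m} = {..<m}"
    using F(1) by (auto simp: bij_betw_def)
  have bij: "bij_betw (\<lambda>v. \<rho> \<circ> v) (tuples m) (tuples m :: ('r \<Rightarrow> nat) set)"
  proof (rule bij_betw_byWitness[where f' = "\<lambda>v. the_inv_into {..<m} \<rho> \<circ> v"])
    have inv: "bij_betw (the_inv_into {..<m} \<rho>) {..<m} {..<m}"
      by (rule bij_betw_the_inv_into[OF F(1)])
    show "\<forall>v\<in>tuples m :: ('r \<Rightarrow> nat) set. the_inv_into {..<m} \<rho> \<circ> (\<rho> \<circ> v) = v"
      using inj by (auto simp: fun_eq_iff Pi_iff the_inv_into_f_f)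
    show "\<forall>v\<in>tuples m :: ('r \<Rightarrow> nat) set. \<rho> \<circ> (the_inv_into {..<m} \<rho> \<circ> v) = v"
      using inj img by (auto simp: fun_eq_iff Pi_iff f_the_inv_into_f)
    show "(\<circ>) \<rho> ` tuples m \<subseteq> (tuples m :: ('r \<Rightarrow> nat) set)"
      using img by (auto simp: Pi_iff)
    show "(\<circ>) (the_inv_into {..<m} \<rho>) ` tuples m \<subseteq> (tuples m :: ('r \<Rightarrow> nat) set)"
      using inv by (auto simp: Pi_iff bij_betw_def)
  qed
  have "hom_weight m F' G' \<psi>
      = (\<Prod>v \<in> tuples m. apply_bcontfun (F' (\<rho> \<circ> v)) (G' (\<psi> \<circ> (\<rho> \<circ> v))))"
    unfolding hom_weight_def by (rule prod.reindex_bij_betw[OF bij, symmetric])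
  also have "\<dots> = hom_weight m F G \<phi>"
    unfolding hom_weight_def
  proof (rule prod.cong[OF refl])
    fix v :: "'r \<Rightarrow> nat" assume v: "v \<in> tuples m"
    have "\<psi> \<circ> (\<rho> \<circ> v) = \<sigma> \<circ> (\<phi> \<circ> v)"
    proof
      fix i
      have "v i < m"
        using v by auto
      then have "\<rho> (v i) < m" "the_inv_into {..<m} \<rho> (\<rho> (v i)) = v i"
        using img inj by (auto simp: the_inv_into_f_f)
      then show "(\<psi> \<circ> (\<rho> \<circ> v)) i = (\<sigma> \<circ> (\<phi> \<circ> v)) i"
        by (simp add: \<psi>_def)
    qed
    moreover have "\<phi> \<circ> v \<in> tuples n"
      using v \<phi> by (auto simp: Pi_iff PiE_iff)
    ultimately show "apply_bcontfun (F' (\<rho> \<circ> v)) (G' (\<psi> \<circ> (\<rho> \<circ> v))) = apply_bcontfun (F v) (G (\<phi> \<circ> v))"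
      using F(2)[OF v] G(2)[of "\<phi> \<circ> v"] by simp
  qed
  finally show ?thesis
    unfolding \<psi>_def .
qed

lemma bij_betw_transport:
  assumes \<rho>: "bij_betw \<rho> {..<m} {..<m}" and \<sigma>: "bij_betw \<sigma> {..<n} {..<n}"
  defines "T \<equiv> \<lambda>\<phi>. restrict (\<sigma> \<circ> \<phi> \<circ> the_inv_into {..<m} \<rho>) {..<m::nat}"
  shows "bij_betw T ({..<m} \<rightarrow>\<^sub>E {..<n::nat}) ({..<m} \<rightarrow>\<^sub>E {..<n})"
    and "bij_betw T (inj_maps m n) (inj_maps m n)"
proof -
  define T' where "T' = (\<lambda>\<phi>. restrict (the_inv_into {..<n} \<sigma> \<circ> \<phi> \<circ> \<rho>) {..<m})"
  define \<rho>' where "\<rho>' = the_inv_into {..<m} \<rho>"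
  define \<sigma>' where "\<sigma>' = the_inv_into {..<n} \<sigma>"
  have \<rho>': "bij_betw \<rho>' {..<m} {..<m}" and \<sigma>': "bij_betw \<sigma>' {..<n} {..<n}"
    using \<rho> \<sigma> by (auto simp: \<rho>'_def \<sigma>'_def bij_betw_the_inv_into)
  have r: "\<rho> i < m" "\<rho>' i < m" "\<rho> (\<rho>' i) = i" "\<rho>' (\<rho> i) = i" if "i < m" for i
    using \<rho> \<rho>' that unfolding \<rho>'_def
    by (auto simp: bij_betw_def f_the_inv_into_f the_inv_into_f_f)
  have s: "\<sigma> i < n" "\<sigma>' i < n" "\<sigma> (\<sigma>' i) = i" "\<sigma>' (\<sigma> i) = i" if "i < n" for i
    using \<sigma> \<sigma>' that unfolding \<sigma>'_def
    by (auto simp: bij_betw_def f_the_inv_into_f the_inv_into_f_f)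
  have T: "T \<phi> = restrict (\<sigma> \<circ> \<phi> \<circ> \<rho>') {..<m}" and T': "T' \<phi> = restrict (\<sigma>' \<circ> \<phi> \<circ> \<rho>) {..<m}" for \<phi>
    by (simp_all add: T_def T'_def \<rho>'_def \<sigma>'_def)
  have TP: "T \<phi> \<in> {..<m} \<rightarrow>\<^sub>E {..<n}" "T' \<phi> \<in> {..<m} \<rightarrow>\<^sub>E {..<n}" "T' (T \<phi>) = \<phi>" "T (T' \<phi>) = \<phi>"
    if "\<phi> \<in> {..<m} \<rightarrow>\<^sub>E {..<n}" for \<phi>
  proof -
    have p: "\<phi> i < n" if "i < m" for i
      using \<open>\<phi> \<in> _\<close> that by auto
    have q: "\<phi> i = undefined" if "\<not> i < m" for i
      using \<open>\<phi> \<in> _\<close> that by (auto simp: PiE_iff extensional_def)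
    show "T \<phi> \<in> {..<m} \<rightarrow>\<^sub>E {..<n}" "T' \<phi> \<in> {..<m} \<rightarrow>\<^sub>E {..<n}"
      using p r s by (auto simp: T T')
    show "T' (T \<phi>) = \<phi>" "T (T' \<phi>) = \<phi>"
      using p q r s by (auto simp: T T' fun_eq_iff restrict_def)
  qed
  have inj: "inj_on (T \<phi>) {..<m}" "inj_on (T' \<phi>) {..<m}"
    if "\<phi> \<in> {..<m} \<rightarrow>\<^sub>E {..<n}" "inj_on \<phi> {..<m}" for \<phi>
  proof -
    have p: "\<phi> i < n" if "i < m" for i
      using \<open>\<phi> \<in> _\<close> that by auto
    show "inj_on (T \<phi>) {..<m}"
    proof (rule inj_onI)
      fix i j assume ij: "i \<in> {..<m}" "j \<in> {..<m}" and eq: "T \<phi> i = T \<phi> j"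
      then have "\<sigma> (\<phi> (\<rho>' i)) = \<sigma> (\<phi> (\<rho>' j))"
        by (simp add: T)
      then have "\<phi> (\<rho>' i) = \<phi> (\<rho>' j)"
        using p r s ij by (metis lessThan_iff)
      then have "\<rho>' i = \<rho>' j"
        using that(2) r ij by (auto dest: inj_onD)
      then show "i = j"
        using r ij by (metis lessThan_iff)
    qed
    show "inj_on (T' \<phi>) {..<m}"
    proof (rule inj_onI)
      fix i j assume ij: "i \<in> {..<m}" "j \<in> {..<m}" and eq: "T' \<phi> i = T' \<phi> j"
      then have "\<sigma>' (\<phi> (\<rho> i)) = \<sigma>' (\<phi> (\<rho> j))"
        by (simp add: T')
      then have "\<phi> (\<rho> i) = \<phi> (\<rho> j)"
        using p r s ij by (metis lessThan_iff)
      then have "\<rho> i = \<rho> j"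
        using that(2) r ij by (auto dest: inj_onD)
      then show "i = j"
        using r ij by (metis lessThan_iff)
    qed
  qed
  show "bij_betw T ({..<m} \<rightarrow>\<^sub>E {..<n}) ({..<m} \<rightarrow>\<^sub>E {..<n})"
    by (rule bij_betw_byWitness[where f' = T']) (use TP in auto)
  show "bij_betw T (inj_maps m n) (inj_maps m n)"
    by (rule bij_betw_byWitness[where f' = T']) (use TP inj in \<open>auto simp: inj_maps_def\<close>)
qed

lift_definition hom_density ::
  "('r::finite, 'k::topological_space \<Rightarrow>\<^sub>C real) hypergraph \<Rightarrow> ('r, 'k) hypergraph \<Rightarrow> real" is
  "\<lambda>(m, F) (n, G). (\<Sum>\<phi> \<in> {..<m} \<rightarrow>\<^sub>E {..<n}. hom_weight m F G \<phi>) / real n ^ m"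
proof -
  fix x x' :: "nat \<times> (('r \<Rightarrow> nat) \<Rightarrow> ('k \<Rightarrow>\<^sub>C real))" and y y' :: "nat \<times> (('r \<Rightarrow> nat) \<Rightarrow> 'k)"
  assume xy: "hiso x x'" "hiso y y'"
  obtain m F m' F' n G n' G' where eqs: "x = (m, F)" "x' = (m', F')" "y = (n, G)" "y' = (n', G')"
    using surj_pair[of x] surj_pair[of x'] surj_pair[of y] surj_pair[of y'] by blast
  obtain \<rho> where r: "m' = m" "bij_betw \<rho> {..<m} {..<m}" "\<And>v. v \<in> tuples m \<Longrightarrow> F' (\<rho> \<circ> v) = F v"
    using xy(1) unfolding eqs by (rule hisoE) blast
  obtain \<sigma> where s: "n' = n" "bij_betw \<sigma> {..<n} {..<n}" "\<And>v. v \<in> tuples n \<Longrightarrow> G' (\<sigma> \<circ> v) = G v"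
    using xy(2) unfolding eqs by (rule hisoE) blast
  have "(\<Sum>\<phi> \<in> {..<m} \<rightarrow>\<^sub>E {..<n}. hom_weight m F G \<phi>)
      = (\<Sum>\<phi> \<in> {..<m} \<rightarrow>\<^sub>E {..<n}. hom_weight m F' G' (restrict (\<sigma> \<circ> \<phi> \<circ> the_inv_into {..<m} \<rho>) {..<m}))"
    by (rule sum.cong[OF refl], rule hom_weight_transport[where F = F and F' = F' and G = G and G' = G' and
          \<rho> = \<rho> and \<sigma> = \<sigma>, OF r(2,3) s(2,3), symmetric]) auto
  also have "\<dots> = (\<Sum>\<phi> \<in> {..<m} \<rightarrow>\<^sub>E {..<n}. hom_weight m F' G' \<phi>)"
    by (rule sum.reindex_bij_betw[OF bij_betw_transport(1)[OF r(2) s(2)]])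
  finally have "(\<Sum>\<phi> \<in> {..<m} \<rightarrow>\<^sub>E {..<n}. hom_weight m F G \<phi>) = (\<Sum>\<phi> \<in> {..<m} \<rightarrow>\<^sub>E {..<n}. hom_weight m F' G' \<phi>)" .
  then show "(case x of (m, F) \<Rightarrow> \<lambda>(n, G). (\<Sum>\<phi> \<in> {..<m} \<rightarrow>\<^sub>E {..<n}. hom_weight m F G \<phi>) / real n ^ m) y
      = (case x' of (m, F) \<Rightarrow> \<lambda>(n, G). (\<Sum>\<phi> \<in> {..<m} \<rightarrow>\<^sub>E {..<n}. hom_weight m F G \<phi>) / real n ^ m) y'"
    by (simp add: eqs r(1) s(1))
qed

text \<open>The average is \<open>0\<close> (division by zero) when \<open>G\<close> has fewer vertices than \<open>F\<close>.\<close>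

lift_definition inj_density ::
  "('r::finite, 'k::topological_space \<Rightarrow>\<^sub>C real) hypergraph \<Rightarrow> ('r, 'k) hypergraph \<Rightarrow> real" is
  "\<lambda>(m, F) (n, G). (\<Sum>\<phi> \<in> inj_maps m n. hom_weight m F G \<phi>) / real (card (inj_maps m n))"
proof -
  fix x x' :: "nat \<times> (('r \<Rightarrow> nat) \<Rightarrow> ('k \<Rightarrow>\<^sub>C real))" and y y' :: "nat \<times> (('r \<Rightarrow> nat) \<Rightarrow> 'k)"
  assume xy: "hiso x x'" "hiso y y'"
  obtain m F m' F' n G n' G' where eqs: "x = (m, F)" "x' = (m', F')" "y = (n, G)" "y' = (n', G')"
    using surj_pair[of x] surj_pair[of x'] surj_pair[of y] surj_pair[of y'] by blast
  obtain \<rho> where r: "m' = m" "bij_betw \<rho> {..<m} {..<m}" "\<And>v. v \<in> tuples m \<Longrightarrow> F' (\<rho> \<circ> v) = F v"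
    using xy(1) unfolding eqs by (rule hisoE) blast
  obtain \<sigma> where s: "n' = n" "bij_betw \<sigma> {..<n} {..<n}" "\<And>v. v \<in> tuples n \<Longrightarrow> G' (\<sigma> \<circ> v) = G v"
    using xy(2) unfolding eqs by (rule hisoE) blast
  have "(\<Sum>\<phi> \<in> inj_maps m n. hom_weight m F G \<phi>)
      = (\<Sum>\<phi> \<in> inj_maps m n. hom_weight m F' G' (restrict (\<sigma> \<circ> \<phi> \<circ> the_inv_into {..<m} \<rho>) {..<m}))"
    by (rule sum.cong[OF refl], rule hom_weight_transport[where F = F and F' = F' and G = G and G' = G' and
          \<rho> = \<rho> and \<sigma> = \<sigma>, OF r(2,3) s(2,3), symmetric]) (auto simp: inj_maps_def)
  also have "\<dots> = (\<Sum>\<phi> \<in> inj_maps m n. hom_weight m F' G' \<phi>)"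
    by (rule sum.reindex_bij_betw[OF bij_betw_transport(2)[OF r(2) s(2)]])
  finally have "(\<Sum>\<phi> \<in> inj_maps m n. hom_weight m F G \<phi>) = (\<Sum>\<phi> \<in> inj_maps m n. hom_weight m F' G' \<phi>)" .
  then show "(case x of (m, F) \<Rightarrow> \<lambda>(n, G). (\<Sum>\<phi> \<in> inj_maps m n. hom_weight m F G \<phi>) / real (card (inj_maps m n))) y
      = (case x' of (m, F) \<Rightarrow> \<lambda>(n, G). (\<Sum>\<phi> \<in> inj_maps m n. hom_weight m F G \<phi>) / real (card (inj_maps m n))) y'"
    by (simp add: eqs r(1) s(1))
qed


section \<open>The embedding \<open>\<tau>\<^sup>+\<close> and the compactification\<close>

type_synonym ('r, 'k) tau_point = "(('r, 'k \<Rightarrow>\<^sub>C real) hypergraph \<Rightarrow> real) \<times> real"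

text \<open>\<open>[-1,1]\<^bsup>\<Pi>(\<F>)\<^esup> \<times> [0,1]\<close>\<close>

definition tau_space ::
  "('k::topological_space \<Rightarrow>\<^sub>C real) set \<Rightarrow> ('r::finite, 'k) tau_point topology" where
  "tau_space \<F> = prod_topology
     (product_topology (\<lambda>_. top_of_set {-1..1}) (hypergraphs \<F>)) (top_of_set {0..1})"

definition tau_plus ::
  "('k::topological_space \<Rightarrow>\<^sub>C real) set \<Rightarrow> ('r::finite, 'k) hypergraph \<Rightarrow> ('r, 'k) tau_point" where
  "tau_plus \<F> G = (\<lambda>F \<in> hypergraphs \<F>. hom_density F G, 1 / real (nverts G))"

definition Pi_plus ::
  "('k::topological_space \<Rightarrow>\<^sub>C real) set \<Rightarrow> ('r::finite, 'k) tau_point set" where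
  "Pi_plus \<F> = range (tau_plus \<F>)"

definition Pi_plus_closure ::
  "('k::topological_space \<Rightarrow>\<^sub>C real) set \<Rightarrow> ('r::finite, 'k) tau_point set" where
  "Pi_plus_closure \<F> = tau_space \<F> closure_of Pi_plus \<F>"

text \<open>
  The continuous extension of \<open>t(F, \<cdot>)\<close> from \<open>\<Pi>(K)\<^sup>+\<close>, where \<open>\<Pi>(K)\<close> is identified with its image
  under \<open>\<tau>\<^sup>+\<close>, to the closure. Restricting to functions that are \<open>undefined\<close> off the closure
  makes it unique.
\<close>

definition t_ext ::
  "('k::topological_space \<Rightarrow>\<^sub>C real) set \<Rightarrow> ('r::finite, 'k \<Rightarrow>\<^sub>C real) hypergraph \<Rightarrow>
   ('r, 'k) tau_point \<Rightarrow> real" where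
  "t_ext \<F> F = (THE g.
     g \<in> extensional (Pi_plus_closure \<F>) \<and>
     continuous_map (subtopology (tau_space \<F>) (Pi_plus_closure \<F>)) euclideanreal g \<and>
     (\<forall>G. g (tau_plus \<F> G) = hom_density F G))"


section \<open>Random elements and convergence in distribution\<close>

definition borel_of :: "'a topology \<Rightarrow> 'a measure" where
  "borel_of X = sigma (topspace X) {U. openin X U}"

lemma borel_of_euclidean: "borel_of euclidean = (borel :: 'a::topological_space measure)"
  by (simp add: borel_of_def borel_def flip: open_openin)

text \<open>\<open>P\<close> is the distribution of a random element of \<open>X\<close>.\<close>

definition law_on :: "'a topology \<Rightarrow> 'a measure \<Rightarrow> bool" where
  "law_on X P \<longleftrightarrow> prob_space P \<and> sets P = sets (borel_of X)"

definition converges_in_law :: "'a topology \<Rightarrow> (nat \<Rightarrow> 'a measure) \<Rightarrow> 'a measure \<Rightarrow> bool" where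
  "converges_in_law X P Q \<longleftrightarrow>
     (\<forall>f. continuous_map X euclideanreal f \<and> bounded (f ` topspace X) \<longrightarrow>
        (\<lambda>n. \<integral>x. f x \<partial>(P n)) \<longlonglongrightarrow> (\<integral>x. f x \<partial>Q))"


section \<open>Infinite labeled hypergraphs\<close>

text \<open>
  \<open>\<L>\<^sub>\<infinity>\<close> is the type \<open>('r \<Rightarrow> nat) \<Rightarrow> 'k\<close> with the product topology of the type class. \<open>\<L>\<^sub>n\<close> is
  embedded by giving the fixed decoration \<open>\<kappa>\<close> to all tuples that contain an isolated vertex.
\<close>

definition add_isolated :: "'k \<Rightarrow> nat \<Rightarrow> (('r \<Rightarrow> nat) \<Rightarrow> 'k) \<Rightarrow> ('r \<Rightarrow> nat) \<Rightarrow> 'k" where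
  "add_isolated \<kappa> n A = (\<lambda>v. if v \<in> tuples n then A v else \<kappa>)"

definition relabel :: "(nat \<Rightarrow> nat) \<Rightarrow> (('r \<Rightarrow> nat) \<Rightarrow> 'k) \<Rightarrow> ('r \<Rightarrow> nat) \<Rightarrow> 'k" where
  "relabel \<sigma> A = (\<lambda>v. A (\<sigma> \<circ> v))"

text \<open>
  The random labeling of a fixed unlabeled hypergraph by a uniformly random permutation of \<open>[n]\<close>,
  as an element of \<open>\<L>\<^sub>\<infinity>\<close>, and its distribution as a Borel measure.
\<close>

lift_definition random_labeling ::
  "'k \<Rightarrow> ('r, 'k) hypergraph \<Rightarrow> (('r \<Rightarrow> nat) \<Rightarrow> 'k) pmf" is
  "\<lambda>\<kappa> (n, A). map_pmf (\<lambda>\<sigma>. add_isolated \<kappa> n (relabel \<sigma> A)) (pmf_of_set {\<sigma>. \<sigma> permutes {..<n}})"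
proof -
  fix \<kappa> :: 'k and x y :: "nat \<times> (('r \<Rightarrow> nat) \<Rightarrow> 'k)"
  assume xy: "hiso x y"
  obtain n A m B where eqs: "x = (n, A)" "y = (m, B)"
    using surj_pair[of x] surj_pair[of y] by blast
  obtain \<rho> where r: "m = n" "bij_betw \<rho> {..<n} {..<n}" "\<And>v. v \<in> tuples n \<Longrightarrow> B (\<rho> \<circ> v) = A v"
    using xy unfolding eqs by (rule hisoE) blast
  define \<pi> where "\<pi> = (\<lambda>i. if i < n then \<rho> i else i)"
  have "bij_betw \<pi> {..<n} {..<n} = bij_betw \<rho> {..<n} {..<n}"
    by (rule bij_betw_cong) (simp add: \<pi>_def)
  then have \<pi>: "\<pi> permutes {..<n}"
    using r(2) by (intro bij_imp_permutes) (auto simp: \<pi>_def)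
  let ?P = "{\<sigma>. \<sigma> permutes {..<n}}"
  have "id \<in> ?P"
    by (simp add: permutes_id)
  then have P: "?P \<noteq> {}" "finite ?P"
    by (blast, simp add: finite_permutations)
  have bij: "bij_betw (\<lambda>\<sigma>. \<pi> \<circ> \<sigma>) ?P ?P"
  proof (rule bij_betw_byWitness[where f' = "\<lambda>\<sigma>. inv \<pi> \<circ> \<sigma>"])
    show "(\<circ>) \<pi> ` ?P \<subseteq> ?P" "(\<circ>) (inv \<pi>) ` ?P \<subseteq> ?P"
      using \<pi> by (auto intro: permutes_compose permutes_inv)
  qed (use \<pi> in \<open>auto simp: fun_eq_iff permutes_inverses\<close>)
  have "map_pmf (\<lambda>\<sigma>. add_isolated \<kappa> n (relabel \<sigma> B)) (pmf_of_set ?P)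
      = map_pmf (\<lambda>\<sigma>. add_isolated \<kappa> n (relabel \<sigma> B)) (map_pmf (\<lambda>\<sigma>. \<pi> \<circ> \<sigma>) (pmf_of_set ?P))"
    by (simp only: map_pmf_of_set_bij_betw[OF bij P])
  also have "\<dots> = map_pmf (\<lambda>\<sigma>. add_isolated \<kappa> n (relabel (\<pi> \<circ> \<sigma>) B)) (pmf_of_set ?P)"
    by (simp only: map_pmf_comp)
  also have "\<dots> = map_pmf (\<lambda>\<sigma>. add_isolated \<kappa> n (relabel \<sigma> A)) (pmf_of_set ?P)"
  proof (rule map_pmf_cong[OF refl])
    fix \<sigma> assume "\<sigma> \<in> set_pmf (pmf_of_set ?P)"
    then have \<sigma>: "\<sigma> permutes {..<n}"
      using P by simp
    have "B (\<pi> \<circ> \<sigma> \<circ> v) = A (\<sigma> \<circ> v)" if v: "v \<in> tuples n" for v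
    proof -
      have lt: "\<sigma> (v i) < n" for i
        using v permutes_in_image[OF \<sigma>, of "v i"] by auto
      then have "\<pi> \<circ> \<sigma> \<circ> v = \<rho> \<circ> (\<sigma> \<circ> v)"
        by (simp add: fun_eq_iff \<pi>_def)
      then show ?thesis
        using r(3)[of "\<sigma> \<circ> v"] lt by auto
    qed
    then show "add_isolated \<kappa> n (relabel (\<pi> \<circ> \<sigma>) B) = add_isolated \<kappa> n (relabel \<sigma> A)"
      by (simp add: add_isolated_def relabel_def fun_eq_iff)
  qed
  finally show "(case x of (n, A) \<Rightarrow>
        map_pmf (\<lambda>\<sigma>. add_isolated \<kappa> n (relabel \<sigma> A)) (pmf_of_set {\<sigma>. \<sigma> permutes {..<n}}))
      = (case y of (n, A) \<Rightarrow>
        map_pmf (\<lambda>\<sigma>. add_isolated \<kappa> n (relabel \<sigma> A)) (pmf_of_set {\<sigma>. \<sigma> permutes {..<n}}))"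
    by (simp add: eqs r(1))
qed

definition random_labeling_law ::
  "'k::topological_space \<Rightarrow> ('r, 'k) hypergraph \<Rightarrow> (('r \<Rightarrow> nat) \<Rightarrow> 'k) measure" where
  "random_labeling_law \<kappa> G = distr (measure_pmf (random_labeling \<kappa> G)) borel (\<lambda>A. A)"

text \<open>The distribution of the random labeling of a random hypergraph \<open>G\<close> defined on \<open>M\<close>.\<close>

definition hat_law ::
  "'k::topological_space \<Rightarrow> 'w measure \<Rightarrow> ('w \<Rightarrow> ('r, 'k) hypergraph) \<Rightarrow>
   (('r \<Rightarrow> nat) \<Rightarrow> 'k) measure" where
  "hat_law \<kappa> M G = M \<bind> (\<lambda>\<omega>. random_labeling_law \<kappa> (G \<omega>))"

definition exchangeable :: "(('r \<Rightarrow> nat) \<Rightarrow> 'k::topological_space) measure \<Rightarrow> bool" where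
  "exchangeable H \<longleftrightarrow>
     (\<forall>\<sigma>. bij \<sigma> \<and> finite {i. \<sigma> i \<noteq> i} \<longrightarrow> distr H borel (relabel \<sigma>) = H)"

end

theory Submission
  imports Defs
begin

text \<open>
  Both statements are equivalent to the convergence of \<open>E t(F, G\<^sub>n)\<close> for every \<open>F \<in> \<Pi>(\<C>)\<close>. Given (1),
  this holds because \<open>t(F, \<cdot>)\<close> extends continuously to the whole space of \<open>\<tau>\<^sup>+\<close>: as \<open>t(F, \<cdot>)\<close> is
  multilinear in the decorations of \<open>F\<close>, it is a uniform limit of linear combinations of
  coordinates. Given (2), it holds because \<open>t(F, G)\<close> differs by \<open>O(1 / |V(G)|)\<close> from the mean of the
  cylinder function \<open>A \<mapsto> \<Prod>\<^sub>v F\<^sub>v (A\<^sub>v)\<close> under a uniformly random labeling of \<open>G\<close>. Conversely, cylinder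
  functions span an algebra which is dense in the continuous functions on \<open>\<L>\<^sub>\<infinity>\<close>, and products of
  densities are densities of disjoint unions, so that the coordinates of \<open>\<tau>\<^sup>+\<close> and \<open>1 / |V|\<close> generate,
  up to \<open>O(1 / |V|)\<close>, only densities; by the Stone-Weierstrass theorem the means of all continuous
  functions converge, and compactness provides the limit law.
\<close>

text \<open>Expectations of single densities suffice, although (1) concerns the joint law of all
  coordinates, because mixed moments of densities are again expectations of densities. Neither
  existence argument rests on uniqueness of the limit: compactness gives one subsequential limit,
  and convergence of the means on a dense algebra forces the whole sequence to it. That |V| tends to
  infinity in probability enters only through E(1/|V|) tending to 0, which disposes of every
  O(1/|V|) error. The same fact makes the last coordinate of \<Gamma> vanish almost surely, whereas
  it is positive on \<open>Pi_plus \<F>\<close>; this is why \<Gamma> avoids the image of the finite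
  hypergraphs. Weak compactness is proved for metric spaces, while \<open>tau_space \<F>\<close> is
  an abstract topology; as \<Pi>(\<F>) is countable, the construction of \<Gamma> takes place in
  \<open>nat \<Rightarrow> real\<close> and is then transported. Finally E t(F, \<Gamma>) equals E
  t_inj(F, H|[k]) because both are the limit of E t(F, G_n).\<close>

section \<open>Weak limits on compact metric spaces\<close>

text \<open>At the first differing position k the sums differ by 3^-k, and all later digits together
  change this by at most 3^-k / 2. Base 3 with digits 0 and 1 leaves this gap; in base 2 the tail
  could cancel the leading difference.\<close>

lemma first_difference_bound:
  fixes b c :: "nat \<Rightarrow> real"
  assumes b: "\<And>j. b j \<in> {0, 1}" and c: "\<And>j. c j \<in> {0, 1}" and "j \<le> N" "b j \<noteq> c j"
  shows "(1/3)^N / 2 \<le> \<bar>(\<Sum>i. b i * (1/3)^i) - (\<Sum>i. c i * (1/3)^i)\<bar>"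
proof -
  define k where "k = (LEAST j. b j \<noteq> c j)"
  have k: "b k \<noteq> c k" "k \<le> j"
    using assms(4) unfolding k_def by (rule LeastI, rule Least_le)
  have less: "b i = c i" if "i < k" for i
    using that not_less_Least unfolding k_def by blast
  define d where "d i = (b i - c i) * (1/3::real)^i" for i
  have abs_d: "\<bar>d i\<bar> \<le> (1/3)^i" for i
    using b[of i] c[of i] by (auto simp: d_def abs_mult)
  have geo: "summable (\<lambda>i. (1/3::real)^i)"
    by (rule summable_geometric) simp
  have "\<bar>b i * (1/3)^i\<bar> \<le> (1/3)^i" "\<bar>c i * (1/3)^i\<bar> \<le> (1/3)^i" for i
    using b[of i] c[of i] by auto
  then have sb: "summable (\<lambda>i. b i * (1/3)^i)" and sc: "summable (\<lambda>i. c i * (1/3)^i)"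
    by (auto intro!: summable_comparison_test'[OF geo, of 0])
  have sd: "summable d"
    unfolding d_def left_diff_distrib by (rule summable_diff[OF sb sc])
  have "(\<Sum>i. b i * (1/3)^i) - (\<Sum>i. c i * (1/3)^i) = suminf d"
    unfolding d_def left_diff_distrib by (rule suminf_diff[OF sb sc])
  also have "\<dots> = (\<Sum>i. d (i + Suc k)) + (\<Sum>i<Suc k. d i)"
    by (rule suminf_split_initial_segment[OF sd])
  also have "(\<Sum>i<Suc k. d i) = d k"
    by (simp add: d_def less)
  finally have eq: "(\<Sum>i. b i * (1/3)^i) - (\<Sum>i. c i * (1/3)^i) = (\<Sum>i. d (i + Suc k)) + d k" .
  have geo': "(\<lambda>i. (1/3::real)^(i + Suc k)) sums ((1/3)^k / 2)"
    using sums_mult[OF geometric_sums[of "1/3::real"], of "(1/3)^Suc k"]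
    by (simp add: power_add mult_ac)
  have abs_sum: "summable (\<lambda>i. \<bar>d (i + Suc k)\<bar>)"
    by (rule summable_comparison_test'[OF sums_summable[OF geo'], of 0]) (use abs_d[of "_ + Suc k"] in simp)
  have "\<bar>\<Sum>i. d (i + Suc k)\<bar> \<le> (\<Sum>i. \<bar>d (i + Suc k)\<bar>)"
    by (rule summable_rabs[OF abs_sum])
  also have "\<dots> \<le> (\<Sum>i. (1/3::real)^(i + Suc k))"
    by (rule suminf_le[OF abs_d abs_sum sums_summable[OF geo']])
  also have "\<dots> = (1/3)^k / 2"
    using geo' by (rule sums_unique[symmetric])
  finally have tail: "\<bar>\<Sum>i. d (i + Suc k)\<bar> \<le> (1/3)^k / 2" .
  have "\<bar>d k\<bar> = (1/3)^k"
    using b[of k] c[of k] k(1) by (auto simp: d_def abs_mult)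
  with tail have "(1/3)^k / 2 \<le> \<bar>(\<Sum>i. d (i + Suc k)) + d k\<bar>"
    by linarith
  moreover have "(1/3::real)^N \<le> (1/3)^k"
    using k(2) assms(3) by (intro power_decreasing) auto
  ultimately show ?thesis
    unfolding eq by linarith
qed

text \<open>
  The ternary digits of \<open>s x\<close> record which balls of a countable family contain \<open>x\<close>; for every radius
  the family contains a finite cover of \<open>S\<close>, so finitely many digits of \<open>s x\<close> locate \<open>x\<close>.
\<close>

lemma compact_borel_code:
  fixes S :: "'a::metric_space set"
  assumes "compact S"
  obtains s :: "'a \<Rightarrow> real" where "s \<in> borel_measurable borel" "\<And>x. s x \<in> {0..2}"
    "\<And>\<epsilon>. \<epsilon> > 0 \<Longrightarrow> \<exists>\<delta>>0. \<forall>x\<in>S. \<forall>y\<in>S. \<bar>s x - s y\<bar> < \<delta> \<longrightarrow> dist x y < \<epsilon>"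
proof -
  have "\<forall>\<epsilon>>0. \<exists>D. finite D \<and> D \<subseteq> S \<and> S \<subseteq> (\<Union>c\<in>D. ball c \<epsilon>)"
    by (rule seq_compact_imp_totally_bounded) (use assms in \<open>simp add: compact_eq_seq_compact_metric\<close>)
  then have "\<exists>D. finite D \<and> S \<subseteq> (\<Union>c\<in>D. ball c (1 / Suc k))" for k
    by (metis divide_pos_pos of_nat_0_less_iff zero_less_Suc zero_less_one)
  then obtain D where D: "\<And>k. finite (D k)" "\<And>k. S \<subseteq> (\<Union>c\<in>D k. ball c (1 / Suc k))"
    by metis
  \<comment> \<open>The empty set keeps \<open>\<B>\<close> nonempty even if all covers are empty,
    so that it can be enumerated; its digit is always 0.\<close>
  define \<B> where "\<B> = insert {} (\<Union>k. (\<lambda>c. ball c (1 / Suc k)) ` D k)"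
  have count: "countable \<B>"
    unfolding \<B>_def using D(1) by (simp add: countable_finite)
  define B where "B = from_nat_into \<B>"
  have B_range: "range B = \<B>"
    unfolding B_def by (rule range_from_nat_into) (use count in \<open>auto simp: \<B>_def\<close>)
  then have "B j \<in> \<B>" for j
    by blast
  then have B_open: "open (B j)" for j
    unfolding \<B>_def by (metis (no_types, lifting) UN_iff imageE insertE open_ball open_empty)
  define s where "s x = (\<Sum>j. indicator (B j) x * (1/3::real)^j)" for x
  have bits: "indicator (B j) x \<in> {0, 1::real}" for j x
    by (auto simp: indicator_def)
  show thesis
  proof
    show "s \<in> borel_measurable borel"
      unfolding s_def using B_open by (intro borel_measurable_suminf) auto
    show "s x \<in> {0..2}" for x
    proof -
      have geo: "summable (\<lambda>j. (1/3::real)^j)"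
        by (rule summable_geometric) simp
      have le: "indicator (B j) x * (1/3::real)^j \<le> (1/3)^j" for j
        by (auto simp: indicator_def)
      have summ: "summable (\<lambda>j. indicator (B j) x * (1/3::real)^j)"
        by (rule summable_comparison_test'[OF geo, of 0]) (use le in simp)
      have "s x \<le> (\<Sum>j. (1/3::real)^j)"
        unfolding s_def by (rule suminf_le[OF le summ geo])
      also have "\<dots> = 3/2"
        using suminf_geometric[of "1/3::real"] by simp
      finally show ?thesis
        using suminf_nonneg[OF summ] by (simp add: s_def)
    qed
    fix \<epsilon> :: real assume "\<epsilon> > 0"
    \<comment> \<open>Two points of one ball of radius 1/(k+1) are closer than twice that radius,
      hence the half.\<close>
    then obtain k where k: "1 / real (Suc k) < \<epsilon> / 2"
      using nat_approx_posE[of "\<epsilon> / 2"] by auto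
    have "\<exists>N. \<forall>c\<in>D k. \<exists>j\<le>N. ball c (1 / Suc k) = B j"
    proof -
      have "\<exists>j. ball c (1 / Suc k) = B j" if "c \<in> D k" for c
        using that B_range unfolding \<B>_def by (metis (no_types, lifting) UN_I UNIV_I imageE image_eqI insertCI)
      then obtain J where J: "\<And>c. c \<in> D k \<Longrightarrow> ball c (1 / Suc k) = B (J c)"
        by metis
      have "J c \<le> Max (J ` D k)" if "c \<in> D k" for c
        using that D(1) by simp
      with J show ?thesis
        by blast
    qed
    then obtain N where N: "\<And>c. c \<in> D k \<Longrightarrow> \<exists>j\<le>N. ball c (1 / Suc k) = B j"
      by blast
    show "\<exists>\<delta>>0. \<forall>x\<in>S. \<forall>y\<in>S. \<bar>s x - s y\<bar> < \<delta> \<longrightarrow> dist x y < \<epsilon>"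
    proof (intro exI conjI ballI impI)
      show "(1/3::real)^N / 2 > 0"
        by simp
      fix x y assume xy: "x \<in> S" "y \<in> S" and lt: "\<bar>s x - s y\<bar> < (1/3)^N / 2"
      obtain c where c: "c \<in> D k" "x \<in> ball c (1 / Suc k)"
        using D(2) xy(1) by blast
      obtain j where j: "j \<le> N" "ball c (1 / Suc k) = B j"
        using N c(1) by blast
      have "indicator (B j) x = (indicator (B j) y :: real)"
        using first_difference_bound[of "\<lambda>j. indicator (B j) x" "\<lambda>j. indicator (B j) y" j N, OF bits bits j(1)] lt
        unfolding s_def by linarith
      then have "y \<in> ball c (1 / Suc k)"
        using c(2) unfolding j(2) by (simp split: split_indicator_asm)
      then have "dist x y < 1 / Suc k + 1 / Suc k"
        using c(2) dist_triangle2[of x y c] by (simp add: dist_commute)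
      then show "dist x y < \<epsilon>"
        using k by linarith
    qed
  qed
qed

text \<open>
  The code \<open>s\<close> transports the measures to a bounded interval, where Helly's theorem applies; its
  inverse is uniformly continuous on \<open>s ` S\<close>, so it extends to the closure and transports the
  limit back.
\<close>

lemma compact_weak_limit:
  fixes S :: "'a::complete_space set" and \<mu> :: "nat \<Rightarrow> 'a measure"
  assumes S: "compact S"
    and \<mu>: "\<And>n. prob_space (\<mu> n)" "\<And>n. sets (\<mu> n) = sets borel" "\<And>n. AE x in \<mu> n. x \<in> S"
  obtains r \<nu> where "strict_mono (r :: nat \<Rightarrow> nat)" "prob_space \<nu>" "sets \<nu> = sets borel" "AE x in \<nu>. x \<in> S"
    "\<And>f :: 'a \<Rightarrow> real. continuous_on S f \<Longrightarrow> f \<in> borel_measurable borel \<Longrightarrow>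
       (\<lambda>n. \<integral>x. f x \<partial>\<mu> (r n)) \<longlonglongrightarrow> (\<integral>x. f x \<partial>\<nu>)"
proof -
  obtain s :: "'a \<Rightarrow> real" where s: "s \<in> borel_measurable borel" "\<And>x. s x \<in> {0..2}"
    "\<And>\<epsilon>. \<epsilon> > 0 \<Longrightarrow> \<exists>\<delta>>0. \<forall>x\<in>S. \<forall>y\<in>S. \<bar>s x - s y\<bar> < \<delta> \<longrightarrow> dist x y < \<epsilon>"
    using compact_borel_code[OF S] by blast
  have ms[measurable]: "s \<in> borel_measurable (\<mu> n)" for n
    using s(1) measurable_cong_sets[OF \<mu>(2) refl] by blast
  have "S \<noteq> {}"
  proof
    assume "S = {}"
    then show False
      using \<mu>(3)[of 0] prob_space.AE_False[OF \<mu>(1)] by simp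
  qed
  then obtain x0 where x0: "x0 \<in> S"
    by blast
  have inj: "inj_on s S"
  proof (rule inj_onI, rule ccontr)
    fix x y assume xy: "x \<in> S" "y \<in> S" "s x = s y" "x \<noteq> y"
    then show False
      using s(3)[of "dist x y"] by force
  qed
  define t where "t = the_inv_into S s"
  have ts: "t (s x) = x" if "x \<in> S" for x
    unfolding t_def by (rule the_inv_into_f_f[OF inj that])
  have "uniformly_continuous_on (s ` S) t"
    unfolding uniformly_continuous_on_def
  proof (intro allI impI)
    fix \<epsilon> :: real assume "\<epsilon> > 0"
    then obtain \<delta> where "\<delta> > 0" "\<forall>x\<in>S. \<forall>y\<in>S. \<bar>s x - s y\<bar> < \<delta> \<longrightarrow> dist x y < \<epsilon>"
      using s(3) by blast
    then show "\<exists>d>0. \<forall>x\<in>s ` S. \<forall>x'\<in>s ` S. dist x' x < d \<longrightarrow> dist (t x') (t x) < \<epsilon>"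
      by (intro exI[of _ \<delta>]) (auto simp: dist_real_def ts)
  qed
  then obtain \<pi> where \<pi>: "uniformly_continuous_on (closure (s ` S)) \<pi>" "\<And>x. x \<in> s ` S \<Longrightarrow> t x = \<pi> x"
    by (rule uniformly_continuous_on_extension_on_closure) (rule that, assumption+)
  define C where "C = closure (s ` S)"
  have \<pi>s: "\<pi> (s x) = x" if "x \<in> S" for x
    using \<pi>(2)[of "s x"] that ts by simp
  have cont_\<pi>: "continuous_on C \<pi>"
    using \<pi>(1) unfolding C_def by (rule uniformly_continuous_imp_continuous)
  have \<pi>_in: "\<pi> y \<in> S" if "y \<in> C" for y
  proof -
    have "\<pi> ` closure (s ` S) \<subseteq> S"
      by (rule image_closure_subset)
        (use cont_\<pi> S \<pi>s in \<open>simp_all add: C_def compact_imp_closed image_subset_iff\<close>)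
    then show ?thesis
      using that by (auto simp: C_def)
  qed
  have C_closed: "closed C" and C_ne: "C \<noteq> {}"
    using x0 by (auto simp: C_def)
  have sC: "s x \<in> C" if "x \<in> S" for x
    unfolding C_def by (rule subsetD[OF closure_subset imageI[OF that]])
  define \<mu>' where "\<mu>' n = distr (\<mu> n) borel s" for n
  have rd: "real_distribution (\<mu>' n)" for n
    unfolding \<mu>'_def by (rule prob_space.real_distribution_distr[OF \<mu>(1)]) simp
  have "tight \<mu>'"
    unfolding tight_def
  proof (intro conjI allI impI rd)
    fix \<epsilon> :: real assume "\<epsilon> > 0"
    \<comment> \<open>The interval excludes its left end and \<open>s\<close> may take the value 0,
      hence -1.\<close>
    have "measure (\<mu>' n) {-1<..2} = 1" for n
    proof -
      have "s -` {-1<..2} \<inter> space (\<mu> n) = space (\<mu> n)"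
        using s(2) by force
      then show ?thesis
        using prob_space.prob_space[OF \<mu>(1)] by (simp add: \<mu>'_def measure_distr)
    qed
    then show "\<exists>a b::real. a < b \<and> (\<forall>n. 1 - \<epsilon> < measure (\<mu>' n) {a<..b})"
      using \<open>\<epsilon> > 0\<close> by (intro exI[of _ "-1"] exI[of _ 2]) simp
  qed
  then obtain r \<nu>' where r: "strict_mono r" and \<nu>': "real_distribution \<nu>'"
    and lim: "weak_conv_m (\<mu>' \<circ> id \<circ> r) \<nu>'"
    using tight_imp_convergent_subsubsequence[of \<mu>' id] by (auto simp: strict_mono_def)
  interpret \<nu>': real_distribution \<nu>' by fact
  have conv: "(\<lambda>n. \<integral>x. h (s x) \<partial>\<mu> (r n)) \<longlonglongrightarrow> (\<integral>y. h y \<partial>\<nu>')"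
    if h: "continuous_on UNIV h" "\<And>x. \<bar>h x\<bar> \<le> B" for h :: "real \<Rightarrow> real" and B
  proof -
    have "(\<lambda>n. \<integral>y. h y \<partial>(\<mu>' \<circ> id \<circ> r) n) \<longlonglongrightarrow> (\<integral>y. h y \<partial>\<nu>')"
      by (rule weak_conv_imp_integral_bdd_continuous_conv[OF _ \<nu>' lim, where B = B])
        (use h rd in \<open>auto simp: continuous_on_eq_continuous_at o_def\<close>)
    moreover have "h \<in> borel_measurable borel"
      using h(1) by (rule borel_measurable_continuous_onI)
    ultimately show ?thesis
      by (simp add: \<mu>'_def integral_distr)
  qed
  have AE_C: "AE y in \<nu>'. y \<in> C"
  proof -
    \<comment> \<open>A bounded continuous function that vanishes exactly on the closed set
      \<open>C\<close>. Its integrals are 0 along the sequence, hence in the limit, so the limit law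
      is concentrated on \<open>C\<close>.\<close>
    define h where "h y = min 1 (infdist y C)" for y
    have h: "continuous_on UNIV h" "\<bar>h y\<bar> \<le> 1" for y
      unfolding h_def using infdist_nonneg[of y C] by (auto intro!: continuous_intros)
    have hm: "h \<in> borel_measurable borel"
      using h(1) by (rule borel_measurable_continuous_onI)
    have "(\<integral>x. h (s x) \<partial>\<mu> n) = (\<integral>x. 0 \<partial>\<mu> n)" for n
    proof (rule integral_cong_AE)
      show "AE x in \<mu> n. h (s x) = 0"
        using \<mu>(3)[of n] by eventually_elim (simp add: h_def sC)
      show "(\<lambda>x. h (s x)) \<in> borel_measurable (\<mu> n)"
        by (rule measurable_compose[OF ms hm])
    qed simp
    then have "(\<integral>y. h y \<partial>\<nu>') = 0"
      using conv[OF h] by (simp add: LIMSEQ_const_iff)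
    moreover have "integrable \<nu>' h"
      by (rule \<nu>'.integrable_const_bound[where B = 1]) (use h hm in auto)
    moreover have "0 \<le> h y" for y
      by (simp add: h_def infdist_nonneg)
    ultimately have "AE y in \<nu>'. h y = 0"
      by (simp add: integral_nonneg_eq_0_iff_AE)
    then show ?thesis
    proof eventually_elim
      fix y assume "h y = 0"
      then have "infdist y C = 0"
        unfolding h_def by linarith
      then show "y \<in> C"
        using in_closed_iff_infdist_zero[OF C_closed C_ne] by simp
    qed
  qed
  \<comment> \<open>The default \<open>x0\<close> makes this a Borel map on the whole line with
    values in \<open>S\<close>.\<close>
  define \<pi>' where "\<pi>' y = (if y \<in> C then \<pi> y else x0)" for y
  have \<pi>'_meas[measurable]: "\<pi>' \<in> borel_measurable borel"
    unfolding \<pi>'_def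
    by (rule borel_measurable_continuous_on_if) (use C_closed cont_\<pi> in auto)
  have \<pi>'_meas'[measurable]: "\<pi>' \<in> borel_measurable \<nu>'"
    by simp
  define \<nu> where "\<nu> = distr \<nu>' borel \<pi>'"
  show thesis
  proof
    show "strict_mono r" by fact
    show "prob_space \<nu>"
      unfolding \<nu>_def by (rule \<nu>'.prob_space_distr) simp
    show "sets \<nu> = sets borel"
      by (simp add: \<nu>_def)
    show "AE x in \<nu>. x \<in> S"
    proof -
      have "{x. x \<in> S} \<in> sets borel"
        using compact_imp_closed[OF S] by simp
      then show ?thesis
        unfolding \<nu>_def by (subst AE_distr_iff) (auto simp: \<pi>'_def \<pi>_in x0)
    qed
    fix f :: "'a \<Rightarrow> real" assume f: "continuous_on S f" "f \<in> borel_measurable borel"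
    have fm[measurable]: "f \<in> borel_measurable (\<mu> n)" for n
      using f(2) measurable_cong_sets[OF \<mu>(2) refl] by blast
    have "bounded (f ` S)"
      using compact_continuous_image[OF f(1) S] by (rule compact_imp_bounded)
    then obtain B where B: "\<And>x. x \<in> S \<Longrightarrow> norm (f x) \<le> B" "0 \<le> B"
      unfolding bounded_pos by (meson imageI less_imp_le)
    \<comment> \<open>\<open>f\<close> need not be continuous off \<open>S\<close>. Composed with
      \<open>\<pi>\<close> it is continuous on the closed set \<open>C\<close>, and its Tietze
      extension with the same bound is a legitimate test function for the weak convergence on the
      line.\<close>
    have "continuous_on C (\<lambda>y. f (\<pi> y))"
      by (rule continuous_on_compose2[OF f(1) cont_\<pi>]) (use \<pi>_in in auto)
    then obtain h where h: "continuous_on UNIV h" "\<And>y. y \<in> C \<Longrightarrow> h y = f (\<pi> y)" "\<And>y. \<bar>h y\<bar> \<le> B"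
      using Tietze[of C "\<lambda>y. f (\<pi> y)" UNIV B] B C_closed \<pi>_in by auto
    have hm[measurable]: "h \<in> borel_measurable borel"
      using h(1) by (rule borel_measurable_continuous_onI)
    have "(\<integral>x. f x \<partial>\<mu> n) = (\<integral>x. h (s x) \<partial>\<mu> n)" for n
    proof (rule integral_cong_AE)
      show "AE x in \<mu> n. f x = h (s x)"
        using \<mu>(3)[of n] by eventually_elim (simp add: h(2) sC \<pi>s)
    qed simp_all
    moreover have "(\<integral>x. f x \<partial>\<nu>) = (\<integral>y. h y \<partial>\<nu>')"
    proof -
      have "(\<integral>x. f x \<partial>\<nu>) = (\<integral>y. f (\<pi>' y) \<partial>\<nu>')"
        unfolding \<nu>_def using f(2) by (intro integral_distr) auto
      also have "\<dots> = (\<integral>y. h y \<partial>\<nu>')"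
      proof (rule integral_cong_AE)
        show "AE y in \<nu>'. f (\<pi>' y) = h y"
          using AE_C by eventually_elim (simp add: h(2) \<pi>'_def)
        show "(\<lambda>y. f (\<pi>' y)) \<in> borel_measurable \<nu>'"
          by (rule measurable_compose[OF \<pi>'_meas' f(2)])
      qed simp
      finally show ?thesis .
    qed
    ultimately show "(\<lambda>n. \<integral>x. f x \<partial>\<mu> (r n)) \<longlonglongrightarrow> (\<integral>x. f x \<partial>\<nu>)"
      using conv[OF h(1,3)] by simp
  qed
qed

section \<open>Convergence on a dense algebra of test functions\<close>

text \<open>The functionals are 1-Lipschitz in the supremum norm, uniformly in n, and
  \<open>R\<close> is uniformly dense by the Stone-Weierstrass theorem. The Cauchy property thus
  passes from \<open>R\<close> to every continuous function.\<close>

lemma (in function_ring_on) convergent_functionals: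
  fixes I :: "nat \<Rightarrow> ('a \<Rightarrow> real) \<Rightarrow> real"
  assumes I: "\<And>n f g e. continuous_on S f \<Longrightarrow> continuous_on S g \<Longrightarrow> (\<And>x. x \<in> S \<Longrightarrow> \<bar>f x - g x\<bar> \<le> e) \<Longrightarrow>
      \<bar>I n f - I n g\<bar> \<le> e"
    and R: "\<And>f. f \<in> R \<Longrightarrow> convergent (\<lambda>n. I n f)"
    and f: "continuous_on S f"
  shows "convergent (\<lambda>n. I n f)"
proof -
  have "Cauchy (\<lambda>n. I n f)"
  proof (rule metric_CauchyI)
    fix e :: real assume "e > 0"
    then obtain g where g: "g \<in> R" "\<And>x. x \<in> S \<Longrightarrow> \<bar>f x - g x\<bar> < e / 3"
      using Stone_Weierstrass_basic[OF f, of "e / 3"] by auto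
    then have close: "\<bar>I n f - I n g\<bar> \<le> e / 3" for n
      by (intro I f continuous) (auto simp: less_imp_le)
    have "Cauchy (\<lambda>n. I n g)"
      using R[OF g(1)] by (rule convergent_Cauchy)
    then obtain N where N: "\<And>m n. m \<ge> N \<Longrightarrow> n \<ge> N \<Longrightarrow> \<bar>I m g - I n g\<bar> < e / 3"
      using \<open>e > 0\<close> unfolding Cauchy_def dist_real_def by (meson divide_pos_pos zero_less_numeral)
    show "\<exists>N. \<forall>m\<ge>N. \<forall>n\<ge>N. dist (I m f) (I n f) < e"
    proof (intro exI allI impI)
      fix m n assume "m \<ge> N" "n \<ge> N"
      then show "dist (I m f) (I n f) < e"
        using N[of m n] close[of m] close[of n] unfolding dist_real_def by linarith
    qed
  qed
  then show ?thesis
    by (rule Cauchy_convergent)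
qed

text \<open>Compactness yields \<open>\<nu>\<close> along a subsequence; since the integrals of each
  continuous function converge along the full sequence, their limit must be the one given by
  \<open>\<nu>\<close>. Elements of \<open>R\<close> are controlled on \<open>S\<close> only, and
  cutting them off to 0 outside the closed set \<open>S\<close> makes them Borel.\<close>

lemma compact_ring_weak_limit:
  fixes S :: "'a::complete_space set" and \<mu> :: "nat \<Rightarrow> 'a measure"
  assumes R: "function_ring_on R S"
    and \<mu>: "\<And>n. prob_space (\<mu> n)" "\<And>n. sets (\<mu> n) = sets borel" "\<And>n. AE x in \<mu> n. x \<in> S"
    and conv: "\<And>f. f \<in> R \<Longrightarrow> convergent (\<lambda>n. \<integral>x. (if x \<in> S then f x else 0) \<partial>\<mu> n)"
  obtains \<nu> where "prob_space \<nu>" "sets \<nu> = sets borel" "AE x in \<nu>. x \<in> S"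
    "\<And>f :: 'a \<Rightarrow> real. continuous_on S f \<Longrightarrow> f \<in> borel_measurable borel \<Longrightarrow>
       (\<lambda>n. \<integral>x. f x \<partial>\<mu> n) \<longlonglongrightarrow> (\<integral>x. f x \<partial>\<nu>)"
proof -
  interpret function_ring_on R S by fact
  obtain r \<nu> where r: "strict_mono (r :: nat \<Rightarrow> nat)"
    and \<nu>: "prob_space \<nu>" "sets \<nu> = sets borel" "AE x in \<nu>. x \<in> S"
    and lim: "\<And>f :: 'a \<Rightarrow> real. continuous_on S f \<Longrightarrow> f \<in> borel_measurable borel \<Longrightarrow>
       (\<lambda>n. \<integral>x. f x \<partial>\<mu> (r n)) \<longlonglongrightarrow> (\<integral>x. f x \<partial>\<nu>)"
    by (rule compact_weak_limit[OF compact \<mu>]) (rule that, assumption+)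
  define I where "I n f = (\<integral>x. (if x \<in> S then f x else 0) \<partial>\<mu> n)" for n and f :: "'a \<Rightarrow> real"
  have meas: "(\<lambda>x. if x \<in> S then f x else 0) \<in> borel_measurable (\<mu> n)" if "continuous_on S f"
    for f :: "'a \<Rightarrow> real" and n
    unfolding measurable_cong_sets[OF \<mu>(2) refl] using that compact_imp_closed[OF compact]
    by (intro borel_measurable_continuous_on_if) auto
  have int: "integrable (\<mu> n) (\<lambda>x. if x \<in> S then f x else 0)" if f: "continuous_on S f"
    for f :: "'a \<Rightarrow> real" and n
  proof -
    interpret prob_space "\<mu> n" by (rule \<mu>)
    have "bounded (f ` S)"
      using compact_continuous_image[OF f compact] by (rule compact_imp_bounded)
    then obtain B where "\<And>x. x \<in> S \<Longrightarrow> norm (f x) \<le> B" "0 \<le> B"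
      unfolding bounded_pos by (meson imageI less_imp_le)
    then show ?thesis
      using meas[OF f] by (intro integrable_const_bound[where B = B]) auto
  qed
  have I_close: "\<bar>I n f - I n g\<bar> \<le> e"
    if fg: "continuous_on S f" "continuous_on S g" and e: "\<And>x. x \<in> S \<Longrightarrow> \<bar>f x - g x\<bar> \<le> e" for n f g e
  proof -
    interpret prob_space "\<mu> n" by (rule \<mu>)
    have "\<bar>I n f - I n g\<bar> = \<bar>\<integral>x. (if x \<in> S then f x else 0) - (if x \<in> S then g x else 0) \<partial>\<mu> n\<bar>"
      unfolding I_def using int[OF fg(1)] int[OF fg(2)] by simp
    also have "\<dots> \<le> (\<integral>x. \<bar>(if x \<in> S then f x else 0) - (if x \<in> S then g x else 0)\<bar> \<partial>\<mu> n)"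
      by (rule integral_abs_bound)
    also have "\<dots> \<le> (\<integral>x. e \<partial>\<mu> n)"
    proof (rule integral_mono_AE)
      show "AE x in \<mu> n. \<bar>(if x \<in> S then f x else 0) - (if x \<in> S then g x else 0)\<bar> \<le> e"
        using \<mu>(3)[of n] by eventually_elim (simp add: e)
    qed (use int[OF fg(1)] int[OF fg(2)] in auto)
    finally show ?thesis
      by (simp add: prob_space)
  qed
  show thesis
  proof (rule that[OF \<nu>])
    fix f :: "'a \<Rightarrow> real" assume f: "continuous_on S f" and fm: "f \<in> borel_measurable borel"
    have "convergent (\<lambda>n. I n f)"
      by (rule convergent_functionals[of I, OF I_close _ f]) (auto simp: I_def conv)
    moreover have "I n f = (\<integral>x. f x \<partial>\<mu> n)" for n
      unfolding I_def
    proof (rule integral_cong_AE)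
      show "AE x in \<mu> n. (if x \<in> S then f x else 0) = f x"
        using \<mu>(3)[of n] by eventually_elim simp
      show "f \<in> borel_measurable (\<mu> n)"
        using fm measurable_cong_sets[OF \<mu>(2) refl] by blast
    qed (rule meas[OF f])
    ultimately have "convergent (\<lambda>n. \<integral>x. f x \<partial>\<mu> n)"
      by simp
    then obtain l where l: "(\<lambda>n. \<integral>x. f x \<partial>\<mu> n) \<longlonglongrightarrow> l"
      by (auto simp: convergent_def)
    then have "(\<lambda>n. \<integral>x. f x \<partial>\<mu> (r n)) \<longlonglongrightarrow> l"
      using LIMSEQ_subseq_LIMSEQ[OF l r] by (simp add: o_def)
    then have "l = (\<integral>x. f x \<partial>\<nu>)"
      using lim[OF f fm] by (rule LIMSEQ_unique)
    with l show "(\<lambda>n. \<integral>x. f x \<partial>\<mu> n) \<longlonglongrightarrow> (\<integral>x. f x \<partial>\<nu>)"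
      by simp
  qed
qed

section \<open>Measures and kernels tested on continuous functions\<close>

lemma open_indicator_limit:
  fixes U :: "'a::metric_space set"
  assumes "open U"
  obtains f :: "nat \<Rightarrow> 'a \<Rightarrow> real"
  where "\<And>k. continuous_on UNIV (f k)" "\<And>k x. f k x \<in> {0..1}" "\<And>x. (\<lambda>k. f k x) \<longlonglongrightarrow> indicator U x"
\<comment> \<open>The distance to the empty set is 0 by convention, so the formula below would give
  0 instead of 1 for the full space.\<close>
proof (cases "U = UNIV")
  case True
  show ?thesis
    by (rule that[of "\<lambda>_ _. 1"]) (auto simp: True)
next
  case False
  then have ne: "- U \<noteq> {}" and cl: "closed (- U)"
    using assms by auto
  show ?thesis
  proof (rule that[of "\<lambda>k x. min 1 (real k * infdist x (- U))"])
    show "continuous_on UNIV (\<lambda>x. min 1 (real k * infdist x (- U)))" for k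
      by (intro continuous_intros)
    show "min 1 (real k * infdist x (- U)) \<in> {0..1}" for k x
      using infdist_nonneg[of x "- U"] by simp
    fix x
    show "(\<lambda>k. min 1 (real k * infdist x (- U))) \<longlonglongrightarrow> indicator U x"
    proof (cases "x \<in> U")
      case True
      then have "infdist x (- U) \<noteq> 0"
        using in_closed_iff_infdist_zero[OF cl ne] by auto
      then have pos: "infdist x (- U) > 0"
        using infdist_nonneg[of x "- U"] by linarith
      obtain N where N: "1 < real N * infdist x (- U)"
        using reals_Archimedean3[OF pos] by blast
      have "min 1 (real k * infdist x (- U)) = 1" if "k \<ge> N" for k
      proof -
        have "real N * infdist x (- U) \<le> real k * infdist x (- U)"
          using that pos by (intro mult_right_mono) auto
        then show ?thesis
          using N by linarith
      qed
      then have "\<forall>\<^sub>F k in sequentially. min 1 (real k * infdist x (- U)) = 1"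
        unfolding eventually_sequentially by blast
      then show ?thesis
        using True by (simp add: tendsto_eventually)
    next
      case False
      then have "infdist x (- U) = 0"
        by simp
      then show ?thesis
        using False by simp
    qed
  qed
qed

text \<open>The open sets are an intersection-stable generator, and dominated convergence gives them
  equal mass. Exchangeability of the limit is checked in this way.\<close>

lemma prob_measure_eqI_continuous:
  fixes M N :: "'a::metric_space measure"
  assumes M: "prob_space M" "sets M = sets borel" and N: "prob_space N" "sets N = sets borel"
    and eq: "\<And>f :: 'a \<Rightarrow> real. continuous_on UNIV f \<Longrightarrow> (\<And>x. f x \<in> {0..1}) \<Longrightarrow>
      (\<integral>x. f x \<partial>M) = (\<integral>x. f x \<partial>N)"
  shows "M = N"
proof (rule measure_eqI_generator_eq[where E = "{U. open U}" and A = "\<lambda>_. UNIV" and \<Omega> = UNIV])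
  interpret M: prob_space M by fact
  interpret N: prob_space N by fact
  show "Int_stable {U :: 'a set. open U}"
    by (auto simp: Int_stable_def)
  show "sets M = sigma_sets UNIV {U. open U}" "sets N = sigma_sets UNIV {U. open U}"
    using M(2) N(2) by (simp_all add: borel_def)
  show "emeasure M UNIV \<noteq> \<infinity>"
    by simp
  fix U :: "'a set" assume "U \<in> {U. open U}"
  then have U: "open U" by simp
  then obtain f :: "nat \<Rightarrow> 'a \<Rightarrow> real" where f: "\<And>k. continuous_on UNIV (f k)" "\<And>k x. f k x \<in> {0..1}"
    "\<And>x. (\<lambda>k. f k x) \<longlonglongrightarrow> indicator U x"
    using open_indicator_limit by blast
  have fb: "norm (f k x) \<le> 1" for k x
    using f(2)[of k x] by simp
  have fm: "f k \<in> borel_measurable borel" for k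
    using f(1) by (rule borel_measurable_continuous_onI)
  have meas: "f k \<in> borel_measurable M" "f k \<in> borel_measurable N" for k
    using fm measurable_cong_sets[OF M(2) refl] measurable_cong_sets[OF N(2) refl] by blast+
  have UM: "U \<in> sets M" "U \<in> sets N"
    using U M(2) N(2) by auto
  have "(\<lambda>k. \<integral>x. f k x \<partial>M) \<longlonglongrightarrow> (\<integral>x. indicator U x \<partial>M)"
    by (rule integral_dominated_convergence[where w = "\<lambda>_. 1"]) (use meas UM f(3) fb in auto)
  moreover have "(\<lambda>k. \<integral>x. f k x \<partial>N) \<longlonglongrightarrow> (\<integral>x. indicator U x \<partial>N)"
    by (rule integral_dominated_convergence[where w = "\<lambda>_. 1"]) (use meas UM f(3) fb in auto)
  moreover have "(\<integral>x. f k x \<partial>M) = (\<integral>x. f k x \<partial>N)" for k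
    by (rule eq[OF f(1,2)])
  ultimately have "(\<integral>x. indicator U x \<partial>M) = (\<integral>x. indicator U x \<partial>N :: real)"
    using LIMSEQ_unique by simp
  then have "measure M U = measure N U"
    using UM sets.sets_into_space[OF UM(1)] sets.sets_into_space[OF UM(2)] by (simp add: Int_absorb2)
  then show "emeasure M U = emeasure N U"
    by (simp add: M.emeasure_eq_measure N.emeasure_eq_measure)
qed auto

text \<open>The labeling kernel is known through its integrals of continuous functions, which depend
  continuously on the hypergraph. Dominated convergence turns this into measurability of the mass of
  each open set, and open sets generate.\<close>

lemma measurable_prob_kernel_continuous:
  fixes K :: "'b \<Rightarrow> 'a::metric_space measure"
  assumes K: "\<And>a. a \<in> space M \<Longrightarrow> prob_space (K a)" "\<And>a. a \<in> space M \<Longrightarrow> sets (K a) = sets borel"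
    and meas: "\<And>f :: 'a \<Rightarrow> real. continuous_on UNIV f \<Longrightarrow> (\<And>x. f x \<in> {0..1}) \<Longrightarrow>
      (\<lambda>a. \<integral>x. f x \<partial>K a) \<in> borel_measurable M"
  shows "K \<in> measurable M (subprob_algebra borel)"
proof (rule measurable_subprob_algebra_generated[where G = "{U. open U}" and \<Omega> = UNIV])
  show "sets (borel :: 'a measure) = sigma_sets UNIV {U. open U}"
    by (simp add: borel_def)
  show "Int_stable {U :: 'a set. open U}"
    by (auto simp: Int_stable_def)
  show "subprob_space (K a)" if "a \<in> space M" for a
    using K(1)[OF that] by (rule prob_space_imp_subprob_space)
  show "sets (K a) = sets borel" if "a \<in> space M" for a
    by (rule K(2)[OF that])
  have main: "(\<lambda>a. emeasure (K a) U) \<in> borel_measurable M" if U: "open U" for U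
  proof -
    obtain f :: "nat \<Rightarrow> 'a \<Rightarrow> real" where f: "\<And>k. continuous_on UNIV (f k)" "\<And>k x. f k x \<in> {0..1}"
      "\<And>x. (\<lambda>k. f k x) \<longlonglongrightarrow> indicator U x"
      using open_indicator_limit[OF U] by blast
    have fb: "norm (f k x) \<le> 1" for k x
      using f(2)[of k x] by simp
    have fm: "f k \<in> borel_measurable borel" for k
      using f(1) by (rule borel_measurable_continuous_onI)
    have "(\<lambda>a. measure (K a) U) \<in> borel_measurable M"
    proof (rule borel_measurable_LIMSEQ_metric)
      show "(\<lambda>a. \<integral>x. f k x \<partial>K a) \<in> borel_measurable M" for k
        by (rule meas[OF f(1,2)])
      fix a assume a: "a \<in> space M"
      interpret prob_space "K a" by (rule K(1)[OF a])
      have km: "f k \<in> borel_measurable (K a)" for k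
        using fm measurable_cong_sets[OF K(2)[OF a] refl] by blast
      have Ua: "U \<in> sets (K a)"
        using U K(2)[OF a] by simp
      have "(\<lambda>k. \<integral>x. f k x \<partial>K a) \<longlonglongrightarrow> (\<integral>x. indicator U x \<partial>K a)"
        by (rule integral_dominated_convergence[where w = "\<lambda>_. 1"]) (use km Ua f(3) fb in auto)
      then show "(\<lambda>k. \<integral>x. f k x \<partial>K a) \<longlonglongrightarrow> measure (K a) U"
        using sets.sets_into_space[OF Ua] by (simp add: Int_absorb2)
    qed
    then have "(\<lambda>a. ennreal (measure (K a) U)) \<in> borel_measurable M"
      by simp
    moreover have "emeasure (K a) U = ennreal (measure (K a) U)" if a: "a \<in> space M" for a
      using finite_measure.emeasure_eq_measure[OF prob_space.finite_measure[OF K(1)[OF a]]] .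
    ultimately show ?thesis
      by (subst measurable_cong) auto
  qed
  then show "(\<lambda>a. emeasure (K a) U) \<in> borel_measurable M" if "U \<in> {U. open U}" for U
    using that by simp
  show "(\<lambda>a. emeasure (K a) UNIV) \<in> borel_measurable M"
    by (rule main) simp
qed auto

section \<open>Densities of labeled representatives\<close>

lemma hypergraph_cases:
  obtains n A where "n > 0" "G = unlabel n A"
proof (induction G rule: hypergraph.abs_induct)
  case (1 y)
  then obtain n A where y: "y = (n, A)" "hiso (n, A) (n, A)"
    by (cases y) auto
  then have "n > 0"
    by (auto elim: hisoE)
  with 1(2) show ?case
    by (simp add: y(1) unlabel_def)
qed

lemma nverts_unlabel: "n > 0 \<Longrightarrow> nverts (unlabel n A) = n"
  unfolding unlabel_def by (subst nverts.abs_eq) (auto intro: hiso_refl)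

lemma nverts_pos: "nverts G > 0"
  by (cases G rule: hypergraph_cases) (simp add: nverts_unlabel)

lemma unlabel_eqI: "n > 0 \<Longrightarrow> (\<And>v. v \<in> tuples n \<Longrightarrow> A v = B v) \<Longrightarrow> unlabel n A = unlabel n B"
  unfolding unlabel_def by (intro Quotient_rel_abs[OF Quotient_hypergraph] hisoI[of _ id]) auto

lemma unlabel_in_hypergraphs:
  "n > 0 \<Longrightarrow> unlabel n A \<in> hypergraphs S \<longleftrightarrow> (\<forall>v\<in>tuples n. A v \<in> S)"
  unfolding unlabel_def hypergraphs_def
  by (simp, subst decorations.abs_eq) (auto intro: hiso_refl)

lemma hom_density_unlabel:
  "m > 0 \<Longrightarrow> n > 0 \<Longrightarrow> hom_density (unlabel m F) (unlabel n A) =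
    (\<Sum>\<phi> \<in> {..<m} \<rightarrow>\<^sub>E {..<n}. hom_weight m F A \<phi>) / real n ^ m"
  unfolding unlabel_def by (subst hom_density.abs_eq) (auto intro: hiso_refl)

lemma inj_density_unlabel:
  "m > 0 \<Longrightarrow> n > 0 \<Longrightarrow> inj_density (unlabel m F) (unlabel n A) =
    (\<Sum>\<phi> \<in> inj_maps m n. hom_weight m F A \<phi>) / real (card (inj_maps m n))"
  unfolding unlabel_def by (subst inj_density.abs_eq) (auto intro: hiso_refl)

lemma random_labeling_unlabel:
  "n > 0 \<Longrightarrow> random_labeling \<kappa> (unlabel n A) =
    map_pmf (\<lambda>\<sigma>. add_isolated \<kappa> n (relabel \<sigma> A)) (pmf_of_set {\<sigma>. \<sigma> permutes {..<n}})"
  unfolding unlabel_def by (subst random_labeling.abs_eq) (auto intro: hiso_refl)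

lemma finite_tuples [simp]: "finite (tuples n :: ('r::finite \<Rightarrow> nat) set)"
  using finite_PiE[of "UNIV :: 'r set" "\<lambda>_. {..<n}"] by (simp add: PiE_UNIV_domain)

text \<open>The universal property of a disjoint union of quotients. Continuity, and with it Borel
  measurability, of densities, vertex counts and label means is checked on labeled
  representatives.\<close>

lemma continuous_on_hypergraphI:
  fixes f :: "('r, 'k::topological_space) hypergraph \<Rightarrow> 'b::topological_space"
  assumes "\<And>n. n > 0 \<Longrightarrow> continuous_on UNIV (\<lambda>A. f (unlabel n A))"
  shows "continuous_on UNIV f"
  unfolding continuous_on_open_vimage[OF open_UNIV]
proof (intro allI impI)
  fix B :: "'b set" assume "open B"
  then have "open ((\<lambda>A. f (unlabel n A)) -` B)" if "n > 0" for n
    using assms[OF that] that unfolding continuous_on_open_vimage[OF open_UNIV] by simp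
  then show "open (f -` B \<inter> UNIV)"
    by (simp add: open_hypergraph_def vimage_def)
qed

lemma continuous_on_hom_weight:
  "continuous_on UNIV (\<lambda>A. hom_weight m F A \<phi>)"
  unfolding hom_weight_def
  by (intro continuous_on_prod continuous_on_compose2[OF continuous_on_apply_bcontfun[of UNIV]]
      continuous_on_product_coordinates) auto

lemma continuous_hom_density: "continuous_on UNIV (hom_density F)"
proof (rule continuous_on_hypergraphI)
  fix n :: nat assume "n > 0"
  then show "continuous_on UNIV (\<lambda>A. hom_density F (unlabel n A))"
    by (cases F rule: hypergraph_cases)
      (simp add: hom_density_unlabel continuous_on_hom_weight continuous_on_divide continuous_on_sum)
qed

lemma continuous_inverse_nverts:
  "continuous_on UNIV (\<lambda>G :: ('r, 'k::topological_space) hypergraph. 1 / real (nverts G))"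
  by (rule continuous_on_hypergraphI) (simp add: nverts_unlabel)

lemma hom_weight_norm_le:
  "\<bar>hom_weight m F A \<phi>\<bar> \<le> (\<Prod>v\<in>tuples m. norm (F v))"
  unfolding hom_weight_def abs_prod
  by (rule prod_mono) (use norm_bounded in \<open>auto simp flip: real_norm_def\<close>)

lemma card_tuple_maps: "card ({..<m} \<rightarrow>\<^sub>E {..<n::nat}) = n ^ m"
  by (simp add: card_PiE)

lemma hom_density_norm_le:
  assumes "m > 0"
  shows "\<bar>hom_density (unlabel m F) G\<bar> \<le> (\<Prod>v\<in>tuples m. norm (F v))"
proof (cases G rule: hypergraph_cases)
  case (1 n A)
  have "\<bar>\<Sum>\<phi> \<in> {..<m} \<rightarrow>\<^sub>E {..<n}. hom_weight m F A \<phi>\<bar> \<le> (\<Sum>\<phi> \<in> {..<m} \<rightarrow>\<^sub>E {..<n}. \<Prod>v\<in>tuples m. norm (F v))"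
    by (rule order_trans[OF sum_abs sum_mono]) (rule hom_weight_norm_le)
  also have "\<dots> = real n ^ m * (\<Prod>v\<in>tuples m. norm (F v))"
    by (simp add: card_tuple_maps)
  finally show ?thesis
    using 1 assms by (simp add: hom_density_unlabel field_simps)
qed

text \<open>Each weight contains the decoration at \<open>w\<close> in exactly one factor, so the
  density is linear in every slot separately. This allows decorations to be replaced tuple by
  tuple.\<close>

lemma hom_density_update:
  assumes "m > 0" "w \<in> tuples m"
  shows "hom_density (unlabel m (F(w := 0))) G = 0"
    "hom_density (unlabel m (F(w := f + g))) G = hom_density (unlabel m (F(w := f))) G + hom_density (unlabel m (F(w := g))) G"
    "hom_density (unlabel m (F(w := c *\<^sub>R f))) G = c * hom_density (unlabel m (F(w := f))) G"
proof -
  have split: "hom_weight m (F(w := f)) A \<phi> =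
      apply_bcontfun f (A (\<phi> \<circ> w)) * (\<Prod>v\<in>tuples m - {w}. apply_bcontfun (F v) (A (\<phi> \<circ> v)))" for f A \<phi>
    unfolding hom_weight_def by (subst prod.remove[OF finite_tuples assms(2)]) simp
  obtain n A where G: "n > 0" "G = unlabel n A"
    by (rule hypergraph_cases)
  show "hom_density (unlabel m (F(w := 0))) G = 0"
    using assms(1) G by (simp add: hom_density_unlabel split)
  show "hom_density (unlabel m (F(w := f + g))) G = hom_density (unlabel m (F(w := f))) G + hom_density (unlabel m (F(w := g))) G"
    using assms(1) G by (simp add: hom_density_unlabel split distrib_right sum.distrib add_divide_distrib)
  show "hom_density (unlabel m (F(w := c *\<^sub>R f))) G = c * hom_density (unlabel m (F(w := f))) G"
    using assms(1) G by (simp add: hom_density_unlabel split mult.assoc flip: sum_distrib_left)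
qed

text \<open>The difference is the density with \<open>f - g\<close> in slot \<open>w\<close>. The
  constant is independent of \<open>G\<close>, so norm convergence of one decoration gives uniform
  convergence of densities.\<close>

lemma hom_density_update_Lipschitz:
  fixes F :: "('r::finite \<Rightarrow> nat) \<Rightarrow> ('k::topological_space \<Rightarrow>\<^sub>C real)"
  assumes "m > 0" "w \<in> tuples m"
  shows "\<bar>hom_density (unlabel m (F(w := f))) G - hom_density (unlabel m (F(w := g))) G\<bar>
    \<le> norm (f - g) * (\<Prod>v\<in>tuples m - {w}. norm (F v))"
proof -
  have "hom_density (unlabel m (F(w := f))) G = hom_density (unlabel m (F(w := f - g))) G + hom_density (unlabel m (F(w := g))) G"
    using hom_density_update(2)[OF assms, of F "f - g" g] by simp
  then have "\<bar>hom_density (unlabel m (F(w := f))) G - hom_density (unlabel m (F(w := g))) G\<bar>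
      \<le> (\<Prod>v\<in>tuples m. norm ((F(w := f - g)) v))"
    using hom_density_norm_le[OF assms(1), of "F(w := f - g)" G] by simp
  also have "\<dots> = norm (f - g) * (\<Prod>v\<in>tuples m - {w}. norm (F v))"
    by (subst prod.remove[OF finite_tuples assms(2)]) simp
  finally show ?thesis .
qed

section \<open>Random labelings\<close>

lemma unlabel_relabel:
  assumes "n > 0" "\<sigma> permutes {..<n}"
  shows "unlabel n (relabel \<sigma> A) = unlabel n A"
  unfolding unlabel_def
  by (intro Quotient_rel_abs[OF Quotient_hypergraph] hisoI[OF assms(1), of \<sigma>])
    (use permutes_imp_bij[OF assms(2)] in \<open>auto simp: relabel_def\<close>)

lemma hom_weight_relabel: "hom_weight m F (relabel \<sigma> A) \<phi> = hom_weight m F A (\<sigma> \<circ> \<phi>)"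
  by (simp add: hom_weight_def relabel_def comp_assoc)

lemma hom_weight_cong_map:
  assumes "\<And>i. i < m \<Longrightarrow> \<phi> i = \<psi> i"
  shows "hom_weight m F A \<phi> = hom_weight m F A \<psi>"
proof -
  have "\<phi> \<circ> v = \<psi> \<circ> v" if "v \<in> tuples m" for v :: "'a \<Rightarrow> nat"
    using that assms by (auto simp: fun_eq_iff)
  then show ?thesis
    unfolding hom_weight_def by (intro prod.cong) auto
qed

text \<open>Taken in the finitely supported \<open>pmf\<close> rather than in the Borel law, the
  mean is a finite sum and makes sense without measurability of \<open>f\<close>.\<close>

definition label_mean ::
  "'k \<Rightarrow> ((('r \<Rightarrow> nat) \<Rightarrow> 'k) \<Rightarrow> real) \<Rightarrow> ('r, 'k) hypergraph \<Rightarrow> real" where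
  "label_mean \<kappa> f G = measure_pmf.expectation (random_labeling \<kappa> G) f"

lemma label_mean_unlabel:
  assumes "n > 0"
  shows "label_mean \<kappa> f (unlabel n A) = (\<Sum>\<sigma> | \<sigma> permutes {..<n}. f (add_isolated \<kappa> n (relabel \<sigma> A))) / fact n"
proof -
  have "{\<sigma>. \<sigma> permutes {..<n}} \<noteq> {}"
    using permutes_id by blast
  then show ?thesis
    unfolding label_mean_def random_labeling_unlabel[OF assms]
    by (simp add: integral_pmf_of_set finite_permutations card_permutations)
qed

lemma label_mean_abs_le:
  assumes "\<And>A. \<bar>f A\<bar> \<le> B"
  shows "\<bar>label_mean \<kappa> f G\<bar> \<le> B"
proof (cases G rule: hypergraph_cases)
  case (1 n A)
  have "\<bar>\<Sum>\<sigma> | \<sigma> permutes {..<n}. f (add_isolated \<kappa> n (relabel \<sigma> A))\<bar> \<le> (\<Sum>\<sigma> | \<sigma> permutes {..<n}. B)"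
    by (rule order_trans[OF sum_abs sum_mono]) (rule assms)
  then show ?thesis
    using 1 by (simp add: label_mean_unlabel card_permutations field_simps)
qed

lemma continuous_on_relabel:
  "continuous_on UNIV (relabel \<sigma> :: (('r \<Rightarrow> nat) \<Rightarrow> 'k::topological_space) \<Rightarrow> _)"
  unfolding relabel_def by (intro continuous_on_coordinatewise_then_product continuous_on_product_coordinates)

lemma continuous_on_add_isolated:
  "continuous_on UNIV (add_isolated \<kappa> n :: (('r \<Rightarrow> nat) \<Rightarrow> 'k::topological_space) \<Rightarrow> _)"
proof (rule continuous_on_coordinatewise_then_product)
  show "continuous_on UNIV (\<lambda>A :: ('r \<Rightarrow> nat) \<Rightarrow> 'k. add_isolated \<kappa> n A v)" for v
    by (cases "v \<in> tuples n") (simp_all add: add_isolated_def)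
qed

lemma continuous_label_mean:
  assumes "continuous_on UNIV f"
  shows "continuous_on UNIV (label_mean \<kappa> f)"
proof (rule continuous_on_hypergraphI)
  fix n :: nat assume "n > 0"
  moreover have "continuous_on UNIV (\<lambda>A. f (add_isolated \<kappa> n (relabel \<sigma> A)))" for \<sigma>
    by (intro continuous_on_compose2[OF assms] continuous_on_compose2[OF continuous_on_add_isolated]
        continuous_on_relabel) auto
  ultimately show "continuous_on UNIV (\<lambda>A. label_mean \<kappa> f (unlabel n A))"
    by (simp add: label_mean_unlabel continuous_on_divide continuous_on_sum)
qed

text \<open>Composing a uniform permutation with \<open>\<sigma>\<close> leaves it uniform, and
  \<open>\<sigma>\<close> preserves the tuples of \<open>[n]\<close>, so the default decorations
  stay in place. With fewer than \<open>N\<close> vertices \<open>\<sigma>\<close> could exchange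
  actual and isolated vertices.\<close>

lemma label_mean_relabel:
  assumes \<sigma>: "\<sigma> permutes {..<N}" and "N \<le> nverts G"
  shows "label_mean \<kappa> (\<lambda>A. f (relabel \<sigma> A)) G = label_mean \<kappa> f G"
proof (cases G rule: hypergraph_cases)
  case (1 n A)
  then have \<sigma>n: "\<sigma> permutes {..<n}"
    using assms by (auto simp: nverts_unlabel intro: permutes_subset)
  have "relabel \<sigma> (add_isolated \<kappa> n (relabel \<pi> A)) = add_isolated \<kappa> n (relabel (\<pi> \<circ> \<sigma>) A)" for \<pi>
  proof
    fix v :: "'a \<Rightarrow> nat"
    have "\<sigma> \<circ> v \<in> tuples n \<longleftrightarrow> v \<in> tuples n"
      using permutes_in_image[OF \<sigma>n] by (simp add: Pi_iff)
    then show "relabel \<sigma> (add_isolated \<kappa> n (relabel \<pi> A)) v = add_isolated \<kappa> n (relabel (\<pi> \<circ> \<sigma>) A) v"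
      by (simp add: relabel_def add_isolated_def comp_assoc)
  qed
  then show ?thesis
    using 1 sum_permutations_compose_right[OF \<sigma>n, of "\<lambda>\<pi>. f (add_isolated \<kappa> n (relabel \<pi> A))"]
    by (simp add: label_mean_unlabel)
qed

section \<open>Injective versus arbitrary vertex maps\<close>

text \<open>The complements of \<open>[m]\<close> and of the image have equally many elements, so a
  bijection between them completes the map. Injective maps can then be absorbed into a uniform or
  exchangeable labeling.\<close>

lemma inj_map_extends_to_permutation:
  assumes "\<phi> \<in> inj_maps m n"
  obtains \<tau> where "m \<le> n" "\<tau> permutes {..<n}" "\<And>i. i < m \<Longrightarrow> \<tau> i = \<phi> i"
proof -
  have inj: "inj_on \<phi> {..<m}" and im: "\<phi> ` {..<m} \<subseteq> {..<n}"
    using assms by (auto simp: inj_maps_def)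
  have "m \<le> n"
    using card_inj_on_le[OF inj im] by simp
  then have "card ({..<n} - {..<m}) = card ({..<n} - \<phi> ` {..<m})"
    using im card_image[OF inj] by (simp add: card_Diff_subset)
  then obtain g where g: "bij_betw g ({..<n} - {..<m}) ({..<n} - \<phi> ` {..<m})"
    using finite_same_card_bij[of "{..<n} - {..<m}" "{..<n} - \<phi> ` {..<m}"] by auto
  define \<tau> where "\<tau> i = (if i < m then \<phi> i else if i < n then g i else i)" for i
  have "bij_betw \<tau> {..<m} (\<phi> ` {..<m})"
    using inj by (subst bij_betw_cong[where g = \<phi>]) (auto simp: \<tau>_def bij_betw_def)
  moreover have "bij_betw \<tau> ({..<n} - {..<m}) ({..<n} - \<phi> ` {..<m})"
    using g by (subst bij_betw_cong[where g = g]) (auto simp: \<tau>_def)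
  ultimately have "bij_betw \<tau> ({..<m} \<union> ({..<n} - {..<m})) (\<phi> ` {..<m} \<union> ({..<n} - \<phi> ` {..<m}))"
    by (rule bij_betw_combine) auto
  moreover have "{..<m} \<union> ({..<n} - {..<m}) = {..<n}" "\<phi> ` {..<m} \<union> ({..<n} - \<phi> ` {..<m}) = {..<n}"
    using im \<open>m \<le> n\<close> by auto
  ultimately have "bij_betw \<tau> {..<n} {..<n}"
    by simp
  then have "\<tau> permutes {..<n}"
    using \<open>m \<le> n\<close> by (intro bij_imp_permutes) (auto simp: \<tau>_def)
  then show thesis
    using \<open>m \<le> n\<close> by (intro that[of \<tau>]) (auto simp: \<tau>_def)
qed

text \<open>Union bound over the ordered pairs of colliding points, of which there are at most m^2.
  A map with a prescribed collision is determined by its values off the second point, which leaves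
  n^(m-1) choices. Multiplying by n keeps the estimate free of division.\<close>

lemma card_non_inj_maps:
  "card (({..<m} \<rightarrow>\<^sub>E {..<n}) - inj_maps m n) * n \<le> m\<^sup>2 * n ^ m"
proof -
  let ?E = "{..<m} \<rightarrow>\<^sub>E {..<n}"
  define C where "C p = {\<phi> \<in> ?E. \<phi> (fst p) = \<phi> (snd p)}" for p
  let ?P = "{p \<in> {..<m} \<times> {..<m}. fst p \<noteq> snd p}"
  have "?E - inj_maps m n \<subseteq> (\<Union>p\<in>?P. C p)"
  proof
    fix \<phi> assume "\<phi> \<in> ?E - inj_maps m n"
    then obtain i j where "\<phi> \<in> ?E" "i < m" "j < m" "\<phi> i = \<phi> j" "i \<noteq> j"
      by (auto simp: inj_maps_def inj_on_def)
    then show "\<phi> \<in> (\<Union>p\<in>?P. C p)"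
      by (intro UN_I[of "(i, j)"]) (simp_all add: C_def)
  qed
  then have "card (?E - inj_maps m n) \<le> card (\<Union>p\<in>?P. C p)"
    by (intro card_mono finite_UN_I) (simp_all add: C_def finite_PiE)
  also have "\<dots> \<le> (\<Sum>p\<in>?P. card (C p))"
    by (rule card_UN_le) simp
  finally have le: "card (?E - inj_maps m n) \<le> (\<Sum>p\<in>?P. card (C p))" .
  have "card (C p) * n \<le> n ^ m" if p: "p \<in> ?P" for p
  proof -
    have j: "snd p < m" "fst p < m" "fst p \<noteq> snd p"
      using p by auto
    have "inj_on (\<lambda>\<phi>. restrict \<phi> ({..<m} - {snd p})) (C p)"
    proof (rule inj_onI)
      fix \<phi> \<psi> assume a: "\<phi> \<in> C p" "\<psi> \<in> C p"
        and eq: "restrict \<phi> ({..<m} - {snd p}) = restrict \<psi> ({..<m} - {snd p})"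
      have eq': "\<phi> i = \<psi> i" if "i < m" "i \<noteq> snd p" for i
        using fun_cong[OF eq, of i] that by simp
      show "\<phi> = \<psi>"
      proof
        fix i
        show "\<phi> i = \<psi> i"
        proof (cases "i < m")
          case True
          then show ?thesis
            using eq'[of i] eq'[OF j(2,3)] a by (cases "i = snd p") (auto simp: C_def)
        next
          case False
          then show ?thesis
            using a by (auto simp: C_def PiE_iff extensional_def)
        qed
      qed
    qed
    then have "card (C p) \<le> card (({..<m} - {snd p}) \<rightarrow>\<^sub>E {..<n})"
    proof (rule card_inj_on_le)
      show "(\<lambda>\<phi>. restrict \<phi> ({..<m} - {snd p})) ` C p \<subseteq> ({..<m} - {snd p}) \<rightarrow>\<^sub>E {..<n}"
        unfolding C_def by (intro image_subsetI restrict_PiE_iff[THEN iffD2]) (simp add: PiE_iff)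
    qed (simp add: finite_PiE)
    also have "\<dots> = n ^ (m - 1)"
      using j by (simp add: card_PiE)
    finally have "card (C p) * n \<le> n ^ (m - 1) * n"
      by simp
    also have "\<dots> = n ^ m"
      using j by (simp flip: power_Suc2)
    finally show ?thesis .
  qed
  then have "(\<Sum>p\<in>?P. card (C p)) * n \<le> (\<Sum>p\<in>?P. n ^ m)"
    unfolding sum_distrib_right by (rule sum_mono)
  also have "\<dots> \<le> m\<^sup>2 * n ^ m"
    using card_mono[of "{..<m} \<times> {..<m}" ?P] by (auto simp: power2_eq_square)
  finally show ?thesis
    using le by (meson le_trans mult_le_mono1)
qed

text \<open>
  Composing with a uniformly random permutation changes neither side, and after averaging over it
  every injective map contributes exactly the mean over labelings; only the non-injective maps, a
  proportion of at most \<open>m\<^sup>2 / n\<close>, remain.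
\<close>

lemma hom_density_label_mean:
  fixes F :: "('r::finite \<Rightarrow> nat) \<Rightarrow> ('k::topological_space \<Rightarrow>\<^sub>C real)"
  assumes "m > 0"
  shows "\<bar>hom_density (unlabel m F) G - label_mean \<kappa> (\<lambda>A. hom_weight m F A id) G\<bar>
    \<le> 2 * (\<Prod>v\<in>tuples m. norm (F v)) * (real m)\<^sup>2 / real (nverts G)"
proof (cases G rule: hypergraph_cases)
  case (1 n A)
  let ?E = "{..<m} \<rightarrow>\<^sub>E {..<n}" and ?P = "{\<sigma>. \<sigma> permutes {..<n}}"
  define B where "B = (\<Prod>v\<in>tuples m. norm (F v))"
  define L where "L = label_mean \<kappa> (\<lambda>A. hom_weight m F A id) G"
  define X where "X \<phi> = (\<Sum>\<sigma>\<in>?P. hom_weight m F (relabel \<sigma> A) \<phi>) / fact n" for \<phi>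
  have np: "real n ^ m > 0"
    using 1 by simp
  have B: "\<bar>hom_weight m F A' \<phi>\<bar> \<le> B" for A' \<phi>
    unfolding B_def by (rule hom_weight_norm_le)
  have L_le: "\<bar>L\<bar> \<le> B"
    unfolding L_def by (rule label_mean_abs_le) (rule B)
  have X_le: "\<bar>X \<phi>\<bar> \<le> B" for \<phi>
  proof -
    have "\<bar>\<Sum>\<sigma>\<in>?P. hom_weight m F (relabel \<sigma> A) \<phi>\<bar> \<le> (\<Sum>\<sigma>\<in>?P. B)"
      by (rule order_trans[OF sum_abs sum_mono]) (rule B)
    then show ?thesis
      by (simp add: X_def card_permutations field_simps)
  qed
  have "(\<Sum>\<phi>\<in>?E. hom_weight m F (relabel \<sigma> A) \<phi>) = (\<Sum>\<phi>\<in>?E. hom_weight m F A \<phi>)" if "\<sigma> \<in> ?P" for \<sigma>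
  proof -
    have "hom_density (unlabel m F) (unlabel n (relabel \<sigma> A)) = hom_density (unlabel m F) (unlabel n A)"
      using that 1 by (simp add: unlabel_relabel)
    then show ?thesis
      using np assms 1 by (simp add: hom_density_unlabel)
  qed
  then have "(\<Sum>\<phi>\<in>?E. X \<phi>) = (\<Sum>\<phi>\<in>?E. hom_weight m F A \<phi>)"
    unfolding X_def sum_divide_distrib[symmetric] by (subst sum.swap) (simp add: card_permutations)
  then have hom: "hom_density (unlabel m F) G = (\<Sum>\<phi>\<in>?E. X \<phi>) / real n ^ m"
    using assms 1 by (simp add: hom_density_unlabel)
  \<comment> \<open>For n < m this is vacuous, and the final estimate comes from the non-injective
    maps alone.\<close>
  have inj: "X \<phi> = L" if \<phi>: "\<phi> \<in> inj_maps m n" for \<phi>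
  proof -
    obtain \<tau> where \<tau>: "m \<le> n" "\<tau> permutes {..<n}" "\<And>i. i < m \<Longrightarrow> \<tau> i = \<phi> i"
      using inj_map_extends_to_permutation[OF \<phi>] by blast
    have "(\<Sum>\<sigma>\<in>?P. hom_weight m F (relabel \<sigma> A) \<phi>) = (\<Sum>\<sigma>\<in>?P. hom_weight m F A (\<sigma> \<circ> \<tau>))"
      unfolding hom_weight_relabel using \<tau>(3) by (intro sum.cong hom_weight_cong_map) auto
    also have "\<dots> = (\<Sum>\<sigma>\<in>?P. hom_weight m F A \<sigma>)"
      by (rule sum_permutations_compose_right[OF \<tau>(2), symmetric])
    also have "\<dots> = (\<Sum>\<sigma>\<in>?P. hom_weight m F (add_isolated \<kappa> n (relabel \<sigma> A)) id)"
    proof (rule sum.cong[OF refl])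
      fix \<sigma>
      \<comment> \<open>Tuples of \<open>[m]\<close> lie in \<open>[n]\<close>, so the default
        decoration \<open>\<kappa>\<close> is never read.\<close>
      have "v \<in> tuples n" if "v \<in> tuples m" for v :: "'r \<Rightarrow> nat"
        using that \<tau>(1) by (auto simp: Pi_iff intro: less_le_trans)
      then show "hom_weight m F A \<sigma> = hom_weight m F (add_isolated \<kappa> n (relabel \<sigma> A)) id"
        unfolding hom_weight_def add_isolated_def relabel_def by (intro prod.cong) auto
    qed
    finally show ?thesis
      using 1 by (simp add: X_def L_def label_mean_unlabel)
  qed
  have "hom_density (unlabel m F) G - L = (\<Sum>\<phi>\<in>?E. X \<phi> - L) / real n ^ m"
    using np by (simp add: hom sum_subtractf card_tuple_maps field_simps)
  also have "(\<Sum>\<phi>\<in>?E. X \<phi> - L) = (\<Sum>\<phi>\<in>?E - inj_maps m n. X \<phi> - L)"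
    by (rule sum.mono_neutral_right) (auto simp: inj intro: finite_PiE)
  finally have "\<bar>hom_density (unlabel m F) G - L\<bar> = \<bar>\<Sum>\<phi>\<in>?E - inj_maps m n. X \<phi> - L\<bar> / real n ^ m"
    by simp
  also have "\<bar>\<Sum>\<phi>\<in>?E - inj_maps m n. X \<phi> - L\<bar> \<le> (\<Sum>\<phi>\<in>?E - inj_maps m n. 2 * B)"
  proof (rule order_trans[OF sum_abs sum_mono])
    fix \<phi>
    show "\<bar>X \<phi> - L\<bar> \<le> 2 * B"
      using X_le[of \<phi>] L_le by linarith
  qed
  then have "\<bar>\<Sum>\<phi>\<in>?E - inj_maps m n. X \<phi> - L\<bar> / real n ^ m
      \<le> real (card (?E - inj_maps m n)) * (2 * B) / real n ^ m"
    using np by (simp add: divide_right_mono)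
  also have "\<dots> \<le> 2 * B * (real m)\<^sup>2 / real n"
  proof -
    have "real (card (?E - inj_maps m n)) * real n \<le> (real m)\<^sup>2 * real n ^ m"
      using card_non_inj_maps[of m n] by (metis of_nat_le_iff of_nat_mult of_nat_power)
    then have "(2 * B) * (real (card (?E - inj_maps m n)) * real n) \<le> (2 * B) * ((real m)\<^sup>2 * real n ^ m)"
      using L_le by (intro mult_left_mono) auto
    then show ?thesis
      using np 1 by (simp add: field_simps)
  qed
  finally show ?thesis
    using 1 by (simp add: L_def B_def nverts_unlabel)
qed

section \<open>Algebra of densities\<close>

text \<open>
  The constant \<open>1\<close> need not lie in \<open>\<F>\<close>, so products of densities with decorations
  in \<open>\<F>\<close> leave \<open>\<Pi>(\<F>)\<close>; this is why the densities of all continuous decorations are needed.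
\<close>

definition disj_union ::
  "nat \<Rightarrow> (('r \<Rightarrow> nat) \<Rightarrow> ('k::topological_space \<Rightarrow>\<^sub>C real)) \<Rightarrow> (('r \<Rightarrow> nat) \<Rightarrow> ('k \<Rightarrow>\<^sub>C real)) \<Rightarrow>
   ('r \<Rightarrow> nat) \<Rightarrow> ('k \<Rightarrow>\<^sub>C real)" where
  "disj_union m F F' v =
    (if v \<in> tuples m then F v else if \<forall>i. m \<le> v i then F' (\<lambda>i. v i - m) else const_bcontfun 1)"

text \<open>A tuple of \<open>[m + m']\<close> lies in the first block, is a shifted tuple of the
  second, or mixes both blocks. The mixed tuples carry the constant 1 and drop out of the
  product.\<close>

lemma hom_weight_disj_union:
  fixes F F' :: "('r::finite \<Rightarrow> nat) \<Rightarrow> ('k::topological_space \<Rightarrow>\<^sub>C real)"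
  shows "hom_weight (m + m') (disj_union m F F') A \<psi> =
    hom_weight m F A \<psi> * hom_weight m' F' A (\<lambda>i. \<psi> (m + i))"
proof -
  define shift :: "('r \<Rightarrow> nat) \<Rightarrow> 'r \<Rightarrow> nat" where "shift v = (\<lambda>i. m + v i)" for v
  define w where "w v = apply_bcontfun (disj_union m F F' v) (A (\<psi> \<circ> v))" for v
  have inj: "inj_on shift (tuples m')"
    by (rule inj_onI) (simp add: shift_def fun_eq_iff)
  have sub: "tuples m \<union> shift ` tuples m' \<subseteq> tuples (m + m')"
    by (auto simp: shift_def Pi_iff intro: trans_less_add1)
  \<comment> \<open>Here r >= 1 matters: a position exists, so no tuple belongs to both
    blocks.\<close>
  have ne: "\<not> (shift v \<in> tuples m)" for v
    by (auto simp: shift_def Pi_iff)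
  have "w v = 1" if v: "v \<in> tuples (m + m') - (tuples m \<union> shift ` tuples m')" for v
  proof -
    have "\<not> (\<forall>i. m \<le> v i)"
    proof
      assume all: "\<forall>i. m \<le> v i"
      then have "v = shift (\<lambda>i. v i - m)"
        by (simp add: shift_def fun_eq_iff)
      moreover have "(\<lambda>i. v i - m) \<in> tuples m'"
      proof
        fix i
        have "v i < m + m'" "m \<le> v i"
          using v all by auto
        then show "v i - m \<in> {..<m'}"
          by auto
      qed
      ultimately show False
        using v by blast
    qed
    then show ?thesis
      using v by (auto simp: w_def disj_union_def const_bcontfun.rep_eq)
  qed
  then have "(\<Prod>v\<in>tuples (m + m'). w v) = (\<Prod>v\<in>tuples m \<union> shift ` tuples m'. w v)"
    by (intro prod.mono_neutral_right sub) auto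
  also have "\<dots> = (\<Prod>v\<in>tuples m. w v) * (\<Prod>v\<in>shift ` tuples m'. w v)"
    by (rule prod.union_disjoint) (use ne in auto)
  also have "(\<Prod>v\<in>tuples m. w v) = hom_weight m F A \<psi>"
    unfolding hom_weight_def by (rule prod.cong) (simp_all add: w_def disj_union_def)
  also have "(\<Prod>v\<in>shift ` tuples m'. w v) = (\<Prod>v\<in>tuples m'. w (shift v))"
    by (simp add: prod.reindex[OF inj])
  also have "\<dots> = hom_weight m' F' A (\<lambda>i. \<psi> (m + i))"
    unfolding hom_weight_def
  proof (rule prod.cong[OF refl])
    fix v :: "'r \<Rightarrow> nat"
    have "disj_union m F F' (shift v) = F' v"
      using ne[of v] by (simp add: disj_union_def) (simp add: shift_def)
    moreover have "\<psi> \<circ> shift v = (\<lambda>i. \<psi> (m + i)) \<circ> v"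
      by (simp add: shift_def fun_eq_iff)
    ultimately show "w (shift v) = apply_bcontfun (F' v) (A ((\<lambda>i. \<psi> (m + i)) \<circ> v))"
      by (simp add: w_def)
  qed
  finally show ?thesis
    by (simp add: hom_weight_def w_def)
qed

lemma hom_density_mult:
  assumes "m > 0" "m' > 0"
  shows "hom_density (unlabel m F) G * hom_density (unlabel m' F') G
    = hom_density (unlabel (m + m') (disj_union m F F')) G"
proof (cases G rule: hypergraph_cases)
  case (1 n A)
  let ?E = "\<lambda>m. {..<m} \<rightarrow>\<^sub>E {..<n}"
  define glue where "glue = (\<lambda>(\<phi>, \<phi>'). \<lambda>i\<in>{..<m + m'}. if i < m then \<phi> i else \<phi>' (i - m) :: nat)"
  define cut where "cut \<psi> = (restrict \<psi> {..<m}, \<lambda>i\<in>{..<m'}. \<psi> (m + i) :: nat)" for \<psi>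
  have bij: "bij_betw glue (?E m \<times> ?E m') (?E (m + m'))"
  proof (rule bij_betw_byWitness[where f' = cut])
    show "\<forall>p\<in>?E m \<times> ?E m'. cut (glue p) = p"
    proof clarify
      fix \<phi> \<phi>' assume p: "\<phi> \<in> ?E m" "\<phi>' \<in> ?E m'"
      then have "\<phi> i = undefined" if "\<not> i < m" for i
        using that by (simp add: PiE_iff extensional_def)
      moreover have "\<phi>' i = undefined" if "\<not> i < m'" for i
        using that p by (simp add: PiE_iff extensional_def)
      ultimately show "cut (glue (\<phi>, \<phi>')) = (\<phi>, \<phi>')"
        by (auto simp: cut_def glue_def restrict_def fun_eq_iff)
    qed
    show "\<forall>\<psi>\<in>?E (m + m'). glue (cut \<psi>) = \<psi>"
      by (auto simp: cut_def glue_def restrict_def fun_eq_iff PiE_iff extensional_def)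
    show "glue ` (?E m \<times> ?E m') \<subseteq> ?E (m + m')"
    proof clarify
      fix \<phi> \<phi>' assume p: "\<phi> \<in> ?E m" "\<phi>' \<in> ?E m'"
      have "\<phi> i < n" if "i < m" for i
        using p(1) that by (auto simp: PiE_iff)
      moreover have "\<phi>' (i - m) < n" if "\<not> i < m" "i < m + m'" for i
      proof -
        have "i - m < m'"
          using that by simp
        then show ?thesis
          using p(2) by (auto simp: PiE_iff)
      qed
      ultimately show "glue (\<phi>, \<phi>') \<in> ?E (m + m')"
        by (simp add: glue_def PiE_iff)
    qed
    show "cut ` ?E (m + m') \<subseteq> ?E m \<times> ?E m'"
    proof (rule image_subsetI)
      fix \<psi> assume "\<psi> \<in> ?E (m + m')"
      then have "\<psi> i < n" if "i < m + m'" for i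
        using that by (simp add: PiE_iff)
      then show "cut \<psi> \<in> ?E m \<times> ?E m'"
        by (simp add: cut_def PiE_iff)
    qed
  qed
  have glue: "hom_weight (m + m') (disj_union m F F') A (glue (\<phi>, \<phi>')) = hom_weight m F A \<phi> * hom_weight m' F' A \<phi>'"
    for \<phi> \<phi>'
    unfolding hom_weight_disj_union
    by (intro arg_cong2[where f = "(*)"] hom_weight_cong_map) (simp_all add: glue_def)
  have "(\<Sum>\<psi>\<in>?E (m + m'). hom_weight (m + m') (disj_union m F F') A \<psi>)
      = (\<Sum>p\<in>?E m \<times> ?E m'. hom_weight (m + m') (disj_union m F F') A (glue p))"
    by (rule sum.reindex_bij_betw[OF bij, symmetric])
  also have "\<dots> = (\<Sum>\<phi>\<in>?E m. \<Sum>\<phi>'\<in>?E m'. hom_weight m F A \<phi> * hom_weight m' F' A \<phi>')"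
    unfolding sum.cartesian_product by (rule sum.cong) (auto simp: glue)
  also have "\<dots> = (\<Sum>\<phi>\<in>?E m. hom_weight m F A \<phi>) * (\<Sum>\<phi>'\<in>?E m'. hom_weight m' F' A \<phi>')"
    by (rule sum_product[symmetric])
  finally show ?thesis
    using 1 assms by (simp add: hom_density_unlabel power_add)
qed

inductive_set linear_span :: "('a \<Rightarrow> real) set \<Rightarrow> ('a \<Rightarrow> real) set" for B where
  base: "f \<in> B \<Longrightarrow> f \<in> linear_span B"
| add: "f \<in> linear_span B \<Longrightarrow> g \<in> linear_span B \<Longrightarrow> (\<lambda>x. f x + g x) \<in> linear_span B"
| scale: "f \<in> linear_span B \<Longrightarrow> (\<lambda>x. c * f x) \<in> linear_span B"

text \<open>Bilinearity reduces the product to generators, by an induction in each factor. It is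
  used for cylinder functions as well as for densities.\<close>

lemma linear_span_mult:
  assumes B: "\<And>f g. f \<in> B \<Longrightarrow> g \<in> B \<Longrightarrow> (\<lambda>x. f x * g x) \<in> B"
    and "f \<in> linear_span B" "g \<in> linear_span B"
  shows "(\<lambda>x. f x * g x) \<in> linear_span B"
  using assms(2)
proof induction
  case (base f)
  from assms(3) show ?case
  proof induction
    case (base g)
    then show ?case
      using \<open>f \<in> B\<close> by (intro linear_span.base B)
  next
    case (add g h)
    then show ?case
      using linear_span.add[OF add.IH] by (simp add: distrib_left)
  next
    case (scale g c)
    then show ?case
      using linear_span.scale[OF scale.IH, of c] by (simp add: mult.left_commute)
  qed
next
  case (add f h)
  then show ?case
    using linear_span.add[OF add.IH] by (simp add: distrib_right)
next
  case (scale f c)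
  then show ?case
    using linear_span.scale[OF scale.IH, of c] by (simp add: mult.assoc)
qed

text \<open>This puts the constant functions into the span of the densities, as a ring of test
  functions requires.\<close>

lemma hom_density_one: "hom_density (unlabel 1 (\<lambda>_. const_bcontfun 1)) G = 1"
proof (cases G rule: hypergraph_cases)
  case (1 n A)
  then show ?thesis
    by (simp add: hom_density_unlabel hom_weight_def const_bcontfun.rep_eq card_tuple_maps[of 1 n, simplified])
qed

lemma linear_span_hom_density_mult:
  assumes "h \<in> linear_span (range hom_density)" "h' \<in> linear_span (range hom_density)"
  shows "(\<lambda>G. h G * h' G) \<in> linear_span (range hom_density)"
proof (rule linear_span_mult[OF _ assms])
  fix f g :: "('a, 'b) hypergraph \<Rightarrow> real"
  assume "f \<in> range hom_density" "g \<in> range hom_density"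
  then obtain F F' where fg: "f = hom_density F" "g = hom_density F'"
    by blast
  obtain m A m' A' where "m > 0" "F = unlabel m A" "m' > 0" "F' = unlabel m' A'"
    by (metis hypergraph_cases)
  then have "(\<lambda>x. f x * g x) = hom_density (unlabel (m + m') (disj_union m A A'))"
    unfolding fg by (simp add: hom_density_mult)
  then show "(\<lambda>x. f x * g x) \<in> range hom_density"
    by simp
qed

lemma continuous_linear_span:
  assumes "f \<in> linear_span B" "\<And>f. f \<in> B \<Longrightarrow> continuous_on S f"
  shows "continuous_on S f"
  using assms(1) by induction (auto intro: assms(2) continuous_intros)

lemma linear_span_hom_density_bounded:
  assumes "h \<in> linear_span (range hom_density)"
  obtains B where "\<And>G. \<bar>h G\<bar> \<le> B" "B \<ge> 0"
proof -
  have "\<exists>B\<ge>0. \<forall>G. \<bar>h G\<bar> \<le> B"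
    using assms
  proof induction
    case (base f)
    then obtain m F where "m > 0" "f = hom_density (unlabel m F)"
      by (metis hypergraph_cases imageE)
    then show ?case
      using hom_density_norm_le[of m F] by (intro exI[of _ "\<Prod>v\<in>tuples m. norm (F v)"]) (simp add: prod_nonneg)
  next
    case (add f g)
    then obtain B B' where "B \<ge> 0" "B' \<ge> 0" "\<forall>G. \<bar>f G\<bar> \<le> B" "\<forall>G. \<bar>g G\<bar> \<le> B'"
      by blast
    then show ?case
      by (intro exI[of _ "B + B'"] conjI allI order_trans[OF abs_triangle_ineq] add_mono) auto
  next
    case (scale f c)
    then obtain B where "B \<ge> 0" "\<forall>G. \<bar>f G\<bar> \<le> B"
      by blast
    then show ?case
      by (intro exI[of _ "\<bar>c\<bar> * B"]) (simp add: abs_mult mult_left_mono)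
  qed
  then show thesis
    using that by blast
qed

section \<open>Laws of random labelings as Borel measures\<close>

lemma
  fixes \<kappa> :: "'k::topological_space"
  shows prob_space_random_labeling_law: "prob_space (random_labeling_law \<kappa> G)"
    and sets_random_labeling_law: "sets (random_labeling_law \<kappa> G) = sets borel"
    and integral_random_labeling_law: "f \<in> borel_measurable borel \<Longrightarrow>
      (\<integral>A. f A \<partial>random_labeling_law \<kappa> G) = label_mean \<kappa> f G"
proof -
  have m: "(\<lambda>A. A) \<in> measurable (measure_pmf (random_labeling \<kappa> G)) borel"
    by simp
  show "prob_space (random_labeling_law \<kappa> G)"
    unfolding random_labeling_law_def by (rule prob_space.prob_space_distr[OF _ m]) (rule measure_pmf.prob_space_axioms)
  show "sets (random_labeling_law \<kappa> G) = sets borel"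
    by (simp add: random_labeling_law_def)
  show "(\<integral>A. f A \<partial>random_labeling_law \<kappa> G) = label_mean \<kappa> f G" if "f \<in> borel_measurable borel"
    unfolding random_labeling_law_def label_mean_def by (rule integral_distr[OF m that])
qed

text \<open>The labeling kernel is measurable because \<open>label_mean \<kappa> f\<close> is
  continuous for continuous \<open>f\<close>; integrating a bounded function against the mixture is
  then an iterated integral. Convergence of \<open>hat_law\<close> thereby becomes convergence of
  expectations of functions of the random hypergraph.\<close>

lemma
  fixes \<kappa> :: "'k::metric_space" and G :: "'w \<Rightarrow> ('r::finite, 'k) hypergraph"
  assumes M: "prob_space M" and G: "G \<in> borel_measurable M"
  shows prob_space_hat_law: "prob_space (hat_law \<kappa> M G)"
    and sets_hat_law: "sets (hat_law \<kappa> M G) = sets borel"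
    and integral_hat_law: "continuous_on UNIV f \<Longrightarrow> (\<And>A. \<bar>f A\<bar> \<le> B) \<Longrightarrow>
      (\<integral>A. f A \<partial>hat_law \<kappa> M G) = (\<integral>\<omega>. label_mean \<kappa> f (G \<omega>) \<partial>M)"
proof -
  interpret prob_space M by fact
  let ?K = "\<lambda>\<omega>. random_labeling_law \<kappa> (G \<omega>)"
  have K: "?K \<in> measurable M (subprob_algebra borel)"
  proof (rule measurable_prob_kernel_continuous)
    fix f :: "(('r \<Rightarrow> nat) \<Rightarrow> 'k) \<Rightarrow> real" assume f: "continuous_on UNIV f"
    have "label_mean \<kappa> f \<in> borel_measurable borel"
      using continuous_label_mean[OF f] by (rule borel_measurable_continuous_onI)
    then show "(\<lambda>\<omega>. \<integral>A. f A \<partial>?K \<omega>) \<in> borel_measurable M"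
      using measurable_compose[OF G] f
      by (simp add: integral_random_labeling_law borel_measurable_continuous_onI)
  qed (rule prob_space_random_labeling_law sets_random_labeling_law)+
  show "prob_space (hat_law \<kappa> M G)"
    unfolding hat_law_def
    by (rule prob_space_bind[OF _ K]) (simp add: prob_space_random_labeling_law)
  show "sets (hat_law \<kappa> M G) = sets borel"
    unfolding hat_law_def by (rule sets_bind) (use not_empty sets_random_labeling_law in auto)
  assume f: "continuous_on UNIV f" and B: "\<And>A. \<bar>f A\<bar> \<le> B"
  have fm: "f \<in> borel_measurable borel"
    using f by (rule borel_measurable_continuous_onI)
  have "(\<integral>A. f A \<partial>hat_law \<kappa> M G) = (\<integral>N. (\<integral>A. f A \<partial>N) \<partial>distr M (subprob_algebra borel) ?K)"
    unfolding hat_law_def bind_nonempty''[OF K not_empty]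
  proof (rule integral_join[where B' = 1])
    show "finite_measure (distr M (subprob_algebra borel) ?K)"
      by (rule prob_space.finite_measure[OF prob_space_distr[OF K]])
    show "AE N in distr M (subprob_algebra borel) ?K. emeasure N (space N) \<le> ennreal 1"
    proof (rule AE_I2)
      fix N assume "N \<in> space (distr M (subprob_algebra borel) ?K)"
      then have "subprob_space N"
        by (simp add: space_subprob_algebra)
      then show "emeasure N (space N) \<le> ennreal 1"
        by (simp add: subprob_space.emeasure_space_le_1)
    qed
  qed (use fm B in auto)
  also have "\<dots> = (\<integral>\<omega>. (\<integral>A. f A \<partial>?K \<omega>) \<partial>M)"
    by (rule integral_distr[OF K]) (rule integral_measurable_subprob_algebra[OF fm])
  finally show "(\<integral>A. f A \<partial>hat_law \<kappa> M G) = (\<integral>\<omega>. label_mean \<kappa> f (G \<omega>) \<partial>M)"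
    by (simp add: integral_random_labeling_law fm)
qed

section \<open>Continuous extension of densities\<close>

lemma compact_space_tau_space: "compact_space (tau_space \<F>)"
  by (simp add: tau_space_def compact_space_prod_topology compact_space_product_topology
      compact_space_subtopology)

lemma Hausdorff_space_tau_space: "Hausdorff_space (tau_space \<F>)"
  by (simp add: tau_space_def Hausdorff_space_prod_topology Hausdorff_space_product_topology
      Hausdorff_space_subtopology)

lemma normal_space_tau_space: "normal_space (tau_space \<F>)"
  by (simp add: compact_Hausdorff_or_regular_imp_normal_space compact_space_tau_space Hausdorff_space_tau_space)

lemma continuous_map_tau_coordinate:
  assumes "F \<in> hypergraphs \<F>"
  shows "continuous_map (tau_space \<F>) euclideanreal (\<lambda>\<gamma>. fst \<gamma> F)"
proof -
  have "continuous_map (tau_space \<F>) (top_of_set {-1..1::real}) ((\<lambda>x. x F) \<circ> fst)"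
    unfolding tau_space_def
    by (rule continuous_map_compose[OF continuous_map_fst]) (rule continuous_map_product_projection[OF assms])
  then show ?thesis
    by (simp add: continuous_map_in_subtopology o_def)
qed

lemma continuous_map_tau_snd:
  "continuous_map (tau_space \<F> :: ('r::finite, 'k::topological_space) tau_point topology) euclideanreal snd"
proof -
  have "continuous_map (tau_space \<F> :: ('r, 'k) tau_point topology) (top_of_set {0..1::real}) snd"
    unfolding tau_space_def by (rule continuous_map_snd)
  then show ?thesis
    by (simp add: continuous_map_in_subtopology)
qed

lemma continuous_map_into_tau_space:
  assumes "\<And>F. F \<in> hypergraphs \<F> \<Longrightarrow> continuous_map X euclideanreal (\<lambda>x. f x F)"
    and "\<And>F x. F \<in> hypergraphs \<F> \<Longrightarrow> x \<in> topspace X \<Longrightarrow> f x F \<in> {-1..1}"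
    and "\<And>F x. F \<notin> hypergraphs \<F> \<Longrightarrow> x \<in> topspace X \<Longrightarrow> f x F = undefined"
    and "continuous_map X euclideanreal g" "\<And>x. x \<in> topspace X \<Longrightarrow> g x \<in> {0..1}"
  shows "continuous_map X (tau_space \<F>) (\<lambda>x. (f x, g x))"
  unfolding tau_space_def
proof (rule continuous_map_pairedI)
  show "continuous_map X (product_topology (\<lambda>_. top_of_set {-1..1}) (hypergraphs \<F>)) f"
    by (rule continuous_map_coordinatewise_then_product)
      (use assms in \<open>auto simp: continuous_map_in_subtopology\<close>)
  show "continuous_map X (top_of_set {0..1}) g"
    using assms by (auto simp: continuous_map_in_subtopology)
qed

lemma Pi_plus_closure_closed: "closedin (tau_space \<F>) (Pi_plus_closure \<F>)"
  by (simp add: Pi_plus_closure_def)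

text \<open>By compactness, the boundedness that \<open>converges_in_law\<close> demands of test
  functions holds for every continuous one.\<close>

lemma bounded_continuous_tau_space:
  assumes "continuous_map (tau_space \<F>) euclideanreal g"
  shows "bounded (g ` topspace (tau_space \<F>))"
proof -
  have "compactin euclideanreal (g ` topspace (tau_space \<F>))"
    using compact_space_tau_space assms unfolding compact_space_def by (rule image_compactin)
  then show ?thesis
    by (simp add: compact_imp_bounded)
qed

lemma abs_hom_density_le_1:
  assumes "\<forall>f\<in>\<F>. norm f \<le> 1" "F \<in> hypergraphs \<F>"
  shows "\<bar>hom_density F G\<bar> \<le> 1"
proof (cases F rule: hypergraph_cases)
  case (1 m F')
  then have "norm (F' v) \<le> 1" if "v \<in> tuples m" for v
    using assms that by (auto simp: unlabel_in_hypergraphs)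
  then have "(\<Prod>v\<in>tuples m. norm (F' v)) \<le> 1"
    by (intro prod_le_1) auto
  then show ?thesis
    using hom_density_norm_le[of m F' G] 1 by simp
qed

lemma one_over_nverts: "1 / real (nverts G) \<in> {0<..1}"
  using nverts_pos[of G] by simp

lemma continuous_map_tau_plus:
  assumes "\<forall>f\<in>\<F>. norm f \<le> 1"
  shows "continuous_map euclidean (tau_space \<F>) (tau_plus \<F>)"
  unfolding tau_plus_def
proof (rule continuous_map_into_tau_space)
  show "(\<lambda>F\<in>hypergraphs \<F>. hom_density F G) F \<in> {-1..1}" if "F \<in> hypergraphs \<F>" for F G
    using abs_hom_density_le_1[OF assms that, of G] that by (simp add: abs_le_iff)
  show "1 / real (nverts G) \<in> {0..1}" for G :: "('b, 'a) hypergraph"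
    using one_over_nverts[of G] by simp
qed (simp_all add: continuous_hom_density continuous_inverse_nverts)

lemma Pi_plus_subset_closure:
  assumes "\<forall>f\<in>\<F>. norm f \<le> 1"
  shows "tau_plus \<F> G \<in> Pi_plus_closure \<F>"
proof -
  have "range (tau_plus \<F>) \<subseteq> topspace (tau_space \<F>)"
    using continuous_map_tau_plus[OF assms] by (auto simp: continuous_map_def)
  then show ?thesis
    unfolding Pi_plus_closure_def Pi_plus_def by (intro subsetD[OF closure_of_subset]) auto
qed

text \<open>The extension of a density lives on this subspace. Density in the subspace topology
  carries equalities and closed inequalities from \<open>Pi_plus \<F>\<close> to its
  closure.\<close>

lemma closure_Pi_plus_dense:
  fixes \<F> :: "('k::topological_space \<Rightarrow>\<^sub>C real) set"
  defines "C \<equiv> Pi_plus_closure \<F> :: ('r::finite, 'k) tau_point set"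
  assumes "\<forall>f\<in>\<F>. norm f \<le> 1"
  shows "subtopology (tau_space \<F>) C closure_of Pi_plus \<F> = C"
proof -
  have "Pi_plus \<F> \<subseteq> C"
    using Pi_plus_subset_closure[OF assms(2)] by (auto simp: Pi_plus_def C_def)
  then have "C \<inter> Pi_plus \<F> = Pi_plus \<F>"
    by blast
  then show ?thesis
    unfolding closure_of_subtopology by (simp add: C_def Pi_plus_closure_def)
qed

text \<open>Uniform limits of densities extend because the extensions are uniformly Cauchy on a dense set.\<close>

lemma uniform_limit_extends:
  fixes \<F> :: "('k::topological_space \<Rightarrow>\<^sub>C real) set" and h :: "('r::finite, 'k) hypergraph \<Rightarrow> real"
  defines "X \<equiv> subtopology (tau_space \<F>) (Pi_plus_closure \<F> :: ('r, 'k) tau_point set)"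
  assumes norm: "\<forall>f\<in>\<F>. norm f \<le> 1"
    and ext: "\<And>j::nat. \<exists>g. continuous_map X euclideanreal g \<and> (\<forall>G. g (tau_plus \<F> G) = h' j G)"
    and lim: "b \<longlonglongrightarrow> 0" "\<And>j G. \<bar>h' j G - h G\<bar> \<le> b j"
  shows "\<exists>g. continuous_map X euclideanreal g \<and> (\<forall>G. g (tau_plus \<F> G) = h G)"
proof -
  obtain g where g: "\<And>j. continuous_map X euclideanreal (g j)" "\<And>j G. g j (tau_plus \<F> G) = h' j G"
    using ext by metis
  have topX: "topspace X = Pi_plus_closure \<F>"
    using closedin_subset[OF Pi_plus_closure_closed] by (auto simp: X_def)
  \<comment> \<open>On \<open>Pi_plus \<F>\<close> this is the triangle inequality through
    \<open>h\<close>, and the condition is closed.\<close>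
  have close: "\<bar>g i \<gamma> - g j \<gamma>\<bar> \<le> b i + b j" if \<gamma>: "\<gamma> \<in> topspace X" for i j \<gamma>
  proof (rule forall_in_closure_of[where X = X and S = "Pi_plus \<F>" and P = "\<lambda>\<gamma>. \<bar>g i \<gamma> - g j \<gamma>\<bar> \<le> b i + b j"])
    show "\<gamma> \<in> X closure_of Pi_plus \<F>"
      using \<gamma> unfolding topX by (simp add: X_def closure_Pi_plus_dense[OF norm])
    show "\<bar>g i \<gamma> - g j \<gamma>\<bar> \<le> b i + b j" if \<gamma>: "\<gamma> \<in> Pi_plus \<F>" for \<gamma> :: "('r, 'k) tau_point"
    proof -
      obtain G where "\<gamma> = tau_plus \<F> G"
        using \<gamma> unfolding Pi_plus_def by blast
      then show ?thesis
        using lim(2)[of i G] lim(2)[of j G] by (simp add: g(2))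
    qed
    have "continuous_map X euclideanreal (\<lambda>\<gamma>. \<bar>g i \<gamma> - g j \<gamma>\<bar>)"
      by (intro continuous_map_real_abs continuous_map_diff g)
    then have "closedin X {\<gamma> \<in> topspace X. \<bar>g i \<gamma> - g j \<gamma>\<bar> \<in> {..b i + b j}}"
      by (rule closedin_continuous_map_preimage) simp
    then show "closedin X {\<gamma> \<in> topspace X. \<bar>g i \<gamma> - g j \<gamma>\<bar> \<le> b i + b j}"
      by simp
  qed
  obtain g' where g': "continuous_map X Met_TC.mtopology g'"
    "\<And>\<epsilon>. 0 < \<epsilon> \<Longrightarrow> \<forall>\<^sub>F n in sequentially. \<forall>x\<in>topspace X. dist (g n x) (g' x) < \<epsilon>"
  proof (rule Met_TC.continuous_map_uniformly_Cauchy_limit[where f = g and X = X])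
    show "Met_TC.mcomplete TYPE(real)"
      using complete_UNIV by simp
    show "\<forall>\<^sub>F n in sequentially. continuous_map X Met_TC.mtopology (g n)"
      using g(1) by simp
    fix \<epsilon> :: real assume "\<epsilon> > 0"
    then have "\<forall>\<^sub>F n in sequentially. b n < \<epsilon> / 2"
      using lim(1) by (intro order_tendstoD) auto
    then obtain N where N: "\<And>n. n \<ge> N \<Longrightarrow> b n < \<epsilon> / 2"
      by (auto simp: eventually_sequentially)
    show "\<exists>N. \<forall>m n x. N \<le> m \<longrightarrow> N \<le> n \<longrightarrow> x \<in> topspace X \<longrightarrow> dist (g m x) (g n x) < \<epsilon>"
    proof (intro exI allI impI)
      fix m n x assume "N \<le> m" "N \<le> n" "x \<in> topspace X"
      then show "dist (g m x) (g n x) < \<epsilon>"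
        using close[of x m n] N[of m] N[of n] unfolding dist_real_def by linarith
    qed
  qed auto
  have "g' (tau_plus \<F> G) = h G" for G
  proof (rule LIMSEQ_unique)
    have "tau_plus \<F> G \<in> topspace X"
      unfolding topX by (rule Pi_plus_subset_closure[OF norm])
    then have "(\<lambda>n. g n (tau_plus \<F> G)) \<longlonglongrightarrow> g' (tau_plus \<F> G)"
      by (intro tendstoI eventually_mono[OF g'(2)]) auto
    then show "(\<lambda>n. h' n G) \<longlonglongrightarrow> g' (tau_plus \<F> G)"
      by (simp add: g(2))
    have "(\<lambda>n. h' n G - h G) \<longlonglongrightarrow> 0"
      by (rule Lim_null_comparison[OF _ lim(1)]) (use lim(2) in auto)
    then show "(\<lambda>n. h' n G) \<longlonglongrightarrow> h G"
      by (simp add: LIM_zero_iff)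
  qed
  then show ?thesis
    using g'(1) by auto
qed

text \<open>Induction over a set \<open>J\<close> of tuples whose decorations are arbitrary, all
  others being in \<open>\<F>\<close>. With the remaining decorations fixed, the admissible
  decorations at a new tuple \<open>w\<close> form a linear subspace, closed by the Lipschitz
  estimate. It contains \<open>\<F>\<close> by the induction hypothesis, hence it is everything. For
  empty \<open>J\<close> the density is a coordinate.\<close>

lemma hom_density_extends_closure:
  fixes \<F> :: "('k::topological_space \<Rightarrow>\<^sub>C real) set" and F :: "('r::finite \<Rightarrow> nat) \<Rightarrow> ('k \<Rightarrow>\<^sub>C real)"
  defines "X \<equiv> subtopology (tau_space \<F>) (Pi_plus_closure \<F> :: ('r, 'k) tau_point set)"
  assumes norm: "\<forall>f\<in>\<F>. norm f \<le> 1" and dense: "closure (span \<F>) = UNIV" and m: "m > 0"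
  shows "\<exists>g. continuous_map X euclideanreal g \<and> (\<forall>G. g (tau_plus \<F> G) = hom_density (unlabel m F) G)"
proof -
  define D where "D h \<longleftrightarrow> (\<exists>g. continuous_map X euclideanreal g \<and> (\<forall>G. g (tau_plus \<F> G) = h G))"
    for h :: "('r, 'k) hypergraph \<Rightarrow> real"
  have "D (hom_density (unlabel m F))"
    if "J \<subseteq> tuples m" "\<And>v. v \<in> tuples m - J \<Longrightarrow> F v \<in> \<F>" for J and F :: "('r \<Rightarrow> nat) \<Rightarrow> ('k \<Rightarrow>\<^sub>C real)"
    using finite_subset[OF that(1) finite_tuples] that
  proof (induction J arbitrary: F rule: finite_induct)
    case empty
    then have F: "unlabel m F \<in> hypergraphs \<F>"
      using m by (simp add: unlabel_in_hypergraphs)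
    then have "continuous_map X euclideanreal (\<lambda>\<gamma>. fst \<gamma> (unlabel m F))"
      unfolding X_def by (intro continuous_map_from_subtopology continuous_map_tau_coordinate)
    then show ?case
      unfolding D_def using F by (intro exI[of _ "\<lambda>\<gamma>. fst \<gamma> (unlabel m F)"]) (simp add: tau_plus_def)
  next
    case (insert w J)
    then have w: "w \<in> tuples m"
      by simp
    define V where "V = {f. D (hom_density (unlabel m (F(w := f))))}"
    have "\<F> \<subseteq> V"
    proof
      fix f assume "f \<in> \<F>"
      then have "D (hom_density (unlabel m (F(w := f))))"
        using insert.prems by (intro insert.IH) auto
      then show "f \<in> V"
        by (simp add: V_def)
    qed
    moreover have "subspace V"
    proof (rule subspaceI)
      show "0 \<in> V"
        unfolding V_def D_def mem_Collect_eq hom_density_update(1)[OF m w]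
        by (intro exI[of _ "\<lambda>_. 0"]) simp
      fix f g assume "f \<in> V" "g \<in> V"
      then obtain u u' where u: "continuous_map X euclideanreal u" "\<And>G. u (tau_plus \<F> G) = hom_density (unlabel m (F(w := f))) G"
        "continuous_map X euclideanreal u'" "\<And>G. u' (tau_plus \<F> G) = hom_density (unlabel m (F(w := g))) G"
        unfolding V_def D_def by blast
      show "f + g \<in> V"
        unfolding V_def D_def mem_Collect_eq hom_density_update(2)[OF m w]
        using u by (intro exI[of _ "\<lambda>\<gamma>. u \<gamma> + u' \<gamma>"]) (simp add: continuous_map_add)
    next
      fix c :: real and f assume "f \<in> V"
      then obtain u where u: "continuous_map X euclideanreal u" "\<And>G. u (tau_plus \<F> G) = hom_density (unlabel m (F(w := f))) G"
        unfolding V_def D_def by blast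
      show "c *\<^sub>R f \<in> V"
        unfolding V_def D_def mem_Collect_eq hom_density_update(3)[OF m w]
        using u by (intro exI[of _ "\<lambda>\<gamma>. c * u \<gamma>"]) (simp add: continuous_map_real_mult_left)
    qed
    moreover have "closed V"
      unfolding closed_sequential_limits
    proof (intro allI impI, elim conjE)
      fix x l assume x: "\<forall>n. x n \<in> V" "x \<longlonglongrightarrow> l"
      define c where "c = (\<Prod>v\<in>tuples m - {w}. norm (F v))"
      have "(\<lambda>n. norm (x n - l)) \<longlonglongrightarrow> 0"
        using x(2) by (simp add: tendsto_norm_zero_iff LIM_zero_iff)
      then have b: "(\<lambda>n. norm (x n - l) * c) \<longlonglongrightarrow> 0"
        by (rule tendsto_mult_left_zero)
      have "D (hom_density (unlabel m (F(w := l))))"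
        unfolding D_def X_def
      proof (rule uniform_limit_extends[OF norm _ b])
        fix j
        show "\<exists>g. continuous_map (subtopology (tau_space \<F>) (Pi_plus_closure \<F>)) euclideanreal g \<and>
            (\<forall>G. g (tau_plus \<F> G) = hom_density (unlabel m (F(w := x j))) G)"
          using x(1) unfolding V_def D_def X_def by blast
        show "\<bar>hom_density (unlabel m (F(w := x j))) G - hom_density (unlabel m (F(w := l))) G\<bar> \<le> norm (x j - l) * c" for G
          unfolding c_def by (rule hom_density_update_Lipschitz[OF m w])
      qed
      then show "l \<in> V"
        by (simp add: V_def)
    qed
    ultimately have "closure (span \<F>) \<subseteq> V"
      by (intro closure_minimal span_minimal)
    then have "F w \<in> V"
      using dense by blast
    then show ?case
      by (simp add: V_def)
  qed
  from this[of "tuples m" F] show ?thesis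
    by (simp add: D_def)
qed

text \<open>\<open>converges_in_law\<close> tests functions on the whole of
  \<open>tau_space \<F>\<close>, so the extension to the closure is continued further by Tietze's
  theorem; the space is normal, being compact Hausdorff. The last claim evaluates the definite
  description in \<open>t_ext\<close>.\<close>

lemma hom_density_extends:
  fixes \<F> :: "('k::topological_space \<Rightarrow>\<^sub>C real) set" and F :: "('r::finite, 'k \<Rightarrow>\<^sub>C real) hypergraph"
  assumes norm: "\<forall>f\<in>\<F>. norm f \<le> 1" and dense: "closure (span \<F>) = UNIV"
  obtains g where "continuous_map (tau_space \<F>) euclideanreal g" "\<And>G. g (tau_plus \<F> G) = hom_density F G"
    "\<And>\<gamma>. t_ext \<F> F \<gamma> = (if \<gamma> \<in> Pi_plus_closure \<F> then g \<gamma> else undefined)"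
proof -
  let ?C = "Pi_plus_closure \<F> :: ('r, 'k) tau_point set"
  let ?X = "subtopology (tau_space \<F>) ?C"
  obtain m F' where F: "m > 0" "F = unlabel m F'"
    by (rule hypergraph_cases)
  obtain u where u: "continuous_map ?X euclideanreal u" "\<And>G. u (tau_plus \<F> G) = hom_density F G"
    using hom_density_extends_closure[OF norm dense F(1), of F'] unfolding F(2) by blast
  obtain g where g: "continuous_map (tau_space \<F>) euclideanreal g" "\<And>\<gamma>. \<gamma> \<in> ?C \<Longrightarrow> g \<gamma> = u \<gamma>"
    by (rule Tietze_extension_realinterval[OF normal_space_tau_space Pi_plus_closure_closed is_interval_univ _ u(1)]) auto
  have g_tau: "g (tau_plus \<F> G) = hom_density F G" for G
    using g(2)[OF Pi_plus_subset_closure[OF norm]] by (simp add: u(2))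
  have topX: "topspace ?X = ?C"
    using closedin_subset[OF Pi_plus_closure_closed] by auto
  have "t_ext \<F> F = restrict g ?C"
    unfolding t_ext_def
  proof (rule the_equality)
    have "continuous_map ?X euclideanreal (restrict g ?C)"
      by (rule continuous_map_eq[OF continuous_map_from_subtopology[OF g(1)]]) (simp add: topX)
    then show "restrict g ?C \<in> extensional ?C \<and> continuous_map ?X euclideanreal (restrict g ?C) \<and>
        (\<forall>G. restrict g ?C (tau_plus \<F> G) = hom_density F G)"
      by (simp add: g_tau Pi_plus_subset_closure[OF norm])
    fix h assume h: "h \<in> extensional ?C \<and> continuous_map ?X euclideanreal h \<and>
        (\<forall>G. h (tau_plus \<F> G) = hom_density F G)"
    show "h = restrict g ?C"
    proof (rule extensionalityI[of _ ?C])
      fix \<gamma> assume \<gamma>: "\<gamma> \<in> ?C"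
      \<comment> \<open>Continuous real functions that agree on a dense subset are equal, which is
        the uniqueness behind the description.\<close>
      have "h \<gamma> = g \<gamma>"
      proof (rule forall_in_closure_of_eq[where f = h and g = g and S = "Pi_plus \<F>", OF _ Hausdorff_space_euclidean])
        show "\<gamma> \<in> ?X closure_of Pi_plus \<F>"
          using \<gamma> by (simp add: closure_Pi_plus_dense[OF norm])
        show "continuous_map ?X euclideanreal h"
          using h by simp
        show "continuous_map ?X euclideanreal g"
          by (rule continuous_map_from_subtopology[OF g(1)])
        show "h x = g x" if "x \<in> Pi_plus \<F>" for x :: "('r, 'k) tau_point"
          using that h by (auto simp: Pi_plus_def g_tau)
      qed
      then show "h \<gamma> = restrict g ?C \<gamma>"
        using \<gamma> by simp
    qed (use h in auto)
  qed
  then show thesis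
    by (intro that[OF g(1) g_tau]) simp
qed

text \<open>This is where countability of \<F> pays off: \<tau>^+ has countably many coordinates and
  can be written as a sequence of reals.\<close>

lemma countable_hypergraphs:
  assumes "countable S"
  shows "countable (hypergraphs S :: ('r::finite, 's) hypergraph set)"
proof (rule countable_subset)
  show "hypergraphs S \<subseteq> (\<Union>n. unlabel n ` (tuples n \<rightarrow>\<^sub>E S) :: ('r, 's) hypergraph set)"
  proof
    fix G :: "('r, 's) hypergraph" assume G: "G \<in> hypergraphs S"
    obtain n A where n: "n > 0" "G = unlabel n A"
      by (rule hypergraph_cases)
    have "G = unlabel n (restrict A (tuples n))"
      unfolding n(2) by (rule unlabel_eqI[OF n(1)]) simp
    moreover have "restrict A (tuples n) \<in> tuples n \<rightarrow>\<^sub>E S"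
      using G n by (simp add: unlabel_in_hypergraphs)
    ultimately show "G \<in> (\<Union>n. unlabel n ` (tuples n \<rightarrow>\<^sub>E S))"
      by blast
  qed
  show "countable (\<Union>n. unlabel n ` (tuples n \<rightarrow>\<^sub>E S) :: ('r, 's) hypergraph set)"
    using assms by (intro countable_UN countable_image countable_PiE) auto
qed

section \<open>Borel sets of abstract topologies\<close>

lemma space_borel_of: "space (borel_of X) = topspace X"
  unfolding borel_of_def by (rule space_measure_of) (use openin_subset in blast)

lemma sets_borel_of: "sets (borel_of X) = sigma_sets (topspace X) {U. openin X U}"
  unfolding borel_of_def by (rule sets_measure_of) (use openin_subset in blast)

lemma measurable_borel_of:
  assumes "continuous_map X Y f" "sets M = sets (borel_of X)"
  shows "f \<in> measurable M (borel_of Y)"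
proof -
  have sp: "space M = topspace X"
    using sets_eq_imp_space_eq[OF assms(2)] by (simp add: space_borel_of)
  show ?thesis
    unfolding borel_of_def
  proof (rule measurable_measure_of)
    show "{U. openin Y U} \<subseteq> Pow (topspace Y)"
      using openin_subset by blast
    show "f \<in> space M \<rightarrow> topspace Y"
      using assms(1) by (auto simp: sp continuous_map_def)
    fix U assume "U \<in> {U. openin Y U}"
    then have "openin X {x \<in> topspace X. f x \<in> U}"
      using assms(1) by (auto simp: continuous_map_def)
    moreover have "f -` U \<inter> space M = {x \<in> topspace X. f x \<in> U}"
      by (auto simp: sp)
    ultimately show "f -` U \<inter> space M \<in> sets M"
      by (simp add: assms(2) sets_borel_of sigma_sets.Basic)
  qed
qed

lemma closedin_sets_borel_of:
  assumes "closedin X C"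
  shows "C \<in> sets (borel_of X)"
proof -
  have "topspace X - C \<in> sets (borel_of X)"
    using assms by (simp add: sets_borel_of closedin_def sigma_sets.Basic)
  then have "topspace X - (topspace X - C) \<in> sets (borel_of X)"
    using sets.compl_sets[of "topspace X - C" "borel_of X"] by (simp add: space_borel_of)
  then show ?thesis
    using closedin_subset[OF assms] by (simp add: double_diff)
qed

section \<open>Limits of random hypergraphs\<close>

lemma compact_UNIV_fun:
  assumes "compact (UNIV :: 'k::topological_space set)"
  shows "compact (UNIV :: ('a \<Rightarrow> 'k) set)"
proof -
  have "compact_space (product_topology (\<lambda>_. euclidean :: 'k topology) (UNIV :: 'a set))"
    unfolding compact_space_product_topology using assms by (simp add: compact_space_def)
  then show ?thesis
    by (metis compact_space_def compactin_euclidean_iff euclidean_product_topology topspace_euclidean)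
qed

lemma bcontfun_compact:
  assumes "compact (UNIV :: 'k::topological_space set)" "continuous_on UNIV (f :: 'k \<Rightarrow> real)"
  shows "apply_bcontfun (Bcontfun f) = f"
proof (rule Bcontfun_inverse)
  show "f \<in> bcontfun"
    using assms(2) compact_imp_bounded[OF compact_continuous_image[OF assms(2,1)]] by (simp add: bcontfun_def)
qed

lemma bounded_continuous_compact:
  assumes "compact (UNIV :: 'a::topological_space set)" "continuous_on UNIV (f :: 'a \<Rightarrow> real)"
  obtains B where "B \<ge> 0" "\<And>x. \<bar>f x\<bar> \<le> B"
  using compact_imp_bounded[OF compact_continuous_image[OF assms(2,1)]] unfolding bounded_pos
  by (metis less_imp_le rangeI real_norm_def)

section \<open>The algebra of cylinder functions\<close>

definition cylinder_functions :: "((('r::finite \<Rightarrow> nat) \<Rightarrow> 'k::topological_space) \<Rightarrow> real) set" where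
  "cylinder_functions = {\<lambda>A. hom_weight m F A id |m F. m > 0}"

text \<open>Both factors read the same array, so instead of a disjoint union they are padded by the
  constant 1 to a common vertex set and their decorations are multiplied tuple by tuple.\<close>

lemma cylinder_functions_mult:
  fixes f g :: "(('r::finite \<Rightarrow> nat) \<Rightarrow> 'k::topological_space) \<Rightarrow> real"
  assumes K: "compact (UNIV :: 'k set)"
    and fg: "f \<in> cylinder_functions" "g \<in> cylinder_functions"
  shows "(\<lambda>A. f A * g A) \<in> cylinder_functions"
proof -
  obtain m F m' F' where f: "m > 0" "f = (\<lambda>A. hom_weight m F A id)" and g: "m' > 0" "g = (\<lambda>A. hom_weight m' F' A id)"
    using fg unfolding cylinder_functions_def by blast
  define l where "l = max m m'"
  define P where "P v = (if v \<in> tuples m then apply_bcontfun (F v) else (\<lambda>_. 1))" for v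
  define P' where "P' v = (if v \<in> tuples m' then apply_bcontfun (F' v) else (\<lambda>_. 1))" for v
  define Q where "Q v = Bcontfun (\<lambda>x. P v x * P' v x)" for v
  have Q: "apply_bcontfun (Q v) = (\<lambda>x. P v x * P' v x)" for v
    unfolding Q_def by (rule bcontfun_compact[OF K]) (auto simp: P_def P'_def intro!: continuous_intros)
  have sub: "tuples m \<subseteq> (tuples l :: ('r \<Rightarrow> nat) set)" "tuples m' \<subseteq> (tuples l :: ('r \<Rightarrow> nat) set)"
    by (auto simp: l_def Pi_iff less_max_iff_disj)
  have "hom_weight l Q A id = f A * g A" for A
  proof -
    have "hom_weight l Q A id = (\<Prod>v\<in>tuples l. P v (A v)) * (\<Prod>v\<in>tuples l. P' v (A v))"
      by (simp add: hom_weight_def Q prod.distrib)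
    also have "(\<Prod>v\<in>tuples l. P v (A v)) = (\<Prod>v\<in>tuples m. P v (A v))"
      by (rule prod.mono_neutral_right) (use sub in \<open>auto simp: P_def\<close>)
    also have "\<dots> = f A"
      by (simp add: P_def f(2) hom_weight_def)
    also have "(\<Prod>v\<in>tuples l. P' v (A v)) = (\<Prod>v\<in>tuples m'. P' v (A v))"
      by (rule prod.mono_neutral_right) (use sub in \<open>auto simp: P'_def\<close>)
    also have "\<dots> = g A"
      by (simp add: P'_def g(2) hom_weight_def)
    finally show ?thesis .
  qed
  then have "(\<lambda>A. f A * g A) = (\<lambda>A. hom_weight l Q A id)"
    by simp
  moreover have "l > 0"
    using f(1) by (simp add: l_def)
  ultimately show ?thesis
    unfolding cylinder_functions_def by blast
qed

lemma function_ring_cylinder: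
  assumes K: "compact (UNIV :: 'k::polish_space set)"
  shows "function_ring_on (linear_span (cylinder_functions :: ((('r::finite \<Rightarrow> nat) \<Rightarrow> 'k) \<Rightarrow> real) set)) UNIV"
proof
  show "compact (UNIV :: (('r \<Rightarrow> nat) \<Rightarrow> 'k) set)"
    by (rule compact_UNIV_fun[OF K])
  show "continuous_on UNIV f" if "f \<in> linear_span cylinder_functions" for f :: "(('r \<Rightarrow> nat) \<Rightarrow> 'k) \<Rightarrow> real"
    using that by (rule continuous_linear_span) (auto simp: cylinder_functions_def continuous_on_hom_weight)
  have one: "(\<lambda>_. 1) \<in> (cylinder_functions :: ((('r \<Rightarrow> nat) \<Rightarrow> 'k) \<Rightarrow> real) set)"
    unfolding cylinder_functions_def
    by (intro CollectI exI[of _ 1] exI[of _ "\<lambda>_. const_bcontfun 1"]) (simp add: hom_weight_def const_bcontfun.rep_eq)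
  show "(\<lambda>_. c) \<in> linear_span (cylinder_functions :: ((('r \<Rightarrow> nat) \<Rightarrow> 'k) \<Rightarrow> real) set)" for c
    using linear_span.scale[OF linear_span.base[OF one], of c] by simp
  fix A B :: "('r \<Rightarrow> nat) \<Rightarrow> 'k" assume "A \<noteq> B"
  then obtain w where w: "A w \<noteq> B w"
    by blast
  define m where "m = Suc (Max (range w))"
  have wm: "w \<in> tuples m"
    by (auto simp: m_def less_Suc_eq_le)
  \<comment> \<open>The resulting function measures the distance of the entry at \<open>w\<close>
    from \<open>A w\<close>; it vanishes at \<open>A\<close> but not at \<open>B\<close>.\<close>
  define F where "F v = (if v = w then Bcontfun (\<lambda>x. dist x (A w)) else const_bcontfun 1)" for v
  have "hom_weight m F C id = dist (C w) (A w)" for C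
  proof -
    have "apply_bcontfun (Bcontfun (\<lambda>x. dist x (A w))) = (\<lambda>x. dist x (A w))"
      by (rule bcontfun_compact[OF K]) (intro continuous_intros)
    then show ?thesis
      unfolding hom_weight_def by (subst prod.remove[OF finite_tuples wm]) (simp add: F_def const_bcontfun.rep_eq)
  qed
  then have ne: "hom_weight m F A id \<noteq> hom_weight m F B id"
    using w by auto
  have "m > 0"
    by (simp add: m_def)
  then have "(\<lambda>C. hom_weight m F C id) \<in> linear_span cylinder_functions"
    unfolding cylinder_functions_def by (intro linear_span.base) blast
  with ne show "\<exists>f\<in>linear_span cylinder_functions. f A \<noteq> f B"
    by (rule bexI[where x = "\<lambda>C. hom_weight m F C id"])
next
  fix f g :: "(('r \<Rightarrow> nat) \<Rightarrow> 'k) \<Rightarrow> real"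
  assume fg: "f \<in> linear_span cylinder_functions" "g \<in> linear_span cylinder_functions"
  show "(\<lambda>A. f A + g A) \<in> linear_span cylinder_functions"
    using fg by (rule linear_span.add)
  show "(\<lambda>A. f A * g A) \<in> linear_span cylinder_functions"
    by (rule linear_span_mult[OF cylinder_functions_mult[OF K] fg])
qed

lemma abs_inverse_nverts_le: "\<bar>1 / real (nverts G)\<bar> \<le> 1"
  using one_over_nverts[of G] by simp

section \<open>Means along the random sequence\<close>

locale random_hypergraphs = prob_space M for M :: "'w measure" +
  fixes G :: "nat \<Rightarrow> 'w \<Rightarrow> ('r::finite, 'k::polish_space) hypergraph"
    and \<F> :: "('k \<Rightarrow>\<^sub>C real) set" and \<kappa> :: 'k
  assumes compact_UNIV: "compact (UNIV :: 'k set)"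
    and countable_F: "countable \<F>"
    and norm_F: "\<forall>f\<in>\<F>. norm f \<le> 1"
    and dense_F: "closure (span \<F>) = UNIV"
    and random: "\<And>n. G n \<in> borel_measurable M"
    and nverts_to_infinity: "\<And>N. (\<lambda>n. measure M {\<omega> \<in> space M. nverts (G n \<omega>) \<le> N}) \<longlonglongrightarrow> 0"
begin

definition mean :: "(('r, 'k) hypergraph \<Rightarrow> real) \<Rightarrow> nat \<Rightarrow> real" where
  "mean h n = (\<integral>\<omega>. h (G n \<omega>) \<partial>M)"

lemma measurable_continuous_G:
  assumes "continuous_on UNIV h"
  shows "(\<lambda>\<omega>. h (G n \<omega>)) \<in> borel_measurable M"
  by (rule measurable_compose[OF random borel_measurable_continuous_onI[OF assms]])

lemma integrable_continuous_G:
  assumes "continuous_on UNIV h" "\<And>x. \<bar>h x\<bar> \<le> B"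
  shows "integrable M (\<lambda>\<omega>. h (G n \<omega>) :: real)"
  by (rule integrable_const_bound[where B = B]) (use assms measurable_continuous_G in auto)

text \<open>The function is at most 1 everywhere and at most 1/(N+1) where |V| > N, so its mean is
  at most P(|V| <= N) + 1/(N+1). This turns convergence in probability into convergence of a
  mean.\<close>

lemma mean_inverse_nverts: "mean (\<lambda>x. 1 / real (nverts x)) \<longlonglongrightarrow> 0"
proof (rule tendstoI)
  fix e :: real assume "e > 0"
  then obtain N where N: "1 / real (Suc N) < e / 2"
    using nat_approx_posE[of "e / 2"] by auto
  have "\<forall>\<^sub>F n in sequentially. measure M {\<omega> \<in> space M. nverts (G n \<omega>) \<le> N} < e / 2"
    using nverts_to_infinity[of N] \<open>e > 0\<close> by (intro order_tendstoD) auto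
  then show "\<forall>\<^sub>F n in sequentially. dist (mean (\<lambda>x. 1 / real (nverts x)) n) 0 < e"
  proof eventually_elim
    fix n assume less: "measure M {\<omega> \<in> space M. nverts (G n \<omega>) \<le> N} < e / 2"
    let ?S = "{\<omega> \<in> space M. nverts (G n \<omega>) \<le> N}"
    have "continuous_on UNIV (\<lambda>x :: ('r, 'k) hypergraph. real (nverts x))"
      by (rule continuous_on_hypergraphI) (simp add: nverts_unlabel)
    then have [measurable]: "(\<lambda>\<omega>. real (nverts (G n \<omega>))) \<in> borel_measurable M"
      by (rule measurable_continuous_G)
    have "{\<omega> \<in> space M. real (nverts (G n \<omega>)) \<le> real N} \<in> sets M"
      by measurable
    then have S: "?S \<in> sets M"
      by simp
    have int: "integrable M (\<lambda>\<omega>. 1 / real (nverts (G n \<omega>)))"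
      by (rule integrable_continuous_G[OF continuous_inverse_nverts]) (rule abs_inverse_nverts_le)
    have iS: "integrable M (indicator ?S :: 'w \<Rightarrow> real)"
      using S by (intro integrable_real_indicator) (simp_all add: less_top[symmetric])
    have "mean (\<lambda>x. 1 / real (nverts x)) n \<le> (\<integral>\<omega>. indicator ?S \<omega> + 1 / real (Suc N) \<partial>M)"
      unfolding mean_def
    proof (rule integral_mono[OF int])
      show "integrable M (\<lambda>\<omega>. indicator ?S \<omega> + 1 / real (Suc N))"
        using iS by (intro Bochner_Integration.integrable_add) auto
      fix \<omega> assume \<omega>: "\<omega> \<in> space M"
      show "1 / real (nverts (G n \<omega>)) \<le> indicator ?S \<omega> + 1 / real (Suc N)"
      proof (cases "nverts (G n \<omega>) \<le> N")
        case True
        have "1 / real (nverts (G n \<omega>)) \<le> 1"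
          using one_over_nverts[of "G n \<omega>"] by simp
        moreover have "0 \<le> 1 / real (Suc N)"
          by simp
        moreover have "indicator ?S \<omega> = (1 :: real)"
          using True \<omega> by simp
        ultimately show ?thesis
          by linarith
      next
        case False
        then have "1 / real (nverts (G n \<omega>)) \<le> 1 / real (Suc N)"
          by (intro divide_left_mono) auto
        then show ?thesis
          using False by simp
      qed
    qed
    also have "\<dots> = measure M ?S + 1 / real (Suc N)"
      using iS S by (subst Bochner_Integration.integral_add) (simp_all add: prob_space Int_absorb2 subset_iff)
    finally have "mean (\<lambda>x. 1 / real (nverts x)) n < e"
      using less N by linarith
    moreover have "mean (\<lambda>x. 1 / real (nverts x)) n \<ge> 0"
      unfolding mean_def by (rule integral_nonneg_AE) simp
    ultimately show "dist (mean (\<lambda>x. 1 / real (nverts x)) n) 0 < e"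
      by (simp add: dist_real_def)
  qed
qed

text \<open>The device by which deterministic O(1/|V|) estimates become null sequences: between
  densities and label means, for exchangeability, and for the approximating ring.\<close>

lemma mean_diff:
  assumes "continuous_on UNIV u" "\<And>x. \<bar>u x\<bar> \<le> C" "continuous_on UNIV v" "\<And>x. \<bar>v x\<bar> \<le> C'"
    and diff: "\<And>x. \<bar>u x - v x\<bar> \<le> B / real (nverts x)"
  shows "(\<lambda>n. mean u n - mean v n) \<longlonglongrightarrow> 0"
proof (rule Lim_null_comparison)
  have "(\<lambda>n. B * mean (\<lambda>x. 1 / real (nverts x)) n) \<longlonglongrightarrow> B * 0"
    by (intro tendsto_intros mean_inverse_nverts)
  then show "(\<lambda>n. B * mean (\<lambda>x. 1 / real (nverts x)) n) \<longlonglongrightarrow> 0"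
    by simp
  have int: "integrable M (\<lambda>\<omega>. 1 / real (nverts (G n \<omega>)))" for n
    by (rule integrable_continuous_G[OF continuous_inverse_nverts]) (rule abs_inverse_nverts_le)
  have iu: "integrable M (\<lambda>\<omega>. u (G n \<omega>))" and iv: "integrable M (\<lambda>\<omega>. v (G n \<omega>))" for n
    using assms by (auto intro: integrable_continuous_G)
  show "\<forall>\<^sub>F n in sequentially. norm (mean u n - mean v n) \<le> B * mean (\<lambda>x. 1 / real (nverts x)) n"
  proof (rule always_eventually, rule allI)
    fix n
    have "norm (mean u n - mean v n) = \<bar>\<integral>\<omega>. u (G n \<omega>) - v (G n \<omega>) \<partial>M\<bar>"
      by (simp add: mean_def iu iv)
    also have "\<dots> \<le> (\<integral>\<omega>. \<bar>u (G n \<omega>) - v (G n \<omega>)\<bar> \<partial>M)"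
      by (rule integral_abs_bound)
    also have "\<dots> \<le> (\<integral>\<omega>. B * (1 / real (nverts (G n \<omega>))) \<partial>M)"
    proof (rule integral_mono)
      show "integrable M (\<lambda>\<omega>. B * (1 / real (nverts (G n \<omega>))))"
        by (intro integrable_mult_right int)
    qed (use iu iv diff in auto)
    also have "\<dots> = B * mean (\<lambda>x. 1 / real (nverts x)) n"
      unfolding mean_def by (rule integral_mult_right_zero)
    finally show "norm (mean u n - mean v n) \<le> B * mean (\<lambda>x. 1 / real (nverts x)) n" .
  qed
qed

lemma integral_hat_law_mean:
  assumes "continuous_on UNIV f"
  shows "(\<integral>A. f A \<partial>hat_law \<kappa> M (G n)) = mean (label_mean \<kappa> f) n"
proof -
  obtain B where "B \<ge> 0" "\<And>A. \<bar>f A\<bar> \<le> B"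
    using bounded_continuous_compact[OF compact_UNIV_fun[OF compact_UNIV] assms] by blast
  then show ?thesis
    unfolding mean_def by (intro integral_hat_law[OF prob_space_axioms random assms])
qed

lemma hom_density_cylinder_mean:
  assumes "m > 0"
  shows "(\<lambda>n. mean (hom_density (unlabel m F)) n - mean (label_mean \<kappa> (\<lambda>A. hom_weight m F A id)) n) \<longlonglongrightarrow> 0"
proof (rule mean_diff)
  show "\<bar>hom_density (unlabel m F) x\<bar> \<le> (\<Prod>v\<in>tuples m. norm (F v))" for x
    by (rule hom_density_norm_le[OF assms])
  show "\<bar>label_mean \<kappa> (\<lambda>A. hom_weight m F A id) x\<bar> \<le> (\<Prod>v\<in>tuples m. norm (F v))" for x
    by (rule label_mean_abs_le) (rule hom_weight_norm_le)
  show "\<bar>hom_density (unlabel m F) x - label_mean \<kappa> (\<lambda>A. hom_weight m F A id) x\<bar> \<le>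
      (2 * (\<Prod>v\<in>tuples m. norm (F v)) * (real m)\<^sup>2) / real (nverts x)" for x
    by (rule hom_density_label_mean[OF assms])
qed (intro continuous_hom_density continuous_label_mean continuous_on_hom_weight)+

definition tau_limit :: "('r, 'k) tau_point measure \<Rightarrow> bool" where
  "tau_limit \<Gamma> \<longleftrightarrow> law_on (tau_space \<F>) \<Gamma> \<and>
    (AE \<gamma> in \<Gamma>. \<gamma> \<in> Pi_plus_closure \<F> - Pi_plus \<F>) \<and>
    converges_in_law (tau_space \<F>)
      (\<lambda>n. distr M (borel_of (tau_space \<F>)) (\<lambda>\<omega>. tau_plus \<F> (G n \<omega>))) \<Gamma>"

definition label_limit :: "(('r \<Rightarrow> nat) \<Rightarrow> 'k) measure \<Rightarrow> bool" where
  "label_limit H \<longleftrightarrow> law_on euclidean H \<and> converges_in_law euclidean (\<lambda>n. hat_law \<kappa> M (G n)) H"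

lemma measurable_tau_plus: "(\<lambda>\<omega>. tau_plus \<F> (G n \<omega>)) \<in> measurable M (borel_of (tau_space \<F>))"
  by (rule measurable_compose[OF random]) (rule measurable_borel_of[OF continuous_map_tau_plus[OF norm_F]], simp add: borel_of_euclidean)

lemma measurable_real_borel_of:
  assumes "continuous_map X euclideanreal g" "sets \<Gamma> = sets (borel_of X)"
  shows "g \<in> borel_measurable \<Gamma>"
  using measurable_borel_of[OF assms] by (simp add: borel_of_euclidean)

lemma integral_distr_tau_plus:
  assumes "continuous_map (tau_space \<F>) euclideanreal g"
  shows "(\<integral>\<gamma>. g \<gamma> \<partial>distr M (borel_of (tau_space \<F>)) (\<lambda>\<omega>. tau_plus \<F> (G n \<omega>))) = mean (\<lambda>x. g (tau_plus \<F> x)) n"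
  unfolding mean_def
  by (rule integral_distr[OF measurable_tau_plus]) (rule measurable_real_borel_of[OF assms refl])

section \<open>Limits of mean densities and of labelings\<close>

lemma tau_limit_mean:
  assumes "tau_limit \<Gamma>"
  shows "mean (hom_density F) \<longlonglongrightarrow> (\<integral>\<gamma>. t_ext \<F> F \<gamma> \<partial>\<Gamma>)"
proof -
  let ?C = "Pi_plus_closure \<F> :: ('r, 'k) tau_point set"
  have sets: "sets \<Gamma> = sets (borel_of (tau_space \<F>))" and AE_C: "AE \<gamma> in \<Gamma>. \<gamma> \<in> ?C"
    and conv: "converges_in_law (tau_space \<F>)
      (\<lambda>n. distr M (borel_of (tau_space \<F>)) (\<lambda>\<omega>. tau_plus \<F> (G n \<omega>))) \<Gamma>"
    using assms by (auto simp: tau_limit_def law_on_def)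
  obtain g where g: "continuous_map (tau_space \<F>) euclideanreal g" "\<And>x. g (tau_plus \<F> x) = hom_density F x"
    "\<And>\<gamma>. t_ext \<F> F \<gamma> = (if \<gamma> \<in> ?C then g \<gamma> else undefined)"
    using hom_density_extends[OF norm_F dense_F] by blast
  have gm: "g \<in> borel_measurable \<Gamma>"
    by (rule measurable_real_borel_of[OF g(1) sets])
  have "(\<lambda>n. mean (hom_density F) n) \<longlonglongrightarrow> (\<integral>\<gamma>. g \<gamma> \<partial>\<Gamma>)"
    using conv[unfolded converges_in_law_def, THEN spec, of g] g(1) bounded_continuous_tau_space[OF g(1)]
    unfolding integral_distr_tau_plus[OF g(1)] by (simp add: g(2))
  \<comment> \<open>The two integrands agree on the closure, where \<open>\<Gamma>\<close> is
    concentrated; elsewhere \<open>t_ext\<close> is \<open>undefined\<close>, and its measurability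
    uses that the closure is a Borel set.\<close>
  also have "(\<integral>\<gamma>. g \<gamma> \<partial>\<Gamma>) = (\<integral>\<gamma>. t_ext \<F> F \<gamma> \<partial>\<Gamma>)"
  proof (rule integral_cong_AE[OF gm])
    have "?C \<in> sets \<Gamma>"
      unfolding sets by (rule closedin_sets_borel_of[OF Pi_plus_closure_closed])
    then show "t_ext \<F> F \<in> borel_measurable \<Gamma>"
      unfolding g(3)[abs_def] using gm by (intro measurable_If_set) auto
    show "AE \<gamma> in \<Gamma>. g \<gamma> = t_ext \<F> F \<gamma>"
      using AE_C by eventually_elim (simp add: g(3))
  qed
  finally show ?thesis .
qed

lemma label_limit_mean:
  assumes "label_limit H" "continuous_on UNIV f"
  shows "mean (label_mean \<kappa> f) \<longlonglongrightarrow> (\<integral>A. f A \<partial>H)"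
proof -
  have "bounded (f ` UNIV)"
    using compact_imp_bounded[OF compact_continuous_image[OF assms(2) compact_UNIV_fun[OF compact_UNIV]]] .
  then show ?thesis
    using assms unfolding label_limit_def converges_in_law_def by (simp add: integral_hat_law_mean)
qed

lemma label_limit_hom_density_mean:
  assumes "label_limit H" "m > 0"
  shows "mean (hom_density (unlabel m F)) \<longlonglongrightarrow> (\<integral>A. hom_weight m F A id \<partial>H)"
  using tendsto_add[OF hom_density_cylinder_mean[OF assms(2), of F]
      label_limit_mean[OF assms(1) continuous_on_hom_weight[of m F id]]] by simp

lemma exists_label_limit:
  assumes conv: "\<And>F. convergent (mean (hom_density F))"
  shows "\<exists>H. label_limit H"
proof -
  let ?\<mu> = "\<lambda>n. hat_law \<kappa> M (G n)"
  have \<mu>: "prob_space (?\<mu> n)" "sets (?\<mu> n) = sets borel" for n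
    by (rule prob_space_hat_law[OF prob_space_axioms random] sets_hat_law[OF prob_space_axioms random])+
  have \<mu>_mean: "(\<integral>A. f A \<partial>?\<mu> n) = mean (label_mean \<kappa> f) n" and int: "integrable (?\<mu> n) f"
    if f: "f \<in> linear_span cylinder_functions" for f n
  proof -
    have cont: "continuous_on UNIV f"
      using function_ring_on.continuous[OF function_ring_cylinder[OF compact_UNIV] f] .
    then show "(\<integral>A. f A \<partial>?\<mu> n) = mean (label_mean \<kappa> f) n"
      by (rule integral_hat_law_mean)
    obtain B where "\<And>A. \<bar>f A\<bar> \<le> B"
      using bounded_continuous_compact[OF compact_UNIV_fun[OF compact_UNIV] cont] by blast
    moreover have "f \<in> borel_measurable (?\<mu> n)"
      using borel_measurable_continuous_onI[OF cont] measurable_cong_sets[OF \<mu>(2) refl] by blast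
    ultimately show "integrable (?\<mu> n) f"
      by (intro finite_measure.integrable_const_bound[OF prob_space.finite_measure[OF \<mu>(1)], where B = B]) auto
  qed
  have R: "convergent (\<lambda>n. \<integral>A. f A \<partial>?\<mu> n)" if "f \<in> linear_span cylinder_functions" for f
    using that
  proof induction
    case (base f)
    then obtain m F where F: "m > 0" "f = (\<lambda>A. hom_weight m F A id)"
      unfolding cylinder_functions_def by blast
    \<comment> \<open>The label mean is written as the mean density minus a null sequence.\<close>
    have "convergent (\<lambda>n. mean (hom_density (unlabel m F)) n -
        (mean (hom_density (unlabel m F)) n - mean (label_mean \<kappa> f) n))"
      unfolding F(2) by (rule convergent_diff[OF conv convergentI[OF hom_density_cylinder_mean[OF F(1)]]])
    then show ?case
      using base by (simp add: \<mu>_mean linear_span.base)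
  next
    case (add f g)
    then show ?case
      by (simp add: int convergent_add)
  next
    case (scale f c)
    then show ?case
      by (simp add: convergent_mult convergent_const)
  qed
  obtain H where H: "prob_space H" "sets H = sets borel"
    "\<And>f :: (('r \<Rightarrow> nat) \<Rightarrow> 'k) \<Rightarrow> real. continuous_on UNIV f \<Longrightarrow> f \<in> borel_measurable borel \<Longrightarrow>
      (\<lambda>n. \<integral>A. f A \<partial>?\<mu> n) \<longlonglongrightarrow> (\<integral>A. f A \<partial>H)"
  proof (rule compact_ring_weak_limit[OF function_ring_cylinder[OF compact_UNIV] \<mu>])
    show "AE A in ?\<mu> n. A \<in> UNIV" for n
      by simp
    show "convergent (\<lambda>n. \<integral>A. (if A \<in> UNIV then f A else 0) \<partial>?\<mu> n)"
      if "f \<in> linear_span cylinder_functions" for f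
      using R[OF that] by simp
  qed (rule that)
  then have "label_limit H"
    by (simp add: label_limit_def law_on_def converges_in_law_def borel_of_euclidean borel_measurable_continuous_onI)
  then show ?thesis ..
qed

text \<open>A permutation of finite support acts within some \<open>[N]\<close>. Label means of
  hypergraphs with at least \<open>N\<close> vertices are exactly invariant under it, and smaller
  hypergraphs lose their weight in the limit.\<close>

lemma label_limit_exchangeable:
  assumes H: "label_limit H"
  shows "exchangeable H"
  unfolding exchangeable_def
proof (intro allI impI, elim conjE)
  fix \<sigma> :: "nat \<Rightarrow> nat" assume \<sigma>: "bij \<sigma>" "finite {i. \<sigma> i \<noteq> i}"
  then obtain N where N: "{i. \<sigma> i \<noteq> i} \<subseteq> {..<N}"
    using finite_nat_iff_bounded by blast
  have perm: "\<sigma> permutes {..<N}"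
  proof (rule permutes_subset[OF _ N])
    show "\<sigma> permutes {i. \<sigma> i \<noteq> i}"
      unfolding permutes_def using \<sigma>(1) by (auto simp: bij_iff)
  qed
  have prob_H: "prob_space H" and sets_H: "sets H = sets borel"
    using H by (auto simp: label_limit_def law_on_def borel_of_euclidean)
  have rel: "relabel \<sigma> \<in> measurable H borel"
    unfolding measurable_cong_sets[OF sets_H refl]
    by (rule borel_measurable_continuous_onI[OF continuous_on_relabel])
  show "distr H borel (relabel \<sigma>) = H"
  proof (rule prob_measure_eqI_continuous[OF prob_space.prob_space_distr[OF prob_H rel] _ prob_H sets_H])
    fix f :: "(('r \<Rightarrow> nat) \<Rightarrow> 'k) \<Rightarrow> real"
    assume f: "continuous_on UNIV f" and f01: "\<And>A. f A \<in> {0..1}"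
    let ?f = "\<lambda>A. f (relabel \<sigma> A)"
    have f': "continuous_on UNIV ?f"
      by (rule continuous_on_compose2[OF f continuous_on_relabel]) simp
    have b: "\<bar>label_mean \<kappa> f x\<bar> \<le> 1" "\<bar>label_mean \<kappa> ?f x\<bar> \<le> 1" for x
      using f01 by (auto intro!: label_mean_abs_le)
    have "(\<lambda>n. mean (label_mean \<kappa> ?f) n - mean (label_mean \<kappa> f) n) \<longlonglongrightarrow> 0"
    proof (rule mean_diff[OF continuous_label_mean[OF f'] b(2) continuous_label_mean[OF f] b(1)])
      fix x :: "('r, 'k) hypergraph"
      \<comment> \<open>The difference is 0 for |V| >= N. Otherwise it is at most 2, as both means
        are bounded by 1, and 2N/|V| exceeds that.\<close>
      show "\<bar>label_mean \<kappa> ?f x - label_mean \<kappa> f x\<bar> \<le> real (2 * N) / real (nverts x)"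
      proof (cases "N \<le> nverts x")
        case True
        then show ?thesis
          by (simp add: label_mean_relabel[OF perm])
      next
        case False
        then have "2 \<le> real (2 * N) / real (nverts x)"
          using nverts_pos[of x] by (simp add: field_simps)
        then show ?thesis
          using b[of x] by linarith
      qed
    qed
    then have "(\<integral>A. ?f A \<partial>H) - (\<integral>A. f A \<partial>H) = 0"
      using tendsto_diff[OF label_limit_mean[OF H f'] label_limit_mean[OF H f]] LIMSEQ_unique by blast
    moreover have "(\<integral>A. f A \<partial>distr H borel (relabel \<sigma>)) = (\<integral>A. ?f A \<partial>H)"
      by (rule integral_distr[OF rel borel_measurable_continuous_onI[OF f]])
    ultimately show "(\<integral>A. f A \<partial>distr H borel (relabel \<sigma>)) = (\<integral>A. f A \<partial>H)"
      by simp
  qed simp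
qed

text \<open>With equally many vertices on both sides, the injective maps act as the permutations of
  \<open>[m]\<close>. By exchangeability each has the expected weight of the identity, so averaging
  over them changes nothing.\<close>

lemma exchangeable_inj_density:
  assumes H: "exchangeable H" "prob_space H" "sets H = sets borel" and m: "m > 0"
  shows "(\<integral>A. inj_density (unlabel m F) (unlabel m A) \<partial>H) = (\<integral>A. hom_weight m F A id \<partial>H)"
proof -
  interpret H: prob_space H by fact
  have meas: "(\<lambda>A. hom_weight m F A \<phi>) \<in> borel_measurable H" for \<phi>
    unfolding measurable_cong_sets[OF H(3) refl]
    by (rule borel_measurable_continuous_onI[OF continuous_on_hom_weight])
  have int: "integrable H (\<lambda>A. hom_weight m F A \<phi>)" for \<phi>
    by (rule H.integrable_const_bound[where B = "\<Prod>v\<in>tuples m. norm (F v)", OF AE_I2 meas])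
      (simp add: hom_weight_norm_le)
  have "(\<integral>A. hom_weight m F A \<phi> \<partial>H) = (\<integral>A. hom_weight m F A id \<partial>H)" if \<phi>: "\<phi> \<in> inj_maps m m" for \<phi>
  proof -
    obtain \<tau> where \<tau>: "\<tau> permutes {..<m}" "\<And>i. i < m \<Longrightarrow> \<tau> i = \<phi> i"
      using inj_map_extends_to_permutation[OF \<phi>] by blast
    have rel: "relabel \<tau> \<in> measurable H borel"
      unfolding measurable_cong_sets[OF H(3) refl]
      by (rule borel_measurable_continuous_onI[OF continuous_on_relabel])
    have "finite {i. \<tau> i \<noteq> i}"
      by (rule finite_subset[of _ "{..<m}"]) (use \<tau>(1) in \<open>auto simp: permutes_def\<close>)
    then have inv: "distr H borel (relabel \<tau>) = H"
      using H(1) permutes_bij[OF \<tau>(1)] unfolding exchangeable_def by blast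
    have "(\<integral>A. hom_weight m F A \<phi> \<partial>H) = (\<integral>A. hom_weight m F (relabel \<tau> A) id \<partial>H)"
      unfolding hom_weight_relabel using \<tau>(2)
      by (intro Bochner_Integration.integral_cong hom_weight_cong_map) auto
    also have "\<dots> = (\<integral>A. hom_weight m F A id \<partial>distr H borel (relabel \<tau>))"
      by (rule integral_distr[OF rel borel_measurable_continuous_onI[OF continuous_on_hom_weight], symmetric])
    finally show ?thesis
      by (simp add: inv)
  qed
  moreover have "finite (inj_maps m m)"
    unfolding inj_maps_def by (simp add: finite_PiE)
  \<comment> \<open>The identity as an extensional map; it shows that the average does not divide by
    0.\<close>
  moreover have "restrict id {..<m} \<in> inj_maps m m"
    by (auto simp: inj_maps_def inj_on_def)
  ultimately show ?thesis
    using m int by (subst inj_density_unlabel) (auto simp: card_gt_0_iff)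
qed

section \<open>Construction of the limit of \<tau>^+\<close>

lemma convergent_mean_linear_span:
  assumes conv: "\<And>F. convergent (mean (hom_density F))"
    and h: "h \<in> linear_span (range hom_density)"
  shows "convergent (mean h)"
  using h
proof induction
  case (base f)
  then show ?case
    using conv by auto
next
  case (add f g)
  have "integrable M (\<lambda>\<omega>. h (G n \<omega>))" if h: "h \<in> linear_span (range hom_density)" for h n
  proof -
    obtain B where B: "\<And>x. \<bar>h x\<bar> \<le> B"
      using linear_span_hom_density_bounded[OF h] by blast
    show ?thesis
      by (rule integrable_continuous_G[OF continuous_linear_span[OF h] B]) (auto simp: continuous_hom_density)
  qed
  then have "mean (\<lambda>x. f x + g x) = (\<lambda>n. mean f n + mean g n)"
    using add.hyps by (simp add: mean_def fun_eq_iff)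
  then show ?case
    using add.IH by (simp add: convergent_add)
next
  case (scale f c)
  have "mean (\<lambda>x. c * f x) = (\<lambda>n. c * mean f n)"
    by (simp add: mean_def fun_eq_iff)
  then show ?case
    using scale.IH by (simp add: convergent_mult convergent_const)
qed

text \<open>
  \<open>coords\<close> is \<open>\<tau>\<^sup>+\<close> written in the metrizable space \<open>nat \<Rightarrow> real\<close>; \<open>decode\<close> leads back to the
  original space and clamps the coordinates so that it is continuous everywhere.
\<close>

definition coords :: "('r, 'k) hypergraph \<Rightarrow> nat \<Rightarrow> real" where
  "coords x j = (case j of 0 \<Rightarrow> 1 / real (nverts x) | Suc i \<Rightarrow> hom_density (from_nat_into (hypergraphs \<F>) i) x)"

definition decode :: "(nat \<Rightarrow> real) \<Rightarrow> ('r, 'k) tau_point" where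
  "decode y = (\<lambda>F\<in>hypergraphs \<F>. max (- 1) (min 1 (y (Suc (to_nat_on (hypergraphs \<F>) F)))), max 0 (min 1 (y 0)))"

text \<open>\<open>from_nat_into\<close> enumerates nonempty sets only. Were \<F> empty, its span
  would be {0}, which is not dense because the constant 1 is nonzero.\<close>

lemma hypergraphs_F: "hypergraphs \<F> \<noteq> ({} :: ('r, 'k \<Rightarrow>\<^sub>C real) hypergraph set)"
proof -
  have "\<F> \<noteq> {}"
  proof
    assume "\<F> = {}"
    then have "(UNIV :: ('k \<Rightarrow>\<^sub>C real) set) = {0}"
      using dense_F by simp
    then have "(const_bcontfun 1 :: 'k \<Rightarrow>\<^sub>C real) = 0"
      by blast
    then have "apply_bcontfun (const_bcontfun 1 :: 'k \<Rightarrow>\<^sub>C real) undefined = 0"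
      by simp
    then show False
      by (simp add: const_bcontfun.rep_eq)
  qed
  then obtain f where "f \<in> \<F>"
    by blast
  then have "unlabel 1 (\<lambda>_. f) \<in> (hypergraphs \<F> :: ('r, 'k \<Rightarrow>\<^sub>C real) hypergraph set)"
    by (simp add: unlabel_in_hypergraphs)
  then show ?thesis
    by blast
qed

lemma abs_coords_le: "\<bar>coords x j\<bar> \<le> 1"
  using abs_hom_density_le_1[OF norm_F from_nat_into[OF hypergraphs_F]] abs_inverse_nverts_le
  by (auto simp: coords_def split: nat.split)

lemma continuous_coords: "continuous_on UNIV coords"
proof (rule continuous_on_coordinatewise_then_product)
  show "continuous_on UNIV (\<lambda>x. coords x j)" for j
    by (cases j) (simp_all add: coords_def continuous_inverse_nverts continuous_hom_density)
qed

lemma continuous_decode: "continuous_map euclidean (tau_space \<F>) decode"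
  unfolding decode_def
proof (rule continuous_map_into_tau_space)
  show "continuous_map euclidean euclideanreal
      (\<lambda>y :: nat \<Rightarrow> real. (\<lambda>F\<in>hypergraphs \<F>. max (- 1) (min 1 (y (Suc (to_nat_on (hypergraphs \<F>) F))))) F)"
    if "F \<in> hypergraphs \<F>" for F :: "('r, 'k \<Rightarrow>\<^sub>C real) hypergraph"
    using that by (auto intro!: continuous_intros)
  show "continuous_map euclidean euclideanreal (\<lambda>y :: nat \<Rightarrow> real. max 0 (min 1 (y 0)))"
    by (auto intro!: continuous_intros)
qed auto

lemma decode_coords: "decode (coords x) = tau_plus \<F> x"
proof -
  have "max (- 1) (min 1 (coords x (Suc (to_nat_on (hypergraphs \<F>) F)))) = hom_density F x"
    if F: "F \<in> hypergraphs \<F>" for F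
    using abs_hom_density_le_1[OF norm_F F, of x] F
    by (simp add: coords_def from_nat_into_to_nat_on[OF countable_hypergraphs[OF countable_F]])
  moreover have "max 0 (min 1 (coords x 0)) = 1 / real (nverts x)"
    using one_over_nverts[of x] by (simp add: coords_def)
  ultimately show ?thesis
    by (simp add: decode_def tau_plus_def restrict_def fun_eq_iff)
qed

lemma compact_closure_coords: "compact (closure (range coords))"
proof -
  have "compactin (product_topology (\<lambda>_. euclideanreal) UNIV) (UNIV \<rightarrow>\<^sub>E {-1..1} :: (nat \<Rightarrow> real) set)"
    unfolding compactin_PiE by simp
  then have cube: "compact (UNIV \<rightarrow>\<^sub>E {-1..1} :: (nat \<Rightarrow> real) set)"
    by (simp add: euclidean_product_topology)
  moreover have "range coords \<subseteq> UNIV \<rightarrow>\<^sub>E {-1..1}"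
    using abs_coords_le by (auto simp: abs_le_iff PiE_UNIV_domain minus_le_iff)
  ultimately have "closure (range coords) \<subseteq> UNIV \<rightarrow>\<^sub>E {-1..1}"
    by (intro closure_minimal compact_imp_closed)
  then show ?thesis
    using compact_Int_closed[OF cube closed_closure[of "range coords"]] by (simp add: Int_absorb1)
qed

text \<open>The error term admits coordinate 0, that is 1/|V|, with approximant 0; the other
  coordinates are densities without error. Hence all coordinates belong to the ring, and together
  they separate points.\<close>

definition approx_ring :: "((nat \<Rightarrow> real) \<Rightarrow> real) set" where
  "approx_ring = {p. continuous_on (closure (range coords)) p \<and>
    (\<exists>h\<in>linear_span (range hom_density). \<exists>B. \<forall>x. \<bar>p (coords x) - h x\<bar> \<le> B / real (nverts x))}"

lemma approx_ringE:
  assumes "p \<in> approx_ring"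
  obtains h B where "continuous_on (closure (range coords)) p" "h \<in> linear_span (range hom_density)"
    "\<And>x. \<bar>p (coords x) - h x\<bar> \<le> B / real (nverts x)"
  using assms unfolding approx_ring_def by blast

lemma approx_ringI:
  assumes "continuous_on (closure (range coords)) p" "h \<in> linear_span (range hom_density)"
    "\<And>x. \<bar>p (coords x) - h x\<bar> \<le> B / real (nverts x)"
  shows "p \<in> approx_ring"
  using assms unfolding approx_ring_def by blast

lemma constant_linear_span: "(\<lambda>_. c) \<in> linear_span (range (hom_density :: _ \<Rightarrow> ('r, 'k) hypergraph \<Rightarrow> real))"
proof -
  have "(\<lambda>x. c * hom_density (unlabel 1 (\<lambda>_. const_bcontfun 1)) x)
      \<in> linear_span (range (hom_density :: _ \<Rightarrow> ('r, 'k) hypergraph \<Rightarrow> real))"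
    by (intro linear_span.scale linear_span.base rangeI)
  then show ?thesis
    unfolding hom_density_one by simp
qed

lemma coords_in_closure: "coords x \<in> closure (range coords)"
  by (rule subsetD[OF closure_subset]) simp

lemma approx_ring_bounded:
  assumes "p \<in> approx_ring"
  obtains C where "\<And>x. \<bar>p (coords x)\<bar> \<le> C" "C \<ge> 0"
proof -
  have "continuous_on (closure (range coords)) p"
    using assms by (rule approx_ringE)
  then have "bounded (p ` closure (range coords))"
    using compact_continuous_image compact_closure_coords compact_imp_bounded by blast
  then obtain C where "C > 0" "\<And>y. y \<in> closure (range coords) \<Longrightarrow> \<bar>p y\<bar> \<le> C"
    unfolding bounded_pos by auto
  then show thesis
    by (intro that[of C]) (auto simp: coords_in_closure)
qed

lemma function_ring_approx: "function_ring_on approx_ring (closure (range coords))"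
proof
  show "compact (closure (range coords))"
    by (rule compact_closure_coords)
  show "continuous_on (closure (range coords)) p" if "p \<in> approx_ring" for p
    using that by (rule approx_ringE)
  show "(\<lambda>_. c) \<in> approx_ring" for c
    by (rule approx_ringI[where h = "\<lambda>_. c" and B = 0]) (simp_all add: constant_linear_span)
  fix p q assume p: "p \<in> approx_ring" and q: "q \<in> approx_ring"
  obtain h B where h: "continuous_on (closure (range coords)) p" "h \<in> linear_span (range hom_density)"
    "\<And>x. \<bar>p (coords x) - h x\<bar> \<le> B / real (nverts x)"
    using p by (rule approx_ringE) (rule that)
  obtain h' B' where h': "continuous_on (closure (range coords)) q" "h' \<in> linear_span (range hom_density)"
    "\<And>x. \<bar>q (coords x) - h' x\<bar> \<le> B' / real (nverts x)"
    using q by (rule approx_ringE) (rule that)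
  show "(\<lambda>y. p y + q y) \<in> approx_ring"
  proof (rule approx_ringI[where h = "\<lambda>x. h x + h' x" and B = "B + B'"])
    show "\<bar>p (coords x) + q (coords x) - (h x + h' x)\<bar> \<le> (B + B') / real (nverts x)" for x
      using h(3)[of x] h'(3)[of x] unfolding add_divide_distrib by linarith
  qed (intro continuous_on_add linear_span.add h h')+
  \<comment> \<open>The product error is split as p (q - h') + h' (p - h), so one bound for
    \<open>p\<close> and one for \<open>h'\<close> are enough: the former from compactness, the
    latter from boundedness of densities.\<close>
  obtain C where C: "\<And>x. \<bar>p (coords x)\<bar> \<le> C" "C \<ge> 0"
    using approx_ring_bounded[OF p] by blast
  obtain D where D: "\<And>x. \<bar>h' x\<bar> \<le> D" "D \<ge> 0"
    using linear_span_hom_density_bounded[OF h'(2)] by blast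
  show "(\<lambda>y. p y * q y) \<in> approx_ring"
  proof (rule approx_ringI[where h = "\<lambda>x. h x * h' x" and B = "C * B' + D * B"])
    fix x
    have "p (coords x) * q (coords x) - h x * h' x = p (coords x) * (q (coords x) - h' x) + h' x * (p (coords x) - h x)"
      by (simp add: algebra_simps)
    also have "\<bar>\<dots>\<bar> \<le> \<bar>p (coords x)\<bar> * \<bar>q (coords x) - h' x\<bar> + \<bar>h' x\<bar> * \<bar>p (coords x) - h x\<bar>"
      by (rule order_trans[OF abs_triangle_ineq]) (simp add: abs_mult)
    also have "\<dots> \<le> C * (B' / real (nverts x)) + D * (B / real (nverts x))"
      by (intro add_mono mult_mono C D h(3) h'(3)) auto
    finally show "\<bar>p (coords x) * q (coords x) - h x * h' x\<bar> \<le> (C * B' + D * B) / real (nverts x)"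
      by (simp add: add_divide_distrib)
  qed (intro continuous_on_mult linear_span_hom_density_mult h h')+
next
  fix y z :: "nat \<Rightarrow> real" assume "y \<noteq> z"
  then obtain j where j: "y j \<noteq> z j"
    by blast
  have cont: "continuous_on (closure (range coords)) (\<lambda>y. y j)"
    using continuous_on_product_coordinates by (rule continuous_on_subset) simp
  have "(\<lambda>y. y j) \<in> approx_ring"
  proof (cases j)
    case 0
    show ?thesis
      by (rule approx_ringI[where h = "\<lambda>_. 0" and B = 1, OF cont constant_linear_span]) (simp add: 0 coords_def)
  next
    case (Suc i)
    show ?thesis
      by (rule approx_ringI[where h = "hom_density (from_nat_into (hypergraphs \<F>) i)" and B = 0, OF cont])
        (auto simp: Suc coords_def intro: linear_span.base)
  qed
  from j this show "\<exists>f\<in>approx_ring. f y \<noteq> f z"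
    by (rule bexI[where P = "\<lambda>f. f y \<noteq> f z" and x = "\<lambda>y. y j" and A = approx_ring])
qed

text \<open>The limit \<open>\<nu>\<close> is found among laws on a compact set of sequences, and
  \<open>\<Gamma>\<close> is its image under \<open>decode\<close>. Continuity of
  \<open>decode\<close> transports both the convergence and the concentration on the
  closure.\<close>

lemma exists_tau_limit:
  assumes conv: "\<And>F. convergent (mean (hom_density F))"
  shows "\<exists>\<Gamma>. tau_limit \<Gamma>"
proof -
  let ?S = "closure (range coords)"
  let ?\<mu> = "\<lambda>n. distr M borel (\<lambda>\<omega>. coords (G n \<omega>))"
  have meas: "(\<lambda>\<omega>. coords (G n \<omega>)) \<in> borel_measurable M" for n
    by (rule measurable_compose[OF random borel_measurable_continuous_onI[OF continuous_coords]])
  have AE_S: "AE y in ?\<mu> n. y \<in> ?S" for n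
    by (subst AE_distr_iff[OF meas]) (auto simp: coords_in_closure)
  have R: "convergent (\<lambda>n. \<integral>y. (if y \<in> ?S then p y else 0) \<partial>?\<mu> n)" if p: "p \<in> approx_ring" for p
  proof -
    obtain h B where h: "continuous_on ?S p" "h \<in> linear_span (range hom_density)"
      "\<And>x. \<bar>p (coords x) - h x\<bar> \<le> B / real (nverts x)"
      using p by (rule approx_ringE) (rule that)
    obtain C where C: "\<And>x. \<bar>p (coords x)\<bar> \<le> C"
      using approx_ring_bounded[OF p] by blast
    obtain D where D: "\<And>x. \<bar>h x\<bar> \<le> D"
      using linear_span_hom_density_bounded[OF h(2)] by blast
    have "continuous_on UNIV (\<lambda>x. p (coords x))"
      by (rule continuous_on_compose2[OF h(1) continuous_coords]) (auto simp: coords_in_closure)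
    moreover have "continuous_on UNIV h"
      using h(2) by (rule continuous_linear_span) (auto simp: continuous_hom_density)
    ultimately have "(\<lambda>n. mean (\<lambda>x. p (coords x)) n - mean h n) \<longlonglongrightarrow> 0"
      by (intro mean_diff[OF _ C _ D h(3)])
    then have "convergent (\<lambda>n. (mean (\<lambda>x. p (coords x)) n - mean h n) + mean h n)"
      by (intro convergent_add convergent_mean_linear_span[OF conv h(2)]) (rule convergentI)
    moreover have "(\<integral>y. (if y \<in> ?S then p y else 0) \<partial>?\<mu> n) = mean (\<lambda>x. p (coords x)) n" for n
    proof -
      have "(\<lambda>y. if y \<in> ?S then p y else 0) \<in> borel_measurable borel"
        by (rule borel_measurable_continuous_on_if) (use h(1) in auto)
      then show ?thesis
        unfolding mean_def by (subst integral_distr[OF meas]) (auto simp: coords_in_closure)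
    qed
    ultimately show ?thesis
      by simp
  qed
  obtain \<nu> where \<nu>: "prob_space \<nu>" "sets \<nu> = sets borel" "AE y in \<nu>. y \<in> ?S"
    and lim: "\<And>f :: (nat \<Rightarrow> real) \<Rightarrow> real. continuous_on ?S f \<Longrightarrow> f \<in> borel_measurable borel \<Longrightarrow>
      (\<lambda>n. \<integral>y. f y \<partial>?\<mu> n) \<longlonglongrightarrow> (\<integral>y. f y \<partial>\<nu>)"
  proof (rule compact_ring_weak_limit[OF function_ring_approx])
    show "prob_space (?\<mu> n)" "sets (?\<mu> n) = sets borel" "AE y in ?\<mu> n. y \<in> ?S" for n
      using prob_space_distr[OF meas] AE_S by simp_all
    show "convergent (\<lambda>n. \<integral>y. (if y \<in> ?S then p y else 0) \<partial>?\<mu> n)" if "p \<in> approx_ring" for p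
      by (rule R[OF that])
  qed (rule that)
  interpret \<nu>: prob_space \<nu> by fact
  have lim': "mean (\<lambda>x. f (coords x)) \<longlonglongrightarrow> (\<integral>y. f y \<partial>\<nu>)" if f: "continuous_on UNIV f"
    for f :: "(nat \<Rightarrow> real) \<Rightarrow> real"
  proof -
    have fm: "f \<in> borel_measurable borel"
      using f by (rule borel_measurable_continuous_onI)
    have "(\<lambda>n. \<integral>y. f y \<partial>?\<mu> n) \<longlonglongrightarrow> (\<integral>y. f y \<partial>\<nu>)"
      using continuous_on_subset[OF f] fm by (intro lim) auto
    moreover have "(\<integral>y. f y \<partial>?\<mu> n) = mean (\<lambda>x. f (coords x)) n" for n
      unfolding mean_def by (rule integral_distr[OF meas fm])
    ultimately show ?thesis
      by simp
  qed
  have dec: "decode \<in> measurable \<nu> (borel_of (tau_space \<F>))"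
    by (rule measurable_borel_of[OF continuous_decode]) (simp add: \<nu>(2) borel_of_euclidean)
  define \<Gamma> where "\<Gamma> = distr \<nu> (borel_of (tau_space \<F>)) decode"
  have sets_\<Gamma>: "sets \<Gamma> = sets (borel_of (tau_space \<F>))"
    by (simp add: \<Gamma>_def)
  have "law_on (tau_space \<F>) \<Gamma>"
    using \<nu>.prob_space_distr[OF dec] by (simp add: law_on_def \<Gamma>_def)
  moreover have "AE \<gamma> in \<Gamma>. \<gamma> \<in> Pi_plus_closure \<F> - Pi_plus \<F>"
  proof -
    have "AE \<gamma> in \<Gamma>. \<gamma> \<in> Pi_plus_closure \<F>"
      unfolding \<Gamma>_def
    proof (subst AE_distr_iff[OF dec])
      have "Pi_plus_closure \<F> \<in> sets (borel_of (tau_space \<F>) :: ('r, 'k) tau_point measure)"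
        by (rule closedin_sets_borel_of[OF Pi_plus_closure_closed])
      then show "{\<gamma> \<in> space (borel_of (tau_space \<F>)). \<gamma> \<in> Pi_plus_closure \<F>}
          \<in> sets (borel_of (tau_space \<F>) :: ('r, 'k) tau_point measure)"
        by (simp add: Collect_conj_eq)
      have "decode ` (euclidean closure_of range coords) \<subseteq> tau_space \<F> closure_of decode ` range coords"
        by (rule continuous_map_image_closure_subset[OF continuous_decode])
      moreover have "decode ` range coords = Pi_plus \<F>"
        by (simp add: image_image decode_coords Pi_plus_def)
      ultimately have "decode y \<in> Pi_plus_closure \<F>" if "y \<in> ?S" for y
        using that by (auto simp: Pi_plus_closure_def)
      then show "AE y in \<nu>. decode y \<in> Pi_plus_closure \<F>"
        using \<nu>(3) by (auto elim: eventually_mono)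
    qed
    \<comment> \<open>The last coordinate is nonnegative and its integral is the limit of E(1/|V|),
      which is 0.\<close>
    moreover have "AE \<gamma> in \<Gamma>. snd \<gamma> = 0"
    proof -
      have snd_meas: "snd \<in> borel_measurable (borel_of (tau_space \<F>) :: ('r, 'k) tau_point measure)"
        by (rule measurable_real_borel_of[OF continuous_map_tau_snd refl])
      have cont: "continuous_on UNIV (\<lambda>y. snd (decode y))"
        by (auto simp: decode_def intro!: continuous_intros)
      have m: "(\<lambda>y. snd (decode y)) \<in> borel_measurable \<nu>"
        by (rule measurable_compose[OF dec snd_meas])
      have "snd (decode (coords x)) = 1 / real (nverts x)" for x
        by (simp add: decode_coords tau_plus_def)
      then have "(\<integral>y. snd (decode y) \<partial>\<nu>) = 0"
        using LIMSEQ_unique[OF lim'[OF cont]] mean_inverse_nverts by simp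
      moreover have "integrable \<nu> (\<lambda>y. snd (decode y))"
        by (rule \<nu>.integrable_const_bound[where B = 1, OF _ m]) (simp add: decode_def)
      moreover have "snd (decode y) \<ge> 0" for y
        by (simp add: decode_def)
      ultimately have "AE y in \<nu>. snd (decode y) = 0"
        by (simp add: integral_nonneg_eq_0_iff_AE)
      moreover have "{\<gamma> \<in> space (borel_of (tau_space \<F>)). snd \<gamma> = 0}
          \<in> sets (borel_of (tau_space \<F>) :: ('r, 'k) tau_point measure)"
        using snd_meas by measurable
      ultimately show ?thesis
        unfolding \<Gamma>_def by (subst AE_distr_iff[OF dec])
    qed
    ultimately show ?thesis
    proof eventually_elim
      fix \<gamma> :: "('r, 'k) tau_point" assume "\<gamma> \<in> Pi_plus_closure \<F>" "snd \<gamma> = 0"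
      moreover have "snd (tau_plus \<F> x) \<noteq> 0" for x :: "('r, 'k) hypergraph"
        using nverts_pos[of x] by (simp add: tau_plus_def)
      ultimately show "\<gamma> \<in> Pi_plus_closure \<F> - Pi_plus \<F>"
        unfolding Pi_plus_def by blast
    qed
  qed
  moreover have "converges_in_law (tau_space \<F>)
      (\<lambda>n. distr M (borel_of (tau_space \<F>)) (\<lambda>\<omega>. tau_plus \<F> (G n \<omega>))) \<Gamma>"
    unfolding converges_in_law_def
  proof (intro allI impI, elim conjE)
    fix f :: "('r, 'k) tau_point \<Rightarrow> real" assume f: "continuous_map (tau_space \<F>) euclideanreal f"
    have "continuous_map euclidean euclideanreal (f \<circ> decode)"
      by (rule continuous_map_compose[OF continuous_decode f])
    then have "continuous_on UNIV (\<lambda>y. f (decode y))"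
      by (simp add: o_def)
    then have "mean (\<lambda>x. f (decode (coords x))) \<longlonglongrightarrow> (\<integral>y. f (decode y) \<partial>\<nu>)"
      by (rule lim')
    moreover have "(\<integral>y. f (decode y) \<partial>\<nu>) = (\<integral>\<gamma>. f \<gamma> \<partial>\<Gamma>)"
      unfolding \<Gamma>_def by (rule integral_distr[OF dec measurable_real_borel_of[OF f refl], symmetric])
    ultimately show "(\<lambda>n. \<integral>\<gamma>. f \<gamma> \<partial>distr M (borel_of (tau_space \<F>)) (\<lambda>\<omega>. tau_plus \<F> (G n \<omega>))) \<longlonglongrightarrow> (\<integral>\<gamma>. f \<gamma> \<partial>\<Gamma>)"
      by (simp add: integral_distr_tau_plus[OF f] decode_coords)
  qed
  ultimately show ?thesis
    unfolding tau_limit_def by blast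
qed

lemma tau_limit_iff_label_limit: "(\<exists>\<Gamma>. tau_limit \<Gamma>) \<longleftrightarrow> (\<exists>H. label_limit H)"
proof
  assume "\<exists>\<Gamma>. tau_limit \<Gamma>"
  then obtain \<Gamma> where "tau_limit \<Gamma>" ..
  then show "\<exists>H. label_limit H"
    by (intro exists_label_limit convergentI[OF tau_limit_mean])
next
  assume "\<exists>H. label_limit H"
  then obtain H where H: "label_limit H" ..
  show "\<exists>\<Gamma>. tau_limit \<Gamma>"
  proof (rule exists_tau_limit)
    fix F :: "('r, 'k \<Rightarrow>\<^sub>C real) hypergraph"
    obtain m F' where "m > 0" "F = unlabel m F'"
      by (rule hypergraph_cases)
    then show "convergent (mean (hom_density F))"
      using label_limit_hom_density_mean[OF H] by (auto intro: convergentI)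
  qed
qed

text \<open>Each side is a limit of the same sequence of mean densities; the right one is first
  rewritten as the mean of a cylinder function by exchangeability of \<open>H\<close>.\<close>

lemma limit_density:
  assumes \<Gamma>: "tau_limit \<Gamma>" and H: "label_limit H"
  shows "(\<integral>\<gamma>. t_ext \<F> F \<gamma> \<partial>\<Gamma>) = (\<integral>A. inj_density F (unlabel (nverts F) A) \<partial>H)"
proof -
  obtain m F' where F: "m > 0" "F = unlabel m F'"
    by (rule hypergraph_cases)
  have "(\<integral>\<gamma>. t_ext \<F> F \<gamma> \<partial>\<Gamma>) = (\<integral>A. hom_weight m F' A id \<partial>H)"
    using tau_limit_mean[OF \<Gamma>, of F] label_limit_hom_density_mean[OF H F(1), of F']
    unfolding F(2) by (rule LIMSEQ_unique)
  moreover have "prob_space H" "sets H = sets borel"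
    using H by (auto simp: label_limit_def law_on_def borel_of_euclidean)
  ultimately show ?thesis
    using exchangeable_inj_density[OF label_limit_exchangeable[OF H] _ _ F(1), of F'] F
    by (simp add: nverts_unlabel)
qed

end

theorem theorem3:
  fixes \<F> :: "('k::polish_space \<Rightarrow>\<^sub>C real) set"
    and M :: "'w measure"
    and G :: "nat \<Rightarrow> 'w \<Rightarrow> ('r::finite, 'k) hypergraph"
    and \<kappa> :: 'k
  assumes compact: "compact (UNIV :: 'k set)"
    and countable: "countable \<F>"
    and norm_le_1: "\<And>f. f \<in> \<F> \<Longrightarrow> norm f \<le> 1"
    and dense: "closure (span \<F>) = UNIV"
    and prob: "prob_space M"
    and random: "\<And>n. G n \<in> borel_measurable M"
    and nverts_to_infinity:
      "\<And>N. (\<lambda>n. measure M {\<omega> \<in> space M. nverts (G n \<omega>) \<le> N}) \<longlonglongrightarrow> 0"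
  defines "tau_limit \<equiv> \<lambda>\<Gamma> :: ('r, 'k) tau_point measure.
      law_on (tau_space \<F>) \<Gamma> \<and>
      (AE \<gamma> in \<Gamma>. \<gamma> \<in> Pi_plus_closure \<F> - Pi_plus \<F>) \<and>
      converges_in_law (tau_space \<F>)
        (\<lambda>n. distr M (borel_of (tau_space \<F>)) (\<lambda>\<omega>. tau_plus \<F> (G n \<omega>))) \<Gamma>"
    and "label_limit \<equiv> \<lambda>H :: (('r \<Rightarrow> nat) \<Rightarrow> 'k) measure.
      law_on euclidean H \<and>
      converges_in_law euclidean (\<lambda>n. hat_law \<kappa> M (G n)) H"
  shows "((\<exists>\<Gamma>. tau_limit \<Gamma>) \<longleftrightarrow> (\<exists>H. label_limit H)) \<and>
    (\<forall>\<Gamma> H. tau_limit \<Gamma> \<longrightarrow> label_limit H \<longrightarrow>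
       (\<forall>F :: ('r, 'k \<Rightarrow>\<^sub>C real) hypergraph.
          (\<integral>\<gamma>. t_ext \<F> F \<gamma> \<partial>\<Gamma>) = (\<integral>A. inj_density F (unlabel (nverts F) A) \<partial>H)) \<and>
       exchangeable H)"
proof -
  interpret R: random_hypergraphs M G \<F> \<kappa>
    unfolding random_hypergraphs_def random_hypergraphs_axioms_def using assms(1-7) by blast
  have "tau_limit = R.tau_limit" "label_limit = R.label_limit"
    unfolding tau_limit_def label_limit_def R.tau_limit_def R.label_limit_def by simp_all
  then show ?thesis
    using R.tau_limit_iff_label_limit R.limit_density R.label_limit_exchangeable by simp
qed

end
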